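(* Let $G=(V,E)$ be a finite connected graph with $|V|\ge3$, $x_0\in V$, $\delta>0$, let $\mathscr{S}_0$ be a non-empty decreasing subset of $\mathscr{S}$, and let $\mathbf{z}\in V_{\vec{l}(G)}$ with $\mathbf{z}^-=x_0$. For every bounded continuous function $h$ on $\mathscr{P}(V_{\vec{l}(G)})$, $$\lim_{n\to\infty}W^n_{\mathscr{S}_0}(\mathbf{z})=\inf_{\hat\mu\in\mathcal{C}l(\mathscr{S}_0)}\big\{\Lambda^{\mathbf{z}}_{\delta,\mathscr{S}_0}(\hat\mu)+h(\hat\mu)\big\}.$$
   Context: Graphs are undirected and simple; an edge is a set $uv=\{u,v\}$; $\mathfrak{b}=|E|$. Infimum over the empty set is $\infty$. Relative entropy: $R(\gamma\|\rho)=\int\frac{d\gamma}{d\rho}\log\frac{d\gamma}{d\rho}d\rho$ if $\gamma\ll\rho$, else $\infty$; $\int R(\mathbf q\|\mathbf p)\,d\hat\mu$ means $\int R(\mathbf q(\mathbf z,\cdot)\|\mathbf p(\mathbf z,\cdot))\,\hat\mu(d\mathbf z)$. $\mathscr{P}(\cdot)$ denotes probability measures with the weak topology. Walk: the $\delta$-once-reinforced random walk $(X_n)_{n\ge0}$ started at $X_0=x_0$ moves at time $n$ from $v$ to $u\sim v$ with conditional probability (given the past) $w_n(uv)/\sum_{u'\sim v}w_n(u'v)$, where $w_n(e)=\delta$ if $e\in\{X_iX_{i+1}:i<n\}$ and $w_n(e)=1$ otherwise. Line digraph: $V_{\vec l(G)}=\vec E=\{\overrightarrow{uv}:uv\in E\}$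 (both orientations of every edge). For $\mathbf z=\overrightarrow{uv}$, $\mathbf z^-=u$, $\mathbf z^+=v$, $\mathbf z|_E=uv$. Write $\mathbf z_1\to\mathbf z_2$ if $\mathbf z_1^+=\mathbf z_2^-$. For $E'\subseteq E$, $\vec{E'}=\{\overrightarrow{uv}:uv\in E'\}$. For $\hat\mu\in\mathscr{P}(V_{\vec l(G)})$, $\hat\mu|_E(E')=\hat\mu(\{\mathbf z:\mathbf z|_E\in E'\})$ for $E'\subseteq E$. Lifted process: $\mathcal Z_n=\overrightarrow{X_nX_{n+1}}$, $\mathcal L^n=\frac1n\sum_{i=0}^{n-1}\delta_{\mathcal Z_i}$. $\mathbb P_{\mathbf z},\mathbb E_{\mathbf z}$: probability and expectation conditioned on $\mathcal Z_0=\mathbf z$. For $E'\subseteq E$ and $\mathbf z_1\to\mathbf z_2$, $\mathbf p_{E'}(\mathbf z_1,\mathbf z_2)=g(\mathbf z_2)/\sum_{\mathbf z:\mathbf z_1\to\mathbf z}g(\mathbf z)$, with $g(\mathbf z)=\delta$ if $\mathbf z|_E\in E'$, $g(\mathbf z)=1$ otherwise; $\mathbf p_{E'}(\mathbf z_1,\mathbf z_2)=0$ if not $\mathbf z_1\to\mathbf z_2$. $\mathscr T_{\vec l(G)}$ is the set of transition probabilities $\mathbf q$ on $V_{\vec l(G)}$ with $\mathbf q(\mathbf z,\mathbf z')\ne0$ only if $\mathbf z\to\mathbf z'$. $\mathscr S$ is the set of edge sets $E'\subseteq E$ that contain an edge incident to $x_0$ and whose induced subgraph (edges $E'$ and their endpoints)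 is connected. $\mathscr S_0\subseteq\mathscr S$ is decreasing if for all $\hat E\subseteq\hat{\hat E}$ in $\mathscr S$, $\hat{\hat E}\in\mathscr S_0$ implies $\hat E\in\mathscr S_0$. $\mathcal Cl(\mathscr S_0)=\{\hat\mu\in\mathscr P(V_{\vec l(G)}):\operatorname{supp}(\hat\mu|_E)\subseteq E'\text{ for some }E'\in\mathscr S_0\}$. $W^n_{\mathscr S_0}(\mathbf z)=-\frac1n\log\mathbb E_{\mathbf z}\{\exp[-nh(\mathcal L^n)]\mathbf 1_{\{\mathcal L^n\in\mathcal Cl(\mathscr S_0)\}}\}$ if $\mathbb P_{\mathbf z}(\mathcal L^n\in\mathcal Cl(\mathscr S_0))>0$, and $\infty$ otherwise. $\mathscr E$ is the set of sequences $(E_k)_{1\le k\le\mathfrak b}$ of subsets of $E$ with $E_k\subset E_{k+1}$, $|E_k|=k$, $E_1=\{x_0v\}$ for some $v$, and the unique edge of $E_{k+1}\setminus E_k$ sharing a vertex with some edge of $E_k$. $\mathscr E_{\mathbf z}=\{(E_k)\in\mathscr E:E_1=\{\mathbf z|_E\}\}$. $\hat{\mathscr A}_{\mathbf z}(\hat\mu,\mathscr S_0)$ is the set of families $(\hat\mu_k,r_k,E_k,\mathbf q_k)_{1\le k\le\mathfrak b}$ with $(E_k)\in\mathscr E_{\mathbf z}$; $r_k\ge0$, $\sum_kr_k=1$, $r_l=0$ whenever $E_l\notin\mathscr S_0$; $\mathbf q_k\in\mathscr T_{\vec l(G)}$, $\hat\mu_k\in\mathscr P(V_{\vec l(G)})$,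 $\operatorname{supp}(\hat\mu_k)\subseteq\vec{E_k}$, $\hat\mu_k\mathbf q_k=\hat\mu_k$; and $\sum_kr_k\hat\mu_k=\hat\mu$. Finally $$\Lambda^{\mathbf z}_{\delta,\mathscr S_0}(\hat\mu)=\inf_{(\hat\mu_k,r_k,E_k,\mathbf q_k)_k\in\hat{\mathscr A}_{\mathbf z}(\hat\mu,\mathscr S_0)}\sum_{k=1}^{\mathfrak b}r_k\int_{V_{\vec l(G)}}R(\mathbf q_k\|\mathbf p_{E_k})\,d\hat\mu_k .$$ *)

theory Defs
  imports "HOL-Probability.Probability"
begin

definition simple_graph :: "'v set \<Rightarrow> 'v set set \<Rightarrow> bool" where
  "simple_graph V E \<longleftrightarrow> (\<forall>e\<in>E. e \<subseteq> V \<and> card e = 2)"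

definition graph_connected :: "'v set \<Rightarrow> 'v set set \<Rightarrow> bool" where
  "graph_connected V E \<longleftrightarrow> V \<noteq> {} \<and> (\<forall>u\<in>V. \<forall>v\<in>V. (u, v) \<in> {(a, b). {a, b} \<in> E}\<^sup>*)"

text \<open>The vertices of the line digraph are pairs \<open>(u, v)\<close>, read as the edge \<open>uv\<close> oriented from
  \<open>u\<close> to \<open>v\<close>.\<close>

definition arcs :: "'v set set \<Rightarrow> ('v \<times> 'v) set" where
  "arcs E = {(u, v). {u, v} \<in> E}"

definition arc_edge :: "'v \<times> 'v \<Rightarrow> 'v set" where
  "arc_edge z = {fst z, snd z}"

definition arc_step :: "'v \<times> 'v \<Rightarrow> 'v \<times> 'v \<Rightarrow> bool" where
  "arc_step z1 z2 \<longleftrightarrow> snd z1 = fst z2"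


definition probs :: "'a set \<Rightarrow> 'a pmf set" where
  "probs S = {\<mu>. set_pmf \<mu> \<subseteq> S}"

text \<open>The weak topology for a discrete space \<open>S\<close>: the coarsest topology on the probability measures
  on \<open>S\<close> for which integration of each bounded function is continuous (every function on a
  discrete space is continuous).\<close>

definition weak_topology :: "'a set \<Rightarrow> 'a pmf topology" where
  "weak_topology S = topology_generated_by
     {{\<mu> \<in> probs S. measure_pmf.expectation \<mu> f \<in> U} | (f :: 'a \<Rightarrow> real) U.
        bounded (range f) \<and> open U}"

text \<open>Relative entropy \<open>R(\<gamma>\<parallel>\<rho>)\<close>.  It is used only for measures with finite support, where the
  integral always exists; \<open>ln 0 = 0\<close> gives the convention \<open>0 log 0 = 0\<close>.\<close>

definition rel_entropy :: "'a pmf \<Rightarrow> 'a pmf \<Rightarrow> ereal" where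
  "rel_entropy \<gamma> \<rho> =
     (if absolutely_continuous (measure_pmf \<rho>) (measure_pmf \<gamma>)
      then ereal (\<integral>x. enn2real (RN_deriv (measure_pmf \<rho>) (measure_pmf \<gamma>) x) *
                      ln (enn2real (RN_deriv (measure_pmf \<rho>) (measure_pmf \<gamma>) x)) \<partial>measure_pmf \<rho>)
      else \<infinity>)"


definition walk_weight :: "real \<Rightarrow> (nat \<Rightarrow> 'v) \<Rightarrow> nat \<Rightarrow> 'v set \<Rightarrow> real" where
  "walk_weight \<delta> x n e = (if e \<in> {{x i, x (Suc i)} | i. i < n} then \<delta> else 1)"

text \<open>\<open>X\<close> is a \<open>\<delta>\<close>-once-reinforced random walk on \<open>(V, E)\<close> started at \<open>x0\<close>, defined on the
  probability space \<open>M\<close>.  As \<open>V\<close> will be finite, conditioning on the past means conditioning on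
  the possible values \<open>x 0, \<dots>, x n\<close> of the path up to time \<open>n\<close>.\<close>

definition once_reinforced_walk ::
  "'v set \<Rightarrow> 'v set set \<Rightarrow> 'v \<Rightarrow> real \<Rightarrow> 'w measure \<Rightarrow> (nat \<Rightarrow> 'w \<Rightarrow> 'v) \<Rightarrow> bool" where
  "once_reinforced_walk V E x0 \<delta> M X \<longleftrightarrow>
     prob_space M \<and>
     (\<forall>n. X n \<in> measurable M (count_space V)) \<and>
     (AE \<omega> in M. X 0 \<omega> = x0) \<and>
     (\<forall>n x u. {x n, u} \<in> E \<longrightarrow> \<P>(\<omega> in M. \<forall>i\<le>n. X i \<omega> = x i) > 0 \<longrightarrow>
        cond_prob M (\<lambda>\<omega>. X (Suc n) \<omega> = u) (\<lambda>\<omega>. \<forall>i\<le>n. X i \<omega> = x i) =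
          walk_weight \<delta> x n {x n, u} / (\<Sum>u' | {x n, u'} \<in> E. walk_weight \<delta> x n {x n, u'}))"

definition lifted :: "(nat \<Rightarrow> 'w \<Rightarrow> 'v) \<Rightarrow> nat \<Rightarrow> 'w \<Rightarrow> 'v \<times> 'v" where
  "lifted X n \<omega> = (X n \<omega>, X (Suc n) \<omega>)"

text \<open>The empirical measure is the image of the uniform distribution on the times \<open>0, \<dots>, n - 1\<close>.
  It is meaningful for \<open>n > 0\<close> only, and used only in the limit.\<close>

definition empirical :: "(nat \<Rightarrow> 'w \<Rightarrow> 'v) \<Rightarrow> nat \<Rightarrow> 'w \<Rightarrow> ('v \<times> 'v) pmf" where
  "empirical X n \<omega> = map_pmf (\<lambda>i. lifted X i \<omega>) (pmf_of_set {..<n})"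

definition walk_from :: "'w measure \<Rightarrow> (nat \<Rightarrow> 'w \<Rightarrow> 'v) \<Rightarrow> 'v \<times> 'v \<Rightarrow> 'w measure" where
  "walk_from M X z = uniform_measure M {\<omega> \<in> space M. lifted X 0 \<omega> = z}"


definition arc_weight :: "real \<Rightarrow> 'v set set \<Rightarrow> 'v \<times> 'v \<Rightarrow> real" where
  "arc_weight \<delta> E' z = (if arc_edge z \<in> E' then \<delta> else 1)"

definition base_prob :: "real \<Rightarrow> 'v set set \<Rightarrow> 'v set set \<Rightarrow> 'v \<times> 'v \<Rightarrow> 'v \<times> 'v \<Rightarrow> real" where
  "base_prob \<delta> E E' z1 z2 =
     (if z2 \<in> arcs E \<and> arc_step z1 z2
      then arc_weight \<delta> E' z2 / (\<Sum>z | z \<in> arcs E \<and> arc_step z1 z. arc_weight \<delta> E' z) else 0)"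

definition base_kernel :: "real \<Rightarrow> 'v set set \<Rightarrow> 'v set set \<Rightarrow> 'v \<times> 'v \<Rightarrow> ('v \<times> 'v) pmf" where
  "base_kernel \<delta> E E' z = embed_pmf (base_prob \<delta> E E' z)"

text \<open>A guard for \<open>embed_pmf\<close>, which is unspecified on functions that are not probability mass
  functions.\<close>

lemma pmf_base_kernel:
  assumes "finite E" "\<And>e. e \<in> E \<Longrightarrow> finite e" "\<delta> > 0" "z1 \<in> arcs E"
  shows "pmf (base_kernel \<delta> E E' z1) z2 = base_prob \<delta> E E' z1 z2"
proof -
  let ?S = "{z. z \<in> arcs E \<and> arc_step z1 z}"
  have "arcs E \<subseteq> \<Union>E \<times> \<Union>E" by (auto simp: arcs_def)
  moreover have "finite (\<Union>E)" using assms by auto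
  ultimately have fin: "finite ?S" by (auto intro: finite_subset)
  have "(snd z1, fst z1) \<in> ?S"
    using assms(4) by (auto simp: arcs_def arc_step_def insert_commute)
  hence ne: "?S \<noteq> {}" by blast
  have w: "arc_weight \<delta> E' z > 0" for z using assms(3) by (simp add: arc_weight_def)
  have pos: "(\<Sum>z\<in>?S. arc_weight \<delta> E' z) > 0" by (rule sum_pos[OF fin ne]) (rule w)
  have nn: "base_prob \<delta> E E' z1 z \<ge> 0" for z
    using pos w[of z] by (simp add: base_prob_def)
  have "(\<integral>\<^sup>+z. ennreal (base_prob \<delta> E E' z1 z) \<partial>count_space UNIV) =
        (\<Sum>z\<in>?S. ennreal (base_prob \<delta> E E' z1 z))"
    by (rule nn_integral_count_space'[OF fin]) (auto simp: base_prob_def)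
  also have "\<dots> = ennreal (\<Sum>z\<in>?S. base_prob \<delta> E E' z1 z)" by (simp add: nn sum_ennreal)
  also have "(\<Sum>z\<in>?S. base_prob \<delta> E E' z1 z) =
             (\<Sum>z\<in>?S. arc_weight \<delta> E' z / (\<Sum>z\<in>?S. arc_weight \<delta> E' z))"
    by (rule sum.cong) (auto simp: base_prob_def)
  also have "\<dots> = 1" using pos by (simp flip: sum_divide_distrib)
  finally show ?thesis unfolding base_kernel_def by (intro pmf_embed_pmf nn) simp
qed

text \<open>Only the values of a kernel at arcs of the graph are relevant.\<close>

definition transitions :: "'v set set \<Rightarrow> ('v \<times> 'v \<Rightarrow> ('v \<times> 'v) pmf) set" where
  "transitions E = {q. \<forall>z \<in> arcs E. set_pmf (q z) \<subseteq> {z' \<in> arcs E. arc_step z z'}}"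


definition rooted_edge_sets :: "'v set set \<Rightarrow> 'v \<Rightarrow> 'v set set set" where
  "rooted_edge_sets E x0 = {E'. E' \<subseteq> E \<and> (\<exists>e\<in>E'. x0 \<in> e) \<and> graph_connected (\<Union>E') E'}"

definition decreasing_family :: "'v set set \<Rightarrow> 'v \<Rightarrow> 'v set set set \<Rightarrow> bool" where
  "decreasing_family E x0 S0 \<longleftrightarrow> S0 \<subseteq> rooted_edge_sets E x0 \<and>
     (\<forall>A \<in> rooted_edge_sets E x0. \<forall>B \<in> rooted_edge_sets E x0. A \<subseteq> B \<longrightarrow> B \<in> S0 \<longrightarrow> A \<in> S0)"

definition Cl :: "'v set set \<Rightarrow> 'v set set set \<Rightarrow> ('v \<times> 'v) pmf set" where
  "Cl E S0 = {\<mu> \<in> probs (arcs E). \<exists>E'\<in>S0. set_pmf (map_pmf arc_edge \<mu>) \<subseteq> E'}"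

definition W ::
  "'v set set \<Rightarrow> 'w measure \<Rightarrow> (nat \<Rightarrow> 'w \<Rightarrow> 'v) \<Rightarrow> (('v \<times> 'v) pmf \<Rightarrow> real) \<Rightarrow> 'v set set set \<Rightarrow>
    nat \<Rightarrow> 'v \<times> 'v \<Rightarrow> ereal" where
  "W E M X h S0 n z =
     (if \<P>(\<omega> in walk_from M X z. empirical X n \<omega> \<in> Cl E S0) > 0
      then ereal (- (1 / real n) * ln (\<integral>\<omega>. exp (- real n * h (empirical X n \<omega>)) *
             indicator (Cl E S0) (empirical X n \<omega>) \<partial>walk_from M X z))
      else \<infinity>)"


text \<open>Families indexed by \<open>1 \<le> k \<le> |E|\<close> are functions on \<open>nat\<close> whose values at other
  indices are irrelevant.\<close>

definition edge_sequences :: "'v set set \<Rightarrow> 'v \<Rightarrow> (nat \<Rightarrow> 'v set set) set" where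
  "edge_sequences E x0 = {Es.
     (\<forall>k\<in>{1..card E}. Es k \<subseteq> E \<and> card (Es k) = k) \<and>
     (\<exists>v. Es 1 = {{x0, v}}) \<and>
     (\<forall>k\<in>{1..<card E}. Es k \<subset> Es (Suc k) \<and>
        (\<forall>e \<in> Es (Suc k) - Es k. \<exists>e' \<in> Es k. e \<inter> e' \<noteq> {}))}"

definition edge_sequences_from :: "'v set set \<Rightarrow> 'v \<Rightarrow> 'v \<times> 'v \<Rightarrow> (nat \<Rightarrow> 'v set set) set" where
  "edge_sequences_from E x0 z = {Es \<in> edge_sequences E x0. Es 1 = {arc_edge z}}"

definition admissible ::
  "'v set set \<Rightarrow> 'v \<Rightarrow> 'v \<times> 'v \<Rightarrow> ('v \<times> 'v) pmf \<Rightarrow> 'v set set set \<Rightarrow>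
    ((nat \<Rightarrow> ('v \<times> 'v) pmf) \<times> (nat \<Rightarrow> real) \<times> (nat \<Rightarrow> 'v set set) \<times>
     (nat \<Rightarrow> 'v \<times> 'v \<Rightarrow> ('v \<times> 'v) pmf)) set" where
  "admissible E x0 z \<mu> S0 = {(\<mu>s, r, Es, q).
     Es \<in> edge_sequences_from E x0 z \<and>
     (\<forall>k\<in>{1..card E}. r k \<ge> 0) \<and> (\<Sum>k=1..card E. r k) = 1 \<and>
     (\<forall>k\<in>{1..card E}. Es k \<notin> S0 \<longrightarrow> r k = 0) \<and>
     (\<forall>k\<in>{1..card E}. q k \<in> transitions E \<and> \<mu>s k \<in> probs (arcs E) \<and>
        set_pmf (\<mu>s k) \<subseteq> arcs (Es k) \<and> bind_pmf (\<mu>s k) (q k) = \<mu>s k) \<and>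
     (\<forall>z'. (\<Sum>k=1..card E. r k * pmf (\<mu>s k) z') = pmf \<mu> z')}"

text \<open>Relative entropies are nonnegative, so \<open>e2ennreal\<close>, which sends negative numbers to 0,
  changes nothing here.\<close>

definition rate ::
  "'v set set \<Rightarrow> 'v \<Rightarrow> real \<Rightarrow> 'v \<times> 'v \<Rightarrow> 'v set set set \<Rightarrow> ('v \<times> 'v) pmf \<Rightarrow> ereal" where
  "rate E x0 \<delta> z S0 \<mu> =
     (INF (\<mu>s, r, Es, q) \<in> admissible E x0 z \<mu> S0.
        \<Sum>k=1..card E. ereal (r k) *
          enn2ereal (\<integral>\<^sup>+z'. e2ennreal (rel_entropy (q k z') (base_kernel \<delta> E (Es k) z'))
                       \<partial>measure_pmf (\<mu>s k)))"

end

theory Submission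
  imports Defs "HOL-Real_Asymp.Real_Asymp"
begin

text \<open>
  Upper bound on probabilities: cut a path into stages, one for each set of visited edges, and count
  the transitions within each stage.  Adding boundedly many transitions from the last arc of a stage
  back to its first one makes the counts balanced, so that normalising them gives an invariant measure
  and a kernel for each stage, hence an admissible family.  The probability of the path is at most
  \<open>exp (- n * cost)\<close>, up to a constant, times its weight under the empirical kernels.  These weights
  have a polynomially bounded sum over all paths, and there are polynomially many possible counts; the
  passage from the empirical measure to the balanced one only needs uniform continuity of \<open>h\<close>.

  Lower bound: by Jensen's inequality, minus the logarithm of the expectation is at most the expected
  relative entropy plus \<open>n * h\<close> for every controlled walk.  For an admissible family take a walk which in stage \<open>k\<close>
  repeatedly picks an arc from the \<open>k\<close>-th invariant measure, moves there inside the visited edges, and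
  then follows the \<open>k\<close>-th kernel for a block of fixed length.  Independence of the blocks replaces the
  ergodic theorem, and picking the arc costs nothing because a bound that holds for every target
  holds on average.
\<close>

section \<open>The graph and the one-step probabilities\<close>

text \<open>The step law depends on the history only through the current arc and the visited edges,
  so within a stage the process is a Markov chain, and there are at most \<open>card E\<close>
  stages. Two obstacles keep a stagewise use of classical large deviations away. Membership in
  \<open>Cl E S0\<close> is an exact constraint, not an approximate one: the transitions that
  balance the counts and the connecting moves of the control must both stay inside edges already
  visited, which connectedness of the visited set permits at a cost independent of the length. And
  an invariant measure of a reducible kernel may be a mixture of which a single long run would see
  only one component; hence the control starts afresh in every block. For the lower bound
  \<open>h\<close> is replaced by its value at the target plus a quadratic function of the
  deviation, since squares can be followed through independent blocks by a backward recursion. The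
  block length \<open>l\<close> is fixed before the length of the path tends to infinity; the
  connecting moves then take a share of time of order \<open>L / (l + L)\<close>. Everything apart
  from the law of the walk is a statement on finite sums over lists of arcs.\<close>

lemma mem_arcs_iff: "a \<in> arcs A \<longleftrightarrow> arc_edge a \<in> A"
  by (cases a) (auto simp: arcs_def arc_edge_def)

lemma arc_edge_swap [simp]: "arc_edge (prod.swap a) = arc_edge a"
  by (auto simp: arc_edge_def)

lemma arc_step_swap [simp]: "arc_step a (prod.swap a)"
  by (auto simp: arc_step_def)

lemma arcs_mono: "A \<subseteq> B \<Longrightarrow> arcs A \<subseteq> arcs B"
  by (auto simp: arcs_def)

section \<open>Connectivity of edge sets and of their arcs\<close>

definition arc_rel :: "'v set set \<Rightarrow> (('v \<times> 'v) \<times> ('v \<times> 'v)) set" where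
  "arc_rel A = {(a, b). a \<in> arcs A \<and> b \<in> arcs A \<and> arc_step a b}"

text \<open>A walk in the graph from the head of \<open>a\<close> to the tail of \<open>b\<close>
  lifts to consecutive arcs. The step into \<open>b\<close> is appended even if
  \<open>b = a\<close>, so the chain has at least one step; later every closing flow therefore
  contains a transition.\<close>

lemma arc_rel_trancl:
  assumes conn: "graph_connected (\<Union>A) A" and a: "a \<in> arcs A" and b: "b \<in> arcs A"
  shows "(a, b) \<in> (arc_rel A)\<^sup>+"
proof -
  have "snd a \<in> \<Union>A" "fst b \<in> \<Union>A"
    using a b by (auto simp: mem_arcs_iff arc_edge_def)
  with conn have "(snd a, fst b) \<in> {(a, b). {a, b} \<in> A}\<^sup>*"
    by (auto simp: graph_connected_def)
  then have "\<exists>c\<in>arcs A. snd c = fst b \<and> (a, c) \<in> (arc_rel A)\<^sup>*"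
  proof (induction rule: rtrancl_induct)
    case base
    show ?case using a by blast
  next
    case (step y v)
    then obtain c where "c \<in> arcs A" "snd c = y" "(a, c) \<in> (arc_rel A)\<^sup>*" by blast
    moreover have "(c, (y, v)) \<in> arc_rel A"
      using step calculation by (auto simp: arc_rel_def arcs_def arc_step_def)
    ultimately have "(a, (y, v)) \<in> (arc_rel A)\<^sup>*" "(y, v) \<in> arcs A"
      by (meson rtrancl.rtrancl_into_rtrancl, simp add: arc_rel_def)
    then show ?case by (intro bexI[of _ "(y, v)"]) auto
  qed
  then obtain c where "c \<in> arcs A" "snd c = fst b" "(a, c) \<in> (arc_rel A)\<^sup>*" by blast
  moreover from this have "(c, b) \<in> arc_rel A"
    using b by (simp add: arc_rel_def arc_step_def)
  ultimately show ?thesis by (auto intro: rtrancl_into_trancl1)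
qed

lemma graph_connected_single: "graph_connected (\<Union>{{u, v}}) {{u, v}}"
proof -
  let ?r = "{(a, b). {a, b} \<in> {{u, v}}}"
  have "(u, v) \<in> ?r" "(v, u) \<in> ?r" by auto
  then show ?thesis unfolding graph_connected_def by (auto intro: r_into_rtrancl)
qed

text \<open>Every vertex is reached from a common vertex \<open>c\<close> of \<open>e\<close> and
  \<open>A\<close>: the old ones inside \<open>A\<close>, the other end of \<open>e\<close> along
  \<open>e\<close> itself. Symmetry of adjacency then joins any two.\<close>

lemma graph_connected_insert:
  assumes conn: "graph_connected (\<Union>A) A" and e: "card e = 2" "e \<inter> \<Union>A \<noteq> {}"
  shows "graph_connected (\<Union>(insert e A)) (insert e A)"
proof -
  let ?r = "{(a, b). {a, b} \<in> insert e A}" and ?s = "{(a, b). {a, b} \<in> A}"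
  have sub: "?s\<^sup>* \<subseteq> ?r\<^sup>*" by (rule rtrancl_mono) auto
  have symr: "(a, b) \<in> ?r\<^sup>* \<Longrightarrow> (b, a) \<in> ?r\<^sup>*" for a b
  proof -
    assume "(a, b) \<in> ?r\<^sup>*"
    moreover have "sym ?r" by (auto simp: sym_def insert_commute)
    ultimately show ?thesis by (meson sym_rtrancl symE)
  qed
  obtain c where c: "c \<in> e" "c \<in> \<Union>A" using e by blast
  have "(c, v) \<in> ?r\<^sup>*" if "v \<in> \<Union>(insert e A)" for v
  proof (cases "v \<in> \<Union>A")
    case True
    then have "(c, v) \<in> ?s\<^sup>*" using conn c unfolding graph_connected_def by blast
    then show ?thesis using sub by blast
  next
    case False
    then have "v \<in> e" "v \<noteq> c" using that c by auto
    then have "e = {c, v}" using e(1) c(1) by (auto simp: card_2_iff)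
    then show ?thesis by (intro r_into_rtrancl) auto
  qed
  then have "(u, v) \<in> ?r\<^sup>*" if "u \<in> \<Union>(insert e A)" "v \<in> \<Union>(insert e A)" for u v
    using that symr by (meson rtrancl_trans)
  moreover have "\<Union>(insert e A) \<noteq> {}" using c by blast
  ultimately show ?thesis unfolding graph_connected_def by blast
qed

text \<open>Otherwise the vertices covered by \<open>A\<close> would be closed under adjacency and
  exhaust \<open>V\<close>, and any edge outside \<open>A\<close> would meet them after all.\<close>

lemma touching_edge_exists:
  assumes G: "simple_graph V E" "graph_connected V E"
    and A: "A \<subset> E" "A \<noteq> {}"
  shows "\<exists>e \<in> E - A. e \<inter> \<Union>A \<noteq> {}"
proof (rule ccontr)
  assume no: "\<not> ?thesis"
  have E: "e \<subseteq> V" "card e = 2" if "e \<in> E" for e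
    using G(1) that unfolding simple_graph_def by blast+
  obtain e0 where e0: "e0 \<in> A" using A by blast
  then have "e0 \<in> E" using A by blast
  then have "card e0 = 2" by (rule E(2))
  then have "e0 \<noteq> {}" by auto
  then obtain u where u: "u \<in> \<Union>A" using e0 by blast
  have "v \<in> \<Union>A" if "v \<in> V" for v
  proof -
    have "u \<in> V" using u A E(1) by blast
    then have "(u, v) \<in> {(a, b). {a, b} \<in> E}\<^sup>*"
      using G(2) that unfolding graph_connected_def by blast
    then show ?thesis
    proof (induction rule: rtrancl_induct)
      case base
      show ?case by (rule u)
    next
      case (step y x)
      have "{y, x} \<in> E" using step.hyps(2) by simp
      moreover have "{y, x} \<inter> \<Union>A \<noteq> {}" using step.IH by blast
      ultimately have "{y, x} \<in> A" using no by (meson DiffI)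
      then show ?case by (meson UnionI insertCI)
    qed
  qed
  moreover obtain e where e: "e \<in> E" "e \<notin> A" using A by blast
  moreover have "e \<noteq> {}" using E(2)[OF e(1)] by auto
  ultimately show False using no E(1)[OF e(1)] by blast
qed

section \<open>One-step probabilities and a uniform lower bound\<close>

locale reinforced_graph =
  fixes V :: "'v set" and E :: "'v set set" and x0 :: 'v and \<delta> :: real and z :: "'v \<times> 'v"
  assumes finV: "finite V" and simple: "simple_graph V E" and connected: "graph_connected V E"
    and \<delta>: "\<delta> > 0" and z: "z \<in> arcs E" "fst z = x0"
begin

lemma card_edge: "e \<in> E \<Longrightarrow> card e = 2"
  using simple by (auto simp: simple_graph_def)

lemma finite_E: "finite E"
proof -
  have "E \<subseteq> Pow V" using simple by (auto simp: simple_graph_def)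
  then show ?thesis using finV by (auto intro: finite_subset)
qed

lemma finite_edge: "e \<in> E \<Longrightarrow> finite e"
  using card_edge[of e] by (auto intro: card_ge_0_finite)

lemma arcs_subset: "arcs E \<subseteq> V \<times> V"
  using simple by (auto simp: arcs_def simple_graph_def)

lemma finite_arcs [simp]: "finite (arcs E)"
  using arcs_subset finV by (auto intro: finite_subset)

lemma swap_arcs: "a \<in> arcs A \<Longrightarrow> prod.swap a \<in> arcs A"
  by (simp add: mem_arcs_iff)

abbreviation succs :: "'v \<times> 'v \<Rightarrow> ('v \<times> 'v) set" where
  "succs a \<equiv> {b. b \<in> arcs E \<and> arc_step a b}"

lemma finite_succs: "finite (succs a)"
  by (rule finite_subset[OF _ finite_arcs]) auto

lemma arc_weight_pos: "arc_weight \<delta> A b > 0"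
  using \<delta> by (simp add: arc_weight_def)

lemma sum_weight_pos:
  assumes "a \<in> arcs E" shows "(\<Sum>b\<in>succs a. arc_weight \<delta> A b) > 0"
proof (rule sum_pos[OF finite_succs])
  show "succs a \<noteq> {}" using swap_arcs[OF assms] arc_step_swap by blast
qed (rule arc_weight_pos)

lemma base_prob_nonneg: "base_prob \<delta> E A a b \<ge> 0"
  unfolding base_prob_def
  by (auto intro!: divide_nonneg_nonneg sum_nonneg less_imp_le[OF arc_weight_pos])

lemma base_prob_sum:
  assumes "a \<in> arcs E" shows "(\<Sum>b\<in>arcs E. base_prob \<delta> E A a b) = 1"
proof -
  have "(\<Sum>b\<in>arcs E. base_prob \<delta> E A a b) = (\<Sum>b\<in>succs a. base_prob \<delta> E A a b)"
    by (rule sum.mono_neutral_right) (auto simp: base_prob_def)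
  also have "\<dots> = (\<Sum>b\<in>succs a. arc_weight \<delta> A b / (\<Sum>b\<in>succs a. arc_weight \<delta> A b))"
    by (rule sum.cong) (auto simp: base_prob_def)
  also have "\<dots> = 1" using sum_weight_pos[OF assms, of A] by (simp flip: sum_divide_distrib)
  finally show ?thesis .
qed

lemma base_prob_le_1:
  assumes "a \<in> arcs E" shows "base_prob \<delta> E A a b \<le> 1"
proof (cases "b \<in> arcs E")
  case True
  then have "base_prob \<delta> E A a b \<le> (\<Sum>b\<in>arcs E. base_prob \<delta> E A a b)"
    by (intro member_le_sum) (auto simp: base_prob_nonneg)
  then show ?thesis using base_prob_sum[OF assms] by simp
qed (simp add: base_prob_def)

text \<open>The weight of an arc is at least \<open>min 1 \<delta>\<close>, and it competes with at
  most \<open>card (arcs E)\<close> weights bounded by \<open>max 1 \<delta>\<close>; the added 1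
  makes the denominator positive at once. This is the price of every single step that is inserted or
  forced later on.\<close>

definition pmin :: real where
  "pmin = min 1 \<delta> / (max 1 \<delta> * (real (card (arcs E)) + 1))"

lemma pmin_pos: "pmin > 0"
  using \<delta> by (auto simp: pmin_def)

lemma pmin_le:
  assumes "a \<in> arcs E" "b \<in> arcs E" "arc_step a b"
  shows "pmin \<le> base_prob \<delta> E A a b"
proof -
  have "(\<Sum>b\<in>succs a. arc_weight \<delta> A b) \<le> real (card (succs a)) * max 1 \<delta>"
    by (rule sum_bounded_above) (auto simp: arc_weight_def)
  also have "\<dots> \<le> (real (card (arcs E)) + 1) * max 1 \<delta>"
    using card_mono[OF finite_arcs, of "succs a"] by (intro mult_right_mono) auto
  finally have "(\<Sum>b\<in>succs a. arc_weight \<delta> A b) \<le> max 1 \<delta> * (real (card (arcs E)) + 1)"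
    by (simp add: mult.commute)
  moreover have "min 1 \<delta> \<le> arc_weight \<delta> A b" by (auto simp: arc_weight_def)
  ultimately show ?thesis
    using assms sum_weight_pos[OF assms(1), of A] \<delta>
    unfolding pmin_def base_prob_def by (auto intro!: frac_le)
qed

lemma base_prob_pos:
  "a \<in> arcs E \<Longrightarrow> b \<in> arcs E \<Longrightarrow> arc_step a b \<Longrightarrow> base_prob \<delta> E A a b > 0"
  using pmin_le pmin_pos by (meson less_le_trans)

lemma pmin_le_1: "pmin \<le> 1"
proof -
  have "max 1 \<delta> * 1 \<le> max 1 \<delta> * (real (card (arcs E)) + 1)"
    using \<delta> by (intro mult_left_mono) auto
  then have "min 1 \<delta> \<le> max 1 \<delta> * (real (card (arcs E)) + 1)" by linarith
  then show ?thesis using \<delta> unfolding pmin_def by (subst divide_le_eq_1) auto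
qed

lemma set_base_kernel:
  assumes "a \<in> arcs E" shows "set_pmf (base_kernel \<delta> E A a) = succs a"
proof (intro set_eqI iffI)
  have *: "pmf (base_kernel \<delta> E A a) b = base_prob \<delta> E A a b" for b
    by (intro pmf_base_kernel finite_E finite_edge \<delta> assms)
  show "b \<in> succs a" if "b \<in> set_pmf (base_kernel \<delta> E A a)" for b
    using that by (auto simp: set_pmf_iff * base_prob_def split: if_splits)
  show "b \<in> set_pmf (base_kernel \<delta> E A a)" if "b \<in> succs a" for b
    using base_prob_pos[OF assms, of b A] that unfolding set_pmf_iff * by auto
qed

end

section \<open>The law of the walk\<close>

text \<open>Here and below, histories are lists with the newest entry first.\<close>

primrec iter :: "'a set \<Rightarrow> ('a list \<Rightarrow> 'a \<Rightarrow> real) \<Rightarrow> ('a list \<Rightarrow> real) \<Rightarrow> nat \<Rightarrow> 'a list \<Rightarrow> real" where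
  "iter S wt F 0 w = F w"
| "iter S wt F (Suc j) w = (\<Sum>b\<in>S. wt w b * iter S wt F j (b # w))"

text \<open>The oldest entry carries weight 1 because the walk is conditioned on its first
  arc.\<close>

fun path_weight :: "('a list \<Rightarrow> 'a \<Rightarrow> real) \<Rightarrow> 'a list \<Rightarrow> real" where
  "path_weight wt (b # a # w) = wt (a # w) b * path_weight wt (a # w)"
| "path_weight wt w = 1"

lemma path_weight_Cons: "w \<noteq> [] \<Longrightarrow> path_weight wt (b # w) = wt w b * path_weight wt w"
  by (cases w) auto

lemma iter_Suc_right:
  "iter S wt F (Suc j) w = iter S wt (\<lambda>w. \<Sum>b\<in>S. wt w b * F (b # w)) j w"
proof (induction j arbitrary: w)
  case (Suc j)
  have "iter S wt F (Suc (Suc j)) w = (\<Sum>b\<in>S. wt w b * iter S wt F (Suc j) (b # w))"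
    by (rule iter.simps(2))
  also have "\<dots> = iter S wt (\<lambda>w. \<Sum>b\<in>S. wt w b * F (b # w)) (Suc j) w"
    by (simp only: Suc.IH) simp
  finally show ?case .
qed simp

text \<open>Induction on the number of steps with \<open>F\<close> generalised: the final step is
  absorbed into \<open>F\<close>, so the history \<open>w\<close> stays fixed. For a history of a
  single arc the factor in front is 1.\<close>

lemma iter_eq_sum:
  assumes "finite S" "w \<noteq> []"
  shows "path_weight wt w * iter S wt F j w =
    (\<Sum>v | set v \<subseteq> S \<and> length v = j. path_weight wt (v @ w) * F (v @ w))"
proof (induction j arbitrary: F)
  case 0
  have "{v. set v \<subseteq> S \<and> length v = 0} = {[]}" by auto
  then show ?case by simp
next
  case (Suc j)
  let ?L = "{v. set v \<subseteq> S \<and> length v = j}"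
  have "path_weight wt w * iter S wt F (Suc j) w =
      (\<Sum>v\<in>?L. path_weight wt (v @ w) * (\<Sum>b\<in>S. wt (v @ w) b * F (b # v @ w)))"
    by (simp only: iter_Suc_right Suc.IH)
  also have "\<dots> = (\<Sum>v\<in>?L. \<Sum>b\<in>S. path_weight wt (b # v @ w) * F (b # v @ w))"
    using assms(2) by (simp add: path_weight_Cons sum_distrib_left mult_ac)
  also have "\<dots> = (\<Sum>(v, b)\<in>?L \<times> S. path_weight wt (b # v @ w) * F (b # v @ w))"
    by (simp add: sum.cartesian_product)
  also have "\<dots> = (\<Sum>v | set v \<subseteq> S \<and> length v = Suc j. path_weight wt (v @ w) * F (v @ w))"
    unfolding lists_length_Suc_eq
    by (subst sum.reindex) (auto simp: inj_on_def case_prod_unfold)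
  finally show ?case .
qed

section \<open>Histories and their empirical measures\<close>

definition emp :: "'a list \<Rightarrow> 'a pmf" where
  "emp w = map_pmf (\<lambda>i. rev w ! i) (pmf_of_set {..<length w})"

lemma set_emp:
  assumes "w \<noteq> []" shows "set_pmf (emp w) = set w"
proof -
  have "set_pmf (emp w) = (\<lambda>i. rev w ! i) ` {..<length (rev w)}"
    using assms by (simp add: emp_def lessThan_empty_iff)
  also have "\<dots> = set (rev w)"
    unfolding set_conv_nth by auto
  finally show ?thesis by simp
qed

lemma pmf_emp:
  assumes "w \<noteq> []" shows "pmf (emp w) x = real (count_list w x) / real (length w)"
proof -
  have "count_list w x = card {i. i < length w \<and> rev w ! i = x}"
    using count_list_rev[of w x]
    by (simp add: count_list_eq_length_filter length_filter_conv_card eq_commute)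
  moreover have "{..<length w} \<inter> (\<lambda>i. rev w ! i) -` {x} = {i. i < length w \<and> rev w ! i = x}"
    by auto
  moreover have "{..<length w} \<noteq> {}" using assms by auto
  ultimately show ?thesis
    by (simp add: emp_def pmf_map measure_pmf_of_set)
qed

abbreviation tilt :: "'v set set \<Rightarrow> 'v set set set \<Rightarrow> (('v \<times> 'v) pmf \<Rightarrow> real) \<Rightarrow> real \<Rightarrow> ('v \<times> 'v) list \<Rightarrow> real" where
  "tilt E S0 h n w \<equiv> exp (- n * h (emp w)) * indicator (Cl E S0) (emp w)"

definition hist :: "(nat \<Rightarrow> 'w \<Rightarrow> 'v) \<Rightarrow> nat \<Rightarrow> 'w \<Rightarrow> ('v \<times> 'v) list" where
  "hist X n \<omega> = rev (map (\<lambda>i. lifted X i \<omega>) [0..<n])"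

lemma hist_0 [simp]: "hist X 0 \<omega> = []"
  and hist_Suc: "hist X (Suc n) \<omega> = lifted X n \<omega> # hist X n \<omega>"
  and length_hist [simp]: "length (hist X n \<omega>) = n"
  by (simp_all add: hist_def)

lemma set_hist: "set (hist X n \<omega>) = (\<lambda>i. lifted X i \<omega>) ` {..<n}"
  by (auto simp: hist_def)

lemma snd_hd_hist: "n \<noteq> 0 \<Longrightarrow> snd (hd (hist X n \<omega>)) = X n \<omega>"
  by (cases n) (auto simp: hist_Suc lifted_def)

lemma hist_eq_iff: "hist X n \<omega> = hist X n \<omega>' \<longleftrightarrow> (\<forall>i<n. lifted X i \<omega> = lifted X i \<omega>')"
  by (induction n) (auto simp: hist_Suc less_Suc_eq)

text \<open>Consecutive arcs share vertices, so a nonempty history determines the vertex path. An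
  empty one does not even fix \<open>X 0\<close>, whence the restriction on
  \<open>n\<close>.\<close>

lemma hist_eq_iff_pos:
  assumes "n \<noteq> 0"
  shows "hist X n \<omega> = hist X n \<omega>' \<longleftrightarrow> (\<forall>i\<le>n. X i \<omega> = X i \<omega>')"
proof -
  obtain m where n: "n = Suc m" using assms by (cases n) auto
  have "(\<forall>i<n. lifted X i \<omega> = lifted X i \<omega>') \<longleftrightarrow> (\<forall>i\<le>n. X i \<omega> = X i \<omega>')"
    unfolding lifted_def n by (auto simp: le_Suc_eq less_Suc_eq_le) (metis Suc_leI le_neq_implies_less)
  then show ?thesis by (simp add: hist_eq_iff)
qed

lemma empirical_eq_emp:
  assumes "n \<noteq> 0" shows "empirical X n \<omega> = emp (hist X n \<omega>)"
  unfolding empirical_def emp_def length_hist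
  using assms by (intro map_pmf_cong refl) (auto simp: hist_def set_pmf_of_set lessThan_empty_iff)

context reinforced_graph
begin

abbreviation visited :: "('v \<times> 'v) list \<Rightarrow> 'v set set" where
  "visited w \<equiv> arc_edge ` set w"

text \<open>The list of arcs holds everything on which the next step depends: the visited edges and
  the current arc.\<close>

definition next_prob :: "('v \<times> 'v) list \<Rightarrow> 'v \<times> 'v \<Rightarrow> real" where
  "next_prob w b = base_prob \<delta> E (visited w) (hd w) b"

lemma iter_next_prob_one:
  "w \<noteq> [] \<Longrightarrow> set w \<subseteq> arcs E \<Longrightarrow> iter (arcs E) next_prob (\<lambda>_. 1) j w = 1"
proof (induction j arbitrary: w)
  case (Suc j)
  then have "iter (arcs E) next_prob (\<lambda>_. 1) (Suc j) w = (\<Sum>b\<in>arcs E. next_prob w b)" by simp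
  also have "\<dots> = 1" unfolding next_prob_def by (rule base_prob_sum) (use Suc.prems in auto)
  finally show ?case .
qed simp

lemma next_prob_nonneg: "next_prob w b \<ge> 0"
  by (simp add: next_prob_def base_prob_nonneg)

end

section \<open>The walk on its probability space\<close>

locale reinforced_walk = reinforced_graph V E x0 \<delta> z
  for V :: "'v set" and E x0 \<delta> z +
  fixes M :: "'w measure" and X :: "nat \<Rightarrow> 'w \<Rightarrow> 'v"
  assumes walk: "once_reinforced_walk V E x0 \<delta> M X"
begin

sublocale prob_space M
  using walk by (simp add: once_reinforced_walk_def)

lemma X_event: "{\<omega> \<in> space M. X n \<omega> = a} \<in> events"
proof (cases "a \<in> V")
  case True
  have "X n -` {a} \<inter> space M \<in> events"
    using walk True by (intro measurable_sets[of _ _ "count_space V"]) (auto simp: once_reinforced_walk_def)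
  moreover have "X n -` {a} \<inter> space M = {\<omega> \<in> space M. X n \<omega> = a}" by auto
  ultimately show ?thesis by simp
next
  case False
  have "X n \<omega> \<in> V" if "\<omega> \<in> space M" for \<omega>
    using walk that measurable_space[of "X n" M "count_space V"]
    by (auto simp: once_reinforced_walk_def)
  then have "{\<omega> \<in> space M. X n \<omega> = a} = {}" using False by auto
  then show ?thesis by (metis sets.empty_sets)
qed

lemma X_in_V: "\<omega> \<in> space M \<Longrightarrow> X n \<omega> \<in> V"
  using walk measurable_space[of "X n" M "count_space V"]
  by (auto simp: once_reinforced_walk_def)

lemma hist_event: "{\<omega> \<in> space M. hist X n \<omega> = w} \<in> events"
proof (induction n arbitrary: w)
  case 0
  then show ?case by simp
next
  case (Suc n)
  show ?case
  proof (cases w)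
    case (Cons b v)
    have "{\<omega> \<in> space M. hist X (Suc n) \<omega> = w} = {\<omega> \<in> space M. X n \<omega> = fst b} \<inter>
        {\<omega> \<in> space M. X (Suc n) \<omega> = snd b} \<inter> {\<omega> \<in> space M. hist X n \<omega> = v}"
      by (auto simp: Cons hist_Suc lifted_def)
    then show ?thesis using Suc X_event by auto
  qed (simp add: hist_Suc)
qed

lemmas walk_step = walk[unfolded once_reinforced_walk_def, THEN conjunct2, THEN conjunct2,
  THEN conjunct2, rule_format]

lemma sum_walk_weight:
  assumes "arc_step a b"
  shows "(\<Sum>u' | {fst b, u'} \<in> E. f {fst b, u'}) = (\<Sum>y\<in>succs a. f (arc_edge y))"
proof (rule sum.reindex_bij_witness[of _ snd "\<lambda>u. (fst b, u)"])
qed (use assms in \<open>auto simp: arc_step_def arcs_def arc_edge_def\<close>)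

text \<open>The conditional probability from the definition of the walk, multiplied out. It must
  also hold where conditioning says nothing: for impossible histories, for arcs that do not continue
  the path and for histories of probability zero both sides vanish.\<close>

lemma prob_hist_Suc:
  assumes n: "n \<noteq> 0" and b: "b \<in> arcs E"
  shows "prob {\<omega> \<in> space M. hist X (Suc n) \<omega> = b # w} = next_prob w b * prob {\<omega> \<in> space M. hist X n \<omega> = w}"
proof (cases "{\<omega> \<in> space M. hist X n \<omega> = w} = {}")
  case True
  then have "{\<omega> \<in> space M. hist X (Suc n) \<omega> = b # w} = {}" by (auto simp: hist_Suc)
  with True show ?thesis by (metis measure_empty mult_zero_right)
next
  case False
  then obtain \<omega>0 where \<omega>0: "\<omega>0 \<in> space M" and w: "w = hist X n \<omega>0" by blast
  define x where "x i = X i \<omega>0" for i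
  have hd: "snd (hd w) = x n" using n by (simp add: w x_def snd_hd_hist)
  show ?thesis
  proof (cases "arc_step (hd w) b")
    case False
    have "{\<omega> \<in> space M. hist X (Suc n) \<omega> = b # w} = {}"
    proof (intro equals0I, clarify)
      fix \<omega> assume "hist X (Suc n) \<omega> = b # w"
      then have "fst b = X n \<omega>" "snd (hd w) = X n \<omega>"
        using snd_hd_hist[OF n, of X \<omega>] by (auto simp: hist_Suc lifted_def)
      with False show False by (simp add: arc_step_def)
    qed
    moreover have "next_prob w b = 0" using False by (simp add: next_prob_def base_prob_def)
    ultimately show ?thesis by (metis measure_empty mult_zero_left)
  next
    case True
    define u where "u = snd b"
    have fb: "fst b = x n" and b_eq: "b = (x n, u)"
      using True hd by (auto simp: arc_step_def u_def prod_eq_iff)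
    have edge: "{x n, u} \<in> E" using b b_eq by (simp add: arcs_def)
    let ?Q = "\<lambda>\<omega>. \<forall>i\<le>n. X i \<omega> = x i"
    have ev: "hist X n \<omega> = w \<longleftrightarrow> ?Q \<omega>" for \<omega>
      unfolding w x_def by (rule hist_eq_iff_pos[OF n])
    have ev': "hist X (Suc n) \<omega> = b # w \<longleftrightarrow> X (Suc n) \<omega> = u \<and> ?Q \<omega>" for \<omega>
      using ev[of \<omega>] by (auto simp: hist_Suc lifted_def b_eq)
    \<comment> \<open>A history of length \<open>n\<close> consists of the arcs at times below
      \<open>n\<close>, and these are exactly the moves that reinforce an edge before time
      \<open>n\<close>.\<close>
    have vis: "{{x i, x (Suc i)} | i. i < n} = visited w"
      by (simp add: w set_hist arc_edge_def lifted_def x_def image_image) (auto simp: image_def)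
    have ww: "walk_weight \<delta> x n e = (if e \<in> visited w then \<delta> else 1)" for e
      by (simp add: walk_weight_def vis)
    have pw: "walk_weight \<delta> x n {x n, u} / (\<Sum>u' | {x n, u'} \<in> E. walk_weight \<delta> x n {x n, u'}) = next_prob w b"
    proof -
      have "(\<Sum>u' | {x n, u'} \<in> E. walk_weight \<delta> x n {x n, u'}) =
            (\<Sum>y\<in>succs (hd w). arc_weight \<delta> (visited w) y)"
        using sum_walk_weight[OF True, of "walk_weight \<delta> x n"] by (simp add: fb ww arc_weight_def)
      moreover have "walk_weight \<delta> x n {x n, u} = arc_weight \<delta> (visited w) b"
        by (simp add: b_eq arc_weight_def ww arc_edge_def)
      ultimately show ?thesis using True b by (simp add: next_prob_def base_prob_def)
    qed
    have sub: "{\<omega> \<in> space M. X (Suc n) \<omega> = u \<and> ?Q \<omega>} \<subseteq> {\<omega> \<in> space M. ?Q \<omega>}" by auto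
    have meas: "{\<omega> \<in> space M. ?Q \<omega>} \<in> events" using hist_event[of n w] unfolding ev .
    show ?thesis
    proof (cases "prob {\<omega> \<in> space M. ?Q \<omega>} > 0")
      case True
      then have "cond_prob M (\<lambda>\<omega>. X (Suc n) \<omega> = u) ?Q = next_prob w b"
        unfolding pw[symmetric] by (intro walk_step edge)
      with True show ?thesis unfolding cond_prob_def ev ev' by (simp add: divide_eq_eq)
    next
      case False
      then have "prob {\<omega> \<in> space M. ?Q \<omega>} = 0" by (simp add: zero_less_measure_iff)
      moreover from this have "prob {\<omega> \<in> space M. X (Suc n) \<omega> = u \<and> ?Q \<omega>} = 0"
        using finite_measure_mono[OF sub meas] by (simp add: measure_le_0_iff)
      ultimately show ?thesis unfolding ev ev' by simp
    qed
  qed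
qed

abbreviation "start \<equiv> {\<omega> \<in> space M. lifted X 0 \<omega> = z}"

lemma start_eq: "start = {\<omega> \<in> space M. hist X 1 \<omega> = [z]}"
  by (auto simp: hist_Suc)

lemma start_event: "start \<in> events"
  unfolding start_eq by (rule hist_event)

text \<open>At time 0 no edge is reinforced, so the first arc is uniform among the arcs that leave
  \<open>x0\<close>.\<close>

lemma prob_start: "prob start > 0"
proof -
  let ?x = "\<lambda>_::nat. x0" and ?Q = "\<lambda>\<omega>. X 0 \<omega> = x0" and ?u = "snd z"
  have Q: "prob {\<omega> \<in> space M. ?Q \<omega>} = 1"
    using walk by (intro prob_Collect_eq_1[THEN iffD2] X_event) (auto simp: once_reinforced_walk_def)
  have e: "{x0, ?u} \<in> E" using z by (cases z) (auto simp: arcs_def)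
  have "cond_prob M (\<lambda>\<omega>. X (Suc 0) \<omega> = ?u) (\<lambda>\<omega>. \<forall>i\<le>0. X i \<omega> = ?x i) =
          walk_weight \<delta> ?x 0 {x0, ?u} / (\<Sum>u' | {x0, u'} \<in> E. walk_weight \<delta> ?x 0 {x0, u'})"
  proof -
    have "{\<omega> \<in> space M. \<forall>i\<le>0. X i \<omega> = ?x i} = {\<omega> \<in> space M. ?Q \<omega>}" by auto
    with Q have "prob {\<omega> \<in> space M. \<forall>i\<le>0. X i \<omega> = ?x i} > 0" by simp
    with e show ?thesis by (intro walk_step)
  qed
  then have "prob {\<omega> \<in> space M. X (Suc 0) \<omega> = ?u \<and> ?Q \<omega>} =
      1 / (\<Sum>u' | {x0, u'} \<in> E. 1)"
    using Q by (simp add: cond_prob_def walk_weight_def)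
  \<comment> \<open>The arcs leaving \<open>x0\<close> are the successors of the reversal of
    \<open>z\<close>, which ends in \<open>x0\<close>.\<close>
  moreover have "(\<Sum>u' | {x0, u'} \<in> E. 1::real) = (\<Sum>y\<in>succs (prod.swap z). 1)"
    using sum_walk_weight[of "prod.swap z" z "\<lambda>_. 1"] z(2) arc_step_swap[of "prod.swap z"]
    by (simp del: sum_constant)
  moreover have "z \<in> succs (prod.swap z)" using z by (simp add: arc_step_def)
  then have "(\<Sum>y\<in>succs (prod.swap z). 1::real) > 0"
    using finite_succs by (intro sum_pos) (blast | simp)+
  moreover have "start = {\<omega> \<in> space M. X (Suc 0) \<omega> = ?u \<and> ?Q \<omega>}"
    using z(2) by (auto simp: lifted_def prod_eq_iff)
  ultimately show ?thesis by simp
qed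

sublocale started: prob_space "walk_from M X z"
  unfolding walk_from_def
  using prob_start by (intro prob_space_uniform_measure) (auto simp: emeasure_eq_measure)

lemma space_from [simp]: "space (walk_from M X z) = space M"
  and sets_from [simp]: "sets (walk_from M X z) = events"
  by (simp_all add: walk_from_def)

lemma prob_from_hist:
  assumes "set v \<subseteq> arcs E" "length v = j"
  shows "started.prob {\<omega> \<in> space M. hist X (Suc j) \<omega> = v @ [z]} = path_weight next_prob (v @ [z])"
proof -
  have "prob {\<omega> \<in> space M. hist X (Suc j) \<omega> = v @ [z]} = path_weight next_prob (v @ [z]) * prob start"
    using assms
  proof (induction v arbitrary: j)
    case Nil
    then show ?case unfolding start_eq by simp
  next
    case (Cons b v)
    then obtain i where j: "j = Suc i" "length v = i" by auto
    have "prob {\<omega> \<in> space M. hist X (Suc (Suc i)) \<omega> = b # (v @ [z])} =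
        next_prob (v @ [z]) b * prob {\<omega> \<in> space M. hist X (Suc i) \<omega> = v @ [z]}"
      by (rule prob_hist_Suc) (use Cons.prems in auto)
    then show ?case using Cons j by (simp add: path_weight_Cons)
  qed
  \<comment> \<open>The last entry of the list is the arc at time 0, so the event lies inside
    \<open>start\<close> and conditioning merely divides by \<open>prob start\<close>.\<close>
  moreover have "{\<omega> \<in> space M. hist X (Suc j) \<omega> = v @ [z]} \<subseteq> start"
  proof clarify
    fix \<omega> assume "hist X (Suc j) \<omega> = v @ [z]"
    then have "last (hist X (Suc j) \<omega>) = z" by simp
    then show "lifted X 0 \<omega> = z" by (simp add: hist_def last_rev hd_map del: upt_Suc)
  qed
  then have "start \<inter> {\<omega> \<in> space M. hist X (Suc j) \<omega> = v @ [z]} = {\<omega> \<in> space M. hist X (Suc j) \<omega> = v @ [z]}"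
    by blast
  ultimately show ?thesis
    using prob_start start_event hist_event unfolding walk_from_def
    by (subst measure_uniform_measure) (auto simp: emeasure_eq_measure)
qed

text \<open>The definition of the walk prescribes the probabilities of moves along edges only. That
  nothing else happens follows by counting mass: the paths of arcs in \<open>P\<close> already carry
  total mass 1, so all other lists over \<open>V\<close> are null.\<close>

lemma integral_hist:
  fixes f :: "('v \<times> 'v) list \<Rightarrow> real"
  shows "(\<integral>\<omega>. f (hist X (Suc j) \<omega>) \<partial>walk_from M X z) = iter (arcs E) next_prob f j [z]"
proof -
  define L where "L = {w. set w \<subseteq> V \<times> V \<and> length w = Suc j}"
  define P where "P = (\<lambda>v. v @ [z]) ` {v. set v \<subseteq> arcs E \<and> length v = j}"
  let ?I = "\<lambda>w. {\<omega> \<in> space M. hist X (Suc j) \<omega> = w}"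
  have finL: "finite L" unfolding L_def by (rule finite_lists_length_eq) (simp add: finV)
  have "P \<subseteq> L"
  proof
    fix w assume "w \<in> P"
    then have "set w \<subseteq> arcs E" "length w = Suc j" using z(1) by (auto simp: P_def)
    then show "w \<in> L" using arcs_subset unfolding L_def by blast
  qed
  have hL: "hist X (Suc j) \<omega> \<in> L" if "\<omega> \<in> space M" for \<omega>
    using X_in_V that by (auto simp: L_def set_hist lifted_def)
  have int: "(\<integral>\<omega>. f (hist X (Suc j) \<omega>) \<partial>walk_from M X z) = (\<Sum>w\<in>L. f w * started.prob (?I w))" for f
  proof -
    have "(\<integral>\<omega>. f (hist X (Suc j) \<omega>) \<partial>walk_from M X z) =
        (\<integral>\<omega>. (\<Sum>w\<in>L. f w * indicator (?I w) \<omega>) \<partial>walk_from M X z)"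
    proof (rule Bochner_Integration.integral_cong[OF refl])
      fix \<omega> assume "\<omega> \<in> space (walk_from M X z)"
      then have \<omega>: "\<omega> \<in> space M" by simp
      have "(\<Sum>w\<in>L. f w * indicator (?I w) \<omega>) = (\<Sum>w\<in>{hist X (Suc j) \<omega>}. f w)"
        using hL[OF \<omega>] \<omega> finL by (intro sum.mono_neutral_cong_right) auto
      then show "f (hist X (Suc j) \<omega>) = (\<Sum>w\<in>L. f w * indicator (?I w) \<omega>)" by simp
    qed
    also have "\<dots> = (\<Sum>w\<in>L. f w * started.prob (?I w))"
      using hist_event by (subst Bochner_Integration.integral_sum) (auto simp: Int_absorb2 started.emeasure_eq_measure)
    finally show ?thesis .
  qed
  have P_sum: "(\<Sum>w\<in>P. f w * started.prob (?I w)) = iter (arcs E) next_prob f j [z]" for f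
  proof -
    have "(\<Sum>w\<in>P. f w * started.prob (?I w)) =
      (\<Sum>v | set v \<subseteq> arcs E \<and> length v = j. path_weight next_prob (v @ [z]) * f (v @ [z]))"
      unfolding P_def by (subst sum.reindex) (auto simp: inj_on_def prob_from_hist intro!: sum.cong)
    also have "\<dots> = iter (arcs E) next_prob f j [z]"
      using iter_eq_sum[OF finite_arcs, of "[z]" next_prob f j] by simp
    finally show ?thesis .
  qed
  have "(\<Sum>w\<in>P. started.prob (?I w)) = 1"
    using P_sum[of "\<lambda>_. 1"] iter_next_prob_one[of "[z]" j] z(1) by simp
  moreover have "(\<Sum>w\<in>L. started.prob (?I w)) = 1"
    using int[of "\<lambda>_. 1"] started.prob_space by simp
  ultimately have "(\<Sum>w\<in>L - P. started.prob (?I w)) = 0"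
    using sum.subset_diff[OF \<open>P \<subseteq> L\<close> finL, of "\<lambda>w. started.prob (?I w)"] by simp
  then have "\<forall>w\<in>L - P. started.prob (?I w) = 0"
    using finL by (subst (asm) sum_nonneg_eq_0_iff) auto
  then have "(\<Sum>w\<in>L. f w * started.prob (?I w)) = (\<Sum>w\<in>P. f w * started.prob (?I w))"
    using \<open>P \<subseteq> L\<close> finL by (intro sum.mono_neutral_right) auto
  then show ?thesis by (simp add: int P_sum)
qed

text \<open>From here on the walk enters only through \<open>iter\<close> with
  \<open>next_prob\<close>. The first arc is already part of the history, so
  \<open>n = Suc j\<close> leaves \<open>j\<close> steps to sum over.\<close>

lemma W_Suc:
  "W E M X h S0 (Suc j) z =
     (if iter (arcs E) next_prob (\<lambda>w. indicator (Cl E S0) (emp w)) j [z] > 0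
      then ereal (- (1 / real (Suc j)) *
        ln (iter (arcs E) next_prob (tilt E S0 h (real (Suc j))) j [z]))
      else \<infinity>)"
proof -
  let ?A = "{\<omega> \<in> space M. emp (hist X (Suc j) \<omega>) \<in> Cl E S0}"
  have "started.prob ?A = (\<integral>\<omega>. indicator ?A \<omega> \<partial>walk_from M X z)"
    by (simp add: Int_absorb2)
  also have "\<dots> = (\<integral>\<omega>. indicator (Cl E S0) (emp (hist X (Suc j) \<omega>)) \<partial>walk_from M X z)"
    by (rule Bochner_Integration.integral_cong) (auto simp: indicator_def)
  also have "\<dots> = iter (arcs E) next_prob (\<lambda>w. indicator (Cl E S0) (emp w)) j [z]"
    by (rule integral_hist)
  finally have "started.prob ?A = iter (arcs E) next_prob (\<lambda>w. indicator (Cl E S0) (emp w)) j [z]" .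
  then show ?thesis
    by (simp add: W_def empirical_eq_emp integral_hist[symmetric] del: of_nat_Suc)
qed

end

section \<open>The weak topology and relative entropy\<close>

lemma pmf_of_weights:
  assumes S: "finite S" and nn: "\<And>a. a \<in> S \<Longrightarrow> g a \<ge> 0" and sum: "(\<Sum>a\<in>S. g a) = 1"
  obtains P where "set_pmf P \<subseteq> S" "\<And>a. a \<in> S \<Longrightarrow> pmf P a = g a"
proof -
  define f where "f a = (if a \<in> S then g a else 0)" for a
  have nnf: "f a \<ge> 0" for a using nn by (simp add: f_def)
  have "(\<integral>\<^sup>+a. ennreal (f a) \<partial>count_space UNIV) = (\<Sum>a\<in>S. ennreal (f a))"
    by (rule nn_integral_count_space'[OF S]) (auto simp: f_def)
  also have "\<dots> = ennreal (\<Sum>a\<in>S. f a)" by (rule sum_ennreal) (rule nnf)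
  also have "(\<Sum>a\<in>S. f a) = 1" using sum by (simp add: f_def)
  finally have int: "(\<integral>\<^sup>+a. ennreal (f a) \<partial>count_space UNIV) = 1" by simp
  have pmf: "pmf (embed_pmf f) a = f a" for a by (rule pmf_embed_pmf[OF nnf int])
  show thesis
  proof (rule that[of "embed_pmf f"])
    show "set_pmf (embed_pmf f) \<subseteq> S" by (auto simp: set_pmf_iff pmf f_def split: if_splits)
    show "pmf (embed_pmf f) a = g a" if "a \<in> S" for a using that by (simp add: pmf f_def)
  qed
qed

lemma sum_pmf_probs: "finite S \<Longrightarrow> \<mu> \<in> probs S \<Longrightarrow> (\<Sum>a\<in>S. pmf \<mu> a) = 1"
  by (simp add: probs_def sum_pmf_eq_1)

text \<open>Induction on the generation of the topology. For a generating set the expectation is a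
  finite linear combination of point masses, hence Lipschitz in them; an intersection takes the
  smaller radius.\<close>

lemma weak_topology_nbhd:
  assumes S: "finite S" and U: "openin (weak_topology S) U" and \<mu>: "\<mu> \<in> U"
  shows "\<exists>\<eta>>0. \<forall>\<nu>\<in>probs S. (\<forall>a\<in>S. \<bar>pmf \<nu> a - pmf \<mu> a\<bar> < \<eta>) \<longrightarrow> \<nu> \<in> U"
proof -
  let ?B = "{{\<mu> \<in> probs S. measure_pmf.expectation \<mu> f \<in> U} | (f :: 'a \<Rightarrow> real) U.
        bounded (range f) \<and> open U}"
  have "generate_topology_on ?B U"
    using U unfolding weak_topology_def openin_topology_generated_by_iff .
  then show ?thesis using \<mu>
  proof (induction arbitrary: \<mu>)
    case Empty
    then show ?case by simp
  next
    case (Int A B)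
    then have "\<mu> \<in> A" "\<mu> \<in> B" by auto
    from Int.IH(1)[OF this(1)] obtain \<eta>1 where 1: "\<eta>1 > 0"
      "\<And>\<nu>. \<nu> \<in> probs S \<Longrightarrow> (\<forall>a\<in>S. \<bar>pmf \<nu> a - pmf \<mu> a\<bar> < \<eta>1) \<Longrightarrow> \<nu> \<in> A" by blast
    from Int.IH(2)[OF \<open>\<mu> \<in> B\<close>] obtain \<eta>2 where 2: "\<eta>2 > 0"
      "\<And>\<nu>. \<nu> \<in> probs S \<Longrightarrow> (\<forall>a\<in>S. \<bar>pmf \<nu> a - pmf \<mu> a\<bar> < \<eta>2) \<Longrightarrow> \<nu> \<in> B" by blast
    show ?case
    proof (intro exI[of _ "min \<eta>1 \<eta>2"] conjI ballI impI)
      fix \<nu> assume "\<nu> \<in> probs S" "\<forall>a\<in>S. \<bar>pmf \<nu> a - pmf \<mu> a\<bar> < min \<eta>1 \<eta>2"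
      then show "\<nu> \<in> A \<inter> B" using 1(2) 2(2) by simp
    qed (use 1(1) 2(1) in simp)
  next
    case (UN K)
    then obtain k where k: "k \<in> K" "\<mu> \<in> k" by blast
    from UN.IH[OF this] obtain \<eta> where "\<eta> > 0"
      "\<forall>\<nu>\<in>probs S. (\<forall>a\<in>S. \<bar>pmf \<nu> a - pmf \<mu> a\<bar> < \<eta>) \<longrightarrow> \<nu> \<in> k" by blast
    with k(1) show ?case by blast
  next
    case (Basis s)
    then obtain f :: "'a \<Rightarrow> real" and U where s: "s = {\<mu> \<in> probs S. measure_pmf.expectation \<mu> f \<in> U}"
      and U: "open U" by blast
    have ex: "measure_pmf.expectation \<nu> f = (\<Sum>a\<in>S. f a * pmf \<nu> a)" if "\<nu> \<in> probs S" for \<nu>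
      using that by (intro integral_measure_pmf_real S) (auto simp: probs_def)
    have \<mu>: "\<mu> \<in> probs S" "measure_pmf.expectation \<mu> f \<in> U" using Basis s by auto
    obtain e where e: "e > 0" "\<And>y. \<bar>y - measure_pmf.expectation \<mu> f\<bar> < e \<Longrightarrow> y \<in> U"
      using U \<mu>(2) unfolding open_dist dist_real_def by blast
    \<comment> \<open>The added 1 makes \<open>C\<close> positive even if \<open>f\<close> vanishes
      on \<open>S\<close>, and the final estimate \<open>(C - 1) * (e / C) < e\<close>
      strict.\<close>
    define C where "C = (\<Sum>a\<in>S. \<bar>f a\<bar>) + 1"
    have C: "C > 0" unfolding C_def by (intro add_nonneg_pos sum_nonneg) auto
    show ?case
    proof (intro exI[of _ "e / C"] conjI ballI impI)
      show "e / C > 0" using e C by simp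
      fix \<nu> assume \<nu>: "\<nu> \<in> probs S" and close: "\<forall>a\<in>S. \<bar>pmf \<nu> a - pmf \<mu> a\<bar> < e / C"
      have "measure_pmf.expectation \<nu> f - measure_pmf.expectation \<mu> f = (\<Sum>a\<in>S. f a * (pmf \<nu> a - pmf \<mu> a))"
        by (simp add: ex \<nu> \<mu> sum_subtractf right_diff_distrib)
      also have "\<bar>\<dots>\<bar> \<le> (\<Sum>a\<in>S. \<bar>f a * (pmf \<nu> a - pmf \<mu> a)\<bar>)" by (rule sum_abs)
      also have "\<dots> \<le> (\<Sum>a\<in>S. \<bar>f a\<bar> * (e / C))"
      proof (rule sum_mono)
        fix a assume "a \<in> S"
        then have "\<bar>pmf \<nu> a - pmf \<mu> a\<bar> \<le> e / C" using close by (simp add: less_imp_le)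
        then show "\<bar>f a * (pmf \<nu> a - pmf \<mu> a)\<bar> \<le> \<bar>f a\<bar> * (e / C)"
          unfolding abs_mult by (intro mult_left_mono) auto
      qed
      also have "\<dots> = (C - 1) * (e / C)" by (simp only: C_def sum_distrib_right[symmetric]) simp
      also have "\<dots> < e" using C e(1) by (simp add: field_simps)
      finally show "\<nu> \<in> s" using e(2) \<nu> by (simp add: s)
    qed
  qed
qed

lemma weak_continuous_at:
  assumes S: "finite S" and h: "continuous_map (weak_topology S) euclideanreal h"
    and \<mu>: "\<mu> \<in> probs S" and e: "\<epsilon> > 0"
  shows "\<exists>\<eta>>0. \<forall>\<nu>\<in>probs S. (\<forall>a\<in>S. \<bar>pmf \<nu> a - pmf \<mu> a\<bar> < \<eta>) \<longrightarrow> \<bar>h \<nu> - h \<mu>\<bar> < \<epsilon>"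
proof -
  let ?U = "{\<nu> \<in> topspace (weak_topology S). h \<nu> \<in> {h \<mu> - \<epsilon><..<h \<mu> + \<epsilon>}}"
  have "\<mu> \<in> topspace (weak_topology S)"
    using \<mu> unfolding weak_topology_def topology_generated_by_topspace
    by (intro UnionI[of "{\<mu> \<in> probs S. measure_pmf.expectation \<mu> (\<lambda>_. 0::real) \<in> UNIV}"])
       (auto intro!: exI[of _ "\<lambda>_. 0::real"] exI[of _ UNIV])
  then have "\<mu> \<in> ?U" using e by simp
  moreover have "openin (weak_topology S) ?U"
    by (rule openin_continuous_map_preimage[OF h]) (simp add: open_openin[symmetric])
  ultimately obtain \<eta> where "\<eta> > 0"
    and \<eta>: "\<forall>\<nu>\<in>probs S. (\<forall>a\<in>S. \<bar>pmf \<nu> a - pmf \<mu> a\<bar> < \<eta>) \<longrightarrow> \<nu> \<in> ?U"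
    using weak_topology_nbhd[OF S] by blast
  moreover have "\<bar>h \<nu> - h \<mu>\<bar> < \<epsilon>" if "\<nu> \<in> ?U" for \<nu> using that by (auto simp: abs_less_iff)
  ultimately show ?thesis by blast
qed

text \<open>Bolzano-Weierstrass, one coordinate at a time.\<close>

lemma finite_family_convergent_subseq:
  fixes f :: "nat \<Rightarrow> 'a \<Rightarrow> real"
  assumes "finite S" and "\<And>n a. a \<in> S \<Longrightarrow> f n a \<in> {0..1}"
  shows "\<exists>r l. strict_mono r \<and> (\<forall>a\<in>S. (\<lambda>n. f (r n) a) \<longlonglongrightarrow> l a)"
  using assms
proof (induction S rule: finite_induct)
  case empty
  show ?case by (intro exI[of _ id]) (auto simp: strict_mono_id)
next
  case (insert x S)
  then obtain r l where r: "strict_mono r" "\<forall>a\<in>S. (\<lambda>n. f (r n) a) \<longlonglongrightarrow> l a" by auto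
  have "compact {0..1::real}" by simp
  moreover have "\<forall>n. f (r n) x \<in> {0..1}" using insert.prems by simp
  ultimately obtain y s where s: "strict_mono s" "((\<lambda>n. f (r n) x) \<circ> s) \<longlonglongrightarrow> y"
    unfolding compact_eq_seq_compact_metric by (rule seq_compactE) simp
  show ?case
  proof (intro exI[of _ "r \<circ> s"] exI[of _ "l(x := y)"] conjI ballI)
    show "strict_mono (r \<circ> s)" using r(1) s(1) by (rule strict_mono_o)
    fix a assume a: "a \<in> insert x S"
    show "(\<lambda>n. f ((r \<circ> s) n) a) \<longlonglongrightarrow> (l(x := y)) a"
    proof (cases "a = x")
      case True
      then show ?thesis using s(2) by (simp add: o_def)
    next
      case False
      then have "((\<lambda>n. f (r n) a) \<circ> s) \<longlonglongrightarrow> l a"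
        using a r(2) by (intro LIMSEQ_subseq_LIMSEQ s(1)) auto
      then show ?thesis using False by (simp add: o_def)
    qed
  qed
qed

text \<open>Heine-Cantor on the simplex: along a subsequence the point masses of a counterexample
  converge, the limit has total mass 1 because the sum is finite, and continuity at this limit
  contradicts the gap \<epsilon>.\<close>

lemma weak_uniformly_continuous:
  assumes S: "finite S" and h: "continuous_map (weak_topology S) euclideanreal h" and e: "\<epsilon> > 0"
  shows "\<exists>\<eta>>0. \<forall>\<mu>\<in>probs S. \<forall>\<nu>\<in>probs S. (\<forall>a\<in>S. \<bar>pmf \<nu> a - pmf \<mu> a\<bar> < \<eta>) \<longrightarrow> \<bar>h \<nu> - h \<mu>\<bar> < \<epsilon>"
proof (rule ccontr)
  assume no: "\<not> ?thesis"
  have "\<exists>\<mu> \<nu>. \<mu> \<in> probs S \<and> \<nu> \<in> probs S \<and> (\<forall>a\<in>S. \<bar>pmf \<nu> a - pmf \<mu> a\<bar> < inverse (real (Suc n)))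
      \<and> \<bar>h \<nu> - h \<mu>\<bar> \<ge> \<epsilon>" for n
  proof -
    have "inverse (real (Suc n)) > 0" by simp
    with no show ?thesis by (meson not_less)
  qed
  then obtain \<mu> \<nu> where *: "\<And>n. \<mu> n \<in> probs S" "\<And>n. \<nu> n \<in> probs S"
    "\<And>n a. a \<in> S \<Longrightarrow> \<bar>pmf (\<nu> n) a - pmf (\<mu> n) a\<bar> < inverse (real (Suc n))"
    "\<And>n. \<bar>h (\<nu> n) - h (\<mu> n)\<bar> \<ge> \<epsilon>" by metis
  obtain r l where r: "strict_mono r" and l: "\<And>a. a \<in> S \<Longrightarrow> (\<lambda>n. pmf (\<mu> (r n)) a) \<longlonglongrightarrow> l a"
    using finite_family_convergent_subseq[OF S, of "\<lambda>n a. pmf (\<mu> n) a"] by (auto simp: pmf_le_1)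
  have l0: "l a \<ge> 0" if "a \<in> S" for a
    using l[OF that] by (rule LIMSEQ_le_const) simp
  have "(\<lambda>n. \<Sum>a\<in>S. pmf (\<mu> (r n)) a) \<longlonglongrightarrow> (\<Sum>a\<in>S. l a)" by (intro tendsto_sum l)
  then have "(\<lambda>n. 1::real) \<longlonglongrightarrow> (\<Sum>a\<in>S. l a)" using sum_pmf_probs[OF S *(1)] by simp
  then have "(\<Sum>a\<in>S. l a) = 1" by (simp add: LIMSEQ_const_iff)
  from pmf_of_weights[OF S l0 this] obtain P where P: "set_pmf P \<subseteq> S" "\<And>a. a \<in> S \<Longrightarrow> pmf P a = l a"
    by blast
  have P_probs: "P \<in> probs S" using P(1) by (simp add: probs_def)
  obtain \<eta> where \<eta>: "\<eta> > 0" "\<And>\<nu>. \<nu> \<in> probs S \<Longrightarrow> (\<forall>a\<in>S. \<bar>pmf \<nu> a - pmf P a\<bar> < \<eta>) \<Longrightarrow> \<bar>h \<nu> - h P\<bar> < \<epsilon> / 2"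
    using weak_continuous_at[OF S h P_probs, of "\<epsilon> / 2"] e by auto
  have lim\<mu>: "(\<lambda>n. pmf (\<mu> (r n)) a - pmf P a) \<longlonglongrightarrow> 0" if "a \<in> S" for a
    using tendsto_diff[OF l[OF that] tendsto_const[of "l a"]] P(2)[OF that] by simp
  have d0: "(\<lambda>n. pmf (\<nu> (r n)) a - pmf (\<mu> (r n)) a) \<longlonglongrightarrow> 0" if "a \<in> S" for a
  proof (rule Lim_null_comparison)
    show "\<forall>\<^sub>F n in sequentially. norm (pmf (\<nu> (r n)) a - pmf (\<mu> (r n)) a) \<le> inverse (real (Suc (r n)))"
      using *(3)[OF that] by (auto intro!: always_eventually less_imp_le)
    show "(\<lambda>n. inverse (real (Suc (r n)))) \<longlonglongrightarrow> 0"
      using LIMSEQ_subseq_LIMSEQ[OF LIMSEQ_inverse_real_of_nat r] by (simp add: o_def)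
  qed
  have lim\<nu>: "(\<lambda>n. pmf (\<nu> (r n)) a - pmf P a) \<longlonglongrightarrow> 0" if "a \<in> S" for a
    using tendsto_add[OF d0[OF that] lim\<mu>[OF that]] by simp
  have ev: "\<forall>\<^sub>F n in sequentially. \<forall>a\<in>S. \<bar>g n a\<bar> < \<eta>"
    if "\<And>a. a \<in> S \<Longrightarrow> (\<lambda>n. g n a) \<longlonglongrightarrow> (0::real)" for g
  proof (intro eventually_ball_finite S ballI)
    fix a assume "a \<in> S"
    from tendstoD[OF that[OF this] \<eta>(1)] show "\<forall>\<^sub>F n in sequentially. \<bar>g n a\<bar> < \<eta>" by simp
  qed
  have "\<forall>\<^sub>F n in sequentially. (\<forall>a\<in>S. \<bar>pmf (\<nu> (r n)) a - pmf P a\<bar> < \<eta>) \<and> (\<forall>a\<in>S. \<bar>pmf (\<mu> (r n)) a - pmf P a\<bar> < \<eta>)"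
    using ev[of "\<lambda>n a. pmf (\<nu> (r n)) a - pmf P a", OF lim\<nu>] ev[of "\<lambda>n a. pmf (\<mu> (r n)) a - pmf P a", OF lim\<mu>]
    by (rule eventually_conj)
  then obtain n where "\<forall>a\<in>S. \<bar>pmf (\<nu> (r n)) a - pmf P a\<bar> < \<eta>" "\<forall>a\<in>S. \<bar>pmf (\<mu> (r n)) a - pmf P a\<bar> < \<eta>"
    by (auto simp: eventually_sequentially)
  then have "\<bar>h (\<nu> (r n)) - h P\<bar> < \<epsilon> / 2" "\<bar>h (\<mu> (r n)) - h P\<bar> < \<epsilon> / 2"
    using \<eta>(2) *(1,2) by blast+
  with *(4)[of "r n"] show False by linarith
qed

text \<open>This is \<open>ln t \<le> t - 1\<close> at \<open>t = y b / (q b * X)\<close>, averaged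
  with the weights \<open>q\<close>; terms with \<open>q b = 0\<close> contribute nothing. With
  \<open>X = 1\<close> it yields nonnegativity of relative entropy, with \<open>X\<close> an
  expectation the variational bound behind the controlled walks.\<close>

lemma log_sum_ge:
  fixes q y :: "'a \<Rightarrow> real"
  assumes S: "finite S" and q: "\<And>b. b \<in> S \<Longrightarrow> q b \<ge> 0" "(\<Sum>b\<in>S. q b) = 1"
    and y: "\<And>b. b \<in> S \<Longrightarrow> y b \<ge> 0" "\<And>b. b \<in> S \<Longrightarrow> q b > 0 \<Longrightarrow> y b > 0"
    and X: "(\<Sum>b\<in>S. y b) \<le> X" "X > 0"
  shows "- ln X \<le> (\<Sum>b\<in>S. q b * ln (q b / y b))"
proof -
  have term_ge: "q b * ln (q b / y b) + q b * ln X \<ge> q b - y b / X" if b: "b \<in> S" for b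
  proof (cases "q b > 0")
    case True
    then have yb: "y b > 0" using y(2) b by simp
    have "ln (y b / (q b * X)) \<le> y b / (q b * X) - 1"
      using True yb X(2) by (intro ln_le_minus_one) auto
    moreover have "ln (y b / (q b * X)) = - (ln (q b / y b) + ln X)"
      using True yb X(2) by (simp add: ln_div ln_mult)
    ultimately have "q b * (ln (q b / y b) + ln X) \<ge> q b * (1 - y b / (q b * X))"
      using True by (intro mult_left_mono) auto
    then show ?thesis using True by (simp add: field_simps)
  next
    case False
    then have "q b = 0" using q(1)[OF b] by simp
    then show ?thesis using y(1)[OF b] X(2) by simp
  qed
  have "0 \<le> 1 - (\<Sum>b\<in>S. y b) / X" using X by simp
  also have "\<dots> = (\<Sum>b\<in>S. q b - y b / X)" by (simp add: sum_subtractf q(2) sum_divide_distrib)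
  also have "\<dots> \<le> (\<Sum>b\<in>S. q b * ln (q b / y b) + q b * ln X)" by (intro sum_mono term_ge)
  also have "\<dots> = (\<Sum>b\<in>S. q b * ln (q b / y b)) + ln X"
    by (simp add: sum.distrib q(2) flip: sum_distrib_right)
  finally show ?thesis by simp
qed

text \<open>The density is the quotient of the mass functions. The Radon-Nikodym derivative is known
  to agree with it on the support of \<rho> only; elsewhere both summands vanish by
  \<open>sub\<close>.\<close>

lemma rel_entropy_eq_sum:
  assumes S: "finite S" "set_pmf \<rho> \<subseteq> S" and sub: "set_pmf \<gamma> \<subseteq> set_pmf \<rho>"
  shows "rel_entropy \<gamma> \<rho> = ereal (\<Sum>b\<in>S. pmf \<gamma> b * ln (pmf \<gamma> b / pmf \<rho> b))"
proof -
  define f where "f b = ennreal (pmf \<gamma> b / pmf \<rho> b)" for b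
  have pw: "ennreal (pmf \<rho> b) * f b = ennreal (pmf \<gamma> b)" for b
  proof (cases "pmf \<rho> b = 0")
    case True
    then have "pmf \<gamma> b = 0" using sub by (auto simp: pmf_eq_0_set_pmf)
    with True show ?thesis by (simp add: f_def)
  next
    case False
    then show ?thesis by (simp add: f_def flip: ennreal_mult')
  qed
  have dens: "density (measure_pmf \<rho>) f = measure_pmf \<gamma>"
    unfolding measure_pmf_eq_density by (subst density_density_eq) (auto simp: pw)
  have ac: "absolutely_continuous (measure_pmf \<rho>) (measure_pmf \<gamma>)"
    unfolding dens[symmetric] by (rule absolutely_continuousI_density) simp
  have "AE x in measure_pmf \<rho>. f x = RN_deriv (measure_pmf \<rho>) (measure_pmf \<gamma>) x"
    by (rule measure_pmf.RN_deriv_unique[OF _ dens]) simp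
  then have RN: "enn2real (RN_deriv (measure_pmf \<rho>) (measure_pmf \<gamma>) x) = pmf \<gamma> x / pmf \<rho> x"
    if "x \<in> set_pmf \<rho>" for x
    using that by (simp add: AE_measure_pmf_iff f_def flip: )
      (metis enn2real_ennreal divide_nonneg_nonneg pmf_nonneg)
  have "(\<integral>x. enn2real (RN_deriv (measure_pmf \<rho>) (measure_pmf \<gamma>) x) *
                      ln (enn2real (RN_deriv (measure_pmf \<rho>) (measure_pmf \<gamma>) x)) \<partial>measure_pmf \<rho>) =
      (\<Sum>x\<in>S. enn2real (RN_deriv (measure_pmf \<rho>) (measure_pmf \<gamma>) x) *
         ln (enn2real (RN_deriv (measure_pmf \<rho>) (measure_pmf \<gamma>) x)) * pmf \<rho> x)"
    using S by (intro integral_measure_pmf_real) auto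
  also have "\<dots> = (\<Sum>x\<in>S. pmf \<gamma> x * ln (pmf \<gamma> x / pmf \<rho> x))"
  proof (rule sum.cong[OF refl])
    fix x assume "x \<in> S"
    show "enn2real (RN_deriv (measure_pmf \<rho>) (measure_pmf \<gamma>) x) *
         ln (enn2real (RN_deriv (measure_pmf \<rho>) (measure_pmf \<gamma>) x)) * pmf \<rho> x =
         pmf \<gamma> x * ln (pmf \<gamma> x / pmf \<rho> x)"
    proof (cases "x \<in> set_pmf \<rho>")
      case True
      then have "pmf \<rho> x \<noteq> 0" by (simp add: set_pmf_iff)
      then show ?thesis by (simp add: RN[OF True])
    next
      case False
      then have "pmf \<rho> x = 0" "pmf \<gamma> x = 0" using sub by (auto simp: pmf_eq_0_set_pmf)
      then show ?thesis by simp
    qed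
  qed
  finally show ?thesis using ac by (simp add: rel_entropy_def)
qed

section \<open>Relative entropies and the rate as real sums\<close>

context reinforced_graph
begin

text \<open>The base kernel charges every successor of an arc, so for a transition kernel this real
  number is the relative entropy and the infinite case never arises.\<close>

definition entropy_at :: "'v set set \<Rightarrow> ('v \<times> 'v \<Rightarrow> ('v \<times> 'v) pmf) \<Rightarrow> 'v \<times> 'v \<Rightarrow> real" where
  "entropy_at A q a = (\<Sum>b\<in>arcs E. pmf (q a) b * ln (pmf (q a) b / base_prob \<delta> E A a b))"

definition stage_cost :: "'v set set \<Rightarrow> ('v \<times> 'v) pmf \<Rightarrow> ('v \<times> 'v \<Rightarrow> ('v \<times> 'v) pmf) \<Rightarrow> real" where
  "stage_cost A \<mu> q = (\<Sum>a\<in>arcs E. pmf \<mu> a * entropy_at A q a)"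

lemma transitions_set: "q \<in> transitions E \<Longrightarrow> a \<in> arcs E \<Longrightarrow> set_pmf (q a) \<subseteq> succs a"
  by (auto simp: transitions_def)

lemma rel_entropy_base_kernel:
  assumes "q \<in> transitions E" "a \<in> arcs E"
  shows "rel_entropy (q a) (base_kernel \<delta> E A a) = ereal (entropy_at A q a)"
proof -
  have "rel_entropy (q a) (base_kernel \<delta> E A a) =
      ereal (\<Sum>b\<in>arcs E. pmf (q a) b * ln (pmf (q a) b / pmf (base_kernel \<delta> E A a) b))"
    using transitions_set[OF assms] set_base_kernel[OF assms(2), of A]
    by (intro rel_entropy_eq_sum) auto
  then show ?thesis
    using pmf_base_kernel[OF finite_E finite_edge \<delta> assms(2), of A] by (simp add: entropy_at_def)
qed

lemma entropy_at_nonneg: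
  assumes q: "q \<in> transitions E" and a: "a \<in> arcs E" shows "entropy_at A q a \<ge> 0"
proof -
  have sub: "set_pmf (q a) \<subseteq> succs a" by (rule transitions_set[OF q a])
  have "- ln 1 \<le> (\<Sum>b\<in>arcs E. pmf (q a) b * ln (pmf (q a) b / base_prob \<delta> E A a b))"
  proof (rule log_sum_ge[OF finite_arcs])
    show "(\<Sum>b\<in>arcs E. pmf (q a) b) = 1" using sub by (intro sum_pmf_eq_1) auto
    show "(\<Sum>b\<in>arcs E. base_prob \<delta> E A a b) \<le> 1" using base_prob_sum[OF a] by simp
    show "base_prob \<delta> E A a b > 0" if "b \<in> arcs E" "pmf (q a) b > 0" for b
    proof -
      have "b \<in> succs a" using that sub by (metis less_irrefl set_pmf_iff subsetD)
      then show ?thesis using a by (intro base_prob_pos) auto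
    qed
  qed (auto simp: base_prob_nonneg)
  then show ?thesis by (simp add: entropy_at_def)
qed

lemma stage_cost_nonneg: "q \<in> transitions E \<Longrightarrow> stage_cost A \<mu> q \<ge> 0"
  unfolding stage_cost_def by (intro sum_nonneg mult_nonneg_nonneg entropy_at_nonneg) auto

lemma integral_rel_entropy:
  assumes q: "q \<in> transitions E" and \<mu>: "\<mu> \<in> probs (arcs E)"
  shows "enn2ereal (\<integral>\<^sup>+a. e2ennreal (rel_entropy (q a) (base_kernel \<delta> E A a)) \<partial>measure_pmf \<mu>) =
    ereal (stage_cost A \<mu> q)"
proof -
  have "(\<integral>\<^sup>+a. e2ennreal (rel_entropy (q a) (base_kernel \<delta> E A a)) \<partial>measure_pmf \<mu>) =
      (\<Sum>a\<in>arcs E. e2ennreal (rel_entropy (q a) (base_kernel \<delta> E A a)) * pmf \<mu> a)"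
    using \<mu> by (intro nn_integral_measure_pmf_support) (auto simp: probs_def)
  also have "\<dots> = (\<Sum>a\<in>arcs E. ennreal (pmf \<mu> a * entropy_at A q a))"
    by (intro sum.cong refl)
       (auto simp: rel_entropy_base_kernel[OF q] ennreal_mult' mult.commute e2ennreal_ereal)
  also have "\<dots> = ennreal (stage_cost A \<mu> q)"
    unfolding stage_cost_def by (intro sum_ennreal mult_nonneg_nonneg entropy_at_nonneg[OF q]) auto
  finally show ?thesis using stage_cost_nonneg[OF q] by (simp add: enn2ereal_ennreal)
qed

definition plan_cost :: "(nat \<Rightarrow> ('v \<times> 'v) pmf) \<times> (nat \<Rightarrow> real) \<times> (nat \<Rightarrow> 'v set set) \<times>
     (nat \<Rightarrow> 'v \<times> 'v \<Rightarrow> ('v \<times> 'v) pmf) \<Rightarrow> real" where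
  "plan_cost = (\<lambda>(\<mu>s, r, Es, q). \<Sum>k=1..card E. r k * stage_cost (Es k) (\<mu>s k) (q k))"

text \<open>The infimum runs over real costs, so the rate is infinite only where no admissible
  family exists.\<close>

lemma rate_eq: "rate E x0 \<delta> z S0 \<mu> = (INF p \<in> admissible E x0 z \<mu> S0. ereal (plan_cost p))"
  unfolding rate_def
proof (rule INF_cong[OF refl], clarify)
  fix \<mu>s r Es q assume adm: "(\<mu>s, r, Es, q) \<in> admissible E x0 z \<mu> S0"
  have "(\<Sum>k=1..card E. ereal (r k) *
          enn2ereal (\<integral>\<^sup>+z'. e2ennreal (rel_entropy (q k z') (base_kernel \<delta> E (Es k) z'))
                       \<partial>measure_pmf (\<mu>s k))) =
     (\<Sum>k=1..card E. ereal (r k * stage_cost (Es k) (\<mu>s k) (q k)))"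
    using adm by (intro sum.cong refl) (auto simp: admissible_def integral_rel_entropy)
  then show "(\<Sum>k=1..card E. ereal (r k) *
          enn2ereal (\<integral>\<^sup>+z'. e2ennreal (rel_entropy (q k z') (base_kernel \<delta> E (Es k) z'))
                       \<partial>measure_pmf (\<mu>s k))) = ereal (plan_cost (\<mu>s, r, Es, q))"
    by (simp add: plan_cost_def)
qed

lemma plan_cost_nonneg: "p \<in> admissible E x0 z \<mu> S0 \<Longrightarrow> plan_cost p \<ge> 0"
  by (auto simp: admissible_def plan_cost_def intro!: sum_nonneg mult_nonneg_nonneg stage_cost_nonneg)

end

section \<open>The stages of a path\<close>

type_synonym 'v trans = "'v set set \<times> ('v \<times> 'v) \<times> ('v \<times> 'v)"

fun chain :: "('v \<times> 'v) list \<Rightarrow> 'v set set set" where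
  "chain [] = {}"
| "chain (b # w) = insert (arc_edge ` set (b # w)) (chain w)"

text \<open>The stage of an arc is the set of edges visited up to and including that arc, so an arc
  over a new edge belongs to the stage that it opens.\<close>

fun node_count :: "('v \<times> 'v) list \<Rightarrow> 'v set set \<Rightarrow> 'v \<times> 'v \<Rightarrow> nat" where
  "node_count [] A x = 0"
| "node_count (b # w) A x = node_count w A x + (if A = arc_edge ` set (b # w) \<and> x = b then 1 else 0)"

text \<open>A transition that crosses a new edge belongs to no stage and is not counted.\<close>

fun trans_count :: "('v \<times> 'v) list \<Rightarrow> 'v trans \<Rightarrow> nat" where
  "trans_count (b # a # w) t = trans_count (a # w) t +
     (if arc_edge b \<in> arc_edge ` set (a # w) \<and> t = (arc_edge ` set (a # w), a, b) then 1 else 0)"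
| "trans_count w t = 0"

lemma trans_count_Cons:
  "w \<noteq> [] \<Longrightarrow> trans_count (b # w) t = trans_count w t +
     (if arc_edge b \<in> arc_edge ` set w \<and> t = (arc_edge ` set w, hd w, b) then 1 else 0)"
  by (cases w) auto

lemma chain_subset: "A \<in> chain w \<Longrightarrow> A \<subseteq> arc_edge ` set w"
  by (induction w) auto

lemma visited_in_chain: "w \<noteq> [] \<Longrightarrow> arc_edge ` set w \<in> chain w"
  by (cases w) auto

lemma node_count_chain: "node_count w A x \<noteq> 0 \<Longrightarrow> A \<in> chain w"
  by (induction w) (auto split: if_splits)

lemma sum_node_count:
  assumes "finite \<A>" "chain w \<subseteq> \<A>" shows "(\<Sum>A\<in>\<A>. node_count w A x) = count_list w x"
  using assms(2)
proof (induction w)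
  case (Cons b w)
  have "(\<Sum>A\<in>\<A>. if A = arc_edge ` set (b # w) \<and> x = b then 1 else 0) =
      (\<Sum>A\<in>\<A>. if A = arc_edge ` set (b # w) then (if x = b then 1 else 0 :: nat) else 0)"
    by (intro sum.cong) auto
  also have "\<dots> = (if x = b then 1 else 0)"
    using Cons.prems assms(1) by (subst sum.delta) auto
  finally show ?case using Cons by (auto simp: sum.distrib simp del: list.set)
qed simp

declare chain.simps(2) [simp del] node_count.simps(2) [simp del]

section \<open>Sequences of growing edge sets\<close>

context reinforced_graph
begin

text \<open>An initial segment of an edge sequence that starts with the edge of \<open>z\<close>.
  Segments are needed because a path reveals its edge sets one at a time and may never use all of
  \<open>E\<close>.\<close>

definition growth :: "nat \<Rightarrow> (nat \<Rightarrow> 'v set set) \<Rightarrow> bool" where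
  "growth m Es \<longleftrightarrow> Es 1 = {arc_edge z} \<and> (\<forall>k\<in>{1..m}. Es k \<subseteq> E \<and> card (Es k) = k) \<and>
     (\<forall>k\<in>{1..<m}. Es k \<subset> Es (Suc k) \<and> (\<forall>e \<in> Es (Suc k) - Es k. \<exists>e' \<in> Es k. e \<inter> e' \<noteq> {}))"

lemma growth_card: "growth m Es \<Longrightarrow> 1 \<le> k \<Longrightarrow> k \<le> m \<Longrightarrow> Es k \<subseteq> E \<and> card (Es k) = k"
  by (simp add: growth_def)

lemma arc_edge_z: "arc_edge z \<in> E"
  using z(1) by (simp add: mem_arcs_iff)

lemma card_E_pos: "card E \<ge> 1"
proof -
  have "card E \<noteq> 0" using arc_edge_z finite_E by auto
  then show ?thesis by simp
qed

lemma edge_sequences_from_iff: "Es \<in> edge_sequences_from E x0 z \<longleftrightarrow> growth (card E) Es"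
proof -
  have "arc_edge z = {x0, snd z}" using z(2) by (simp add: arc_edge_def)
  then show ?thesis
    by (auto simp: edge_sequences_from_def edge_sequences_def growth_def)
qed

lemma growth_1: "growth 1 (\<lambda>_. {arc_edge z})"
  using arc_edge_z by (auto simp: growth_def)

lemma growth_Suc:
  assumes g: "growth m Es" and m: "m \<ge> 1" and e: "e \<in> E" "e \<notin> Es m" "e \<inter> \<Union>(Es m) \<noteq> {}"
  shows "growth (Suc m) (Es(Suc m := insert e (Es m)))"
proof -
  let ?Es = "Es(Suc m := insert e (Es m))"
  have Em: "Es m \<subseteq> E" "card (Es m) = m" using g m by (auto simp: growth_def)
  have "finite (Es m)" using Em(1) finite_E by (rule finite_subset)
  then have c: "card (insert e (Es m)) = Suc m" using e Em by simp
  have 1: "?Es 1 = {arc_edge z}" using g m by (simp add: growth_def)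
  have 2: "?Es k \<subseteq> E \<and> card (?Es k) = k" if "k \<in> {1..Suc m}" for k
    using that g c e(1) Em by (cases "k = Suc m") (auto simp: growth_def)
  have 3: "?Es k \<subset> ?Es (Suc k) \<and> (\<forall>e \<in> ?Es (Suc k) - ?Es k. \<exists>e' \<in> ?Es k. e \<inter> e' \<noteq> {})"
    if "k \<in> {1..<Suc m}" for k
  proof (cases "k = m")
    case True
    then show ?thesis using e by auto
  next
    case False
    then have "k \<in> {1..<m}" using that by auto
    then show ?thesis using g by (auto simp: growth_def)
  qed
  show ?thesis unfolding growth_def by (intro conjI 1 ballI 2) (use 3 in blast)+
qed

lemma growth_mono:
  assumes g: "growth m Es" shows "1 \<le> i \<Longrightarrow> i \<le> j \<Longrightarrow> j \<le> m \<Longrightarrow> Es i \<subseteq> Es j"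
proof (induction j)
  case (Suc j)
  show ?case
  proof (cases "i = Suc j")
    case False
    then have "Es j \<subset> Es (Suc j)" using Suc.prems g by (auto simp: growth_def)
    then show ?thesis using Suc False by auto
  qed simp
qed simp

text \<open>By cardinality each step adds a single edge, and this edge touches the earlier
  ones.\<close>

lemma growth_connected:
  assumes g: "growth m Es" and k: "1 \<le> k" "k \<le> m"
  shows "graph_connected (\<Union>(Es k)) (Es k)"
  using k
proof (induction k rule: dec_induct)
  case base
  show ?case using g graph_connected_single[of "fst z" "snd z"]
    by (simp add: growth_def arc_edge_def)
next
  case (step k)
  have sub: "Es k \<subset> Es (Suc k)" "\<forall>e \<in> Es (Suc k) - Es k. \<exists>e' \<in> Es k. e \<inter> e' \<noteq> {}"
    using g step by (auto simp: growth_def)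
  have c: "Es (Suc k) \<subseteq> E" "card (Es k) = k" "card (Es (Suc k)) = Suc k"
    using g step by (auto simp: growth_def)
  have fin: "finite (Es (Suc k))" using c(1) finite_E by (rule finite_subset)
  have "card (Es (Suc k) - Es k) = 1"
    using sub(1) c fin by (subst card_Diff_subset) (auto intro: finite_subset)
  then obtain e where e: "Es (Suc k) - Es k = {e}" by (meson card_1_singletonE)
  then have ins: "Es (Suc k) = insert e (Es k)" using sub(1) by blast
  obtain e' where "e' \<in> Es k" "e \<inter> e' \<noteq> {}" using e sub(2) by blast
  then have "e \<inter> \<Union>(Es k) \<noteq> {}" by blast
  moreover have "card e = 2" using card_edge ins c(1) by blast
  ultimately show ?case unfolding ins using step by (intro graph_connected_insert) auto
qed

lemma growth_rooted:
  assumes "growth m Es" "1 \<le> k" "k \<le> m" shows "Es k \<in> rooted_edge_sets E x0"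
proof -
  have "Es 1 \<subseteq> Es k" using growth_mono[OF assms(1), of 1 k] assms by simp
  then have "arc_edge z \<in> Es k" using assms(1) by (simp add: growth_def)
  moreover have "x0 \<in> arc_edge z" using z(2) by (simp add: arc_edge_def)
  moreover have "Es k \<subseteq> E" using assms by (auto simp: growth_def)
  ultimately show ?thesis
    using growth_connected[OF assms] unfolding rooted_edge_sets_def by blast
qed

text \<open>An admissible family needs a sequence of full length. The stages added here are
  arbitrary; those beyond the path later receive weight 0.\<close>

lemma growth_extend:
  assumes "growth m Es" "1 \<le> m" "m \<le> card E"
  shows "\<exists>Es'. growth (card E) Es' \<and> (\<forall>k\<le>m. Es' k = Es k)"
  using assms
proof (induction "card E - m" arbitrary: m Es)
  case 0
  then have "m = card E" by simp
  then show ?case using 0 by blast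
next
  case (Suc i)
  have Em: "Es m \<subseteq> E" "card (Es m) = m" using Suc.prems by (auto simp: growth_def)
  have "Es m \<noteq> E" using Suc.hyps(2) Em(2) by auto
  moreover have "Es m \<noteq> {}" using Em(2) Suc.prems by auto
  ultimately obtain e where e: "e \<in> E - Es m" "e \<inter> \<Union>(Es m) \<noteq> {}"
    using touching_edge_exists[OF simple connected, of "Es m"] Em(1) by blast
  have "growth (Suc m) (Es(Suc m := insert e (Es m)))"
    using growth_Suc Suc.prems e by blast
  moreover have "i = card E - Suc m" "Suc m \<le> card E" using Suc.hyps(2) by simp_all
  ultimately obtain Es' where Es': "growth (card E) Es'" "\<forall>k\<le>Suc m. Es' k = (Es(Suc m := insert e (Es m))) k"
    using Suc.hyps(1)[of "Suc m" "Es(Suc m := insert e (Es m))"] by force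
  have "\<forall>k\<le>m. Es' k = Es k" using Es'(2) by simp
  with Es'(1) show ?case by blast
qed

section \<open>Paths, their stages and their transitions\<close>

inductive is_path :: "('v \<times> 'v) list \<Rightarrow> bool" where
  base: "is_path [z]"
| step: "is_path w \<Longrightarrow> b \<in> arcs E \<Longrightarrow> arc_step (hd w) b \<Longrightarrow> is_path (b # w)"

lemma is_path_nonempty: "is_path w \<Longrightarrow> w \<noteq> []"
  by (induction rule: is_path.induct) auto

lemma is_path_arcs: "is_path w \<Longrightarrow> set w \<subseteq> arcs E"
  by (induction rule: is_path.induct) (use z(1) in auto)

lemma is_path_hd: "is_path w \<Longrightarrow> hd w \<in> arcs E"
  by (rule subsetD[OF is_path_arcs hd_in_set[OF is_path_nonempty]])

lemma is_pathI:
  "set v \<subseteq> arcs E \<Longrightarrow> path_weight next_prob (v @ [z]) > 0 \<Longrightarrow> is_path (v @ [z])"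
proof (induction v)
  case (Cons b v)
  have "path_weight next_prob (b # v @ [z]) = next_prob (v @ [z]) b * path_weight next_prob (v @ [z])"
    by (rule path_weight_Cons) simp
  moreover have "path_weight next_prob (v @ [z]) \<ge> 0"
    by (induction v) (auto simp: path_weight_Cons next_prob_nonneg)
  ultimately have "path_weight next_prob (v @ [z]) > 0" "next_prob (v @ [z]) b \<noteq> 0"
    using Cons.prems(2) by (auto simp: zero_less_mult_iff)
  moreover from this have "arc_step (hd (v @ [z])) b" by (simp add: next_prob_def base_prob_def split: if_splits)
  ultimately show ?case using Cons by (auto intro: is_path.step)
qed (simp add: is_path.base)

text \<open>An arc starts where the previous one ends, so an edge entered for the first time touches
  the visited set and prolongs the sequence.\<close>

lemma path_growth:
  assumes "is_path w"
  shows "\<exists>m Es. 1 \<le> m \<and> m \<le> card E \<and> growth m Es \<and> Es m = visited w \<and> chain w \<subseteq> Es ` {1..m}"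
  using assms
proof induction
  case base
  have "1 \<le> card E" by (rule card_E_pos)
  then show ?case using growth_1
    by (intro exI[of _ 1] exI[of _ "\<lambda>_. {arc_edge z}"]) (auto simp: chain.simps)
next
  case (step w b)
  then obtain m Es where IH: "1 \<le> m" "m \<le> card E" "growth m Es" "Es m = visited w" "chain w \<subseteq> Es ` {1..m}"
    by blast
  show ?case
  proof (cases "arc_edge b \<in> visited w")
    case True
    then have vis: "visited (b # w) = visited w" by auto
    moreover from this have "chain (b # w) \<subseteq> Es ` {1..m}"
    proof -
      have "Es m \<in> Es ` {1..m}" using IH(1) by simp
      then show ?thesis unfolding chain.simps(2) vis using IH(4,5) by simp
    qed
    ultimately show ?thesis using IH by (intro exI[of _ m] exI[of _ Es] conjI) simp_all
  next
    case False
    let ?Es = "Es(Suc m := insert (arc_edge b) (Es m))"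
    have eE: "arc_edge b \<in> E" using step.hyps(2) by (simp add: mem_arcs_iff)
    have hd: "arc_edge (hd w) \<in> visited w" using is_path_nonempty[OF step.hyps(1)] by simp
    have "fst b \<in> arc_edge b \<inter> arc_edge (hd w)" using step.hyps(3) by (simp add: arc_edge_def arc_step_def)
    then have "arc_edge b \<inter> \<Union>(Es m) \<noteq> {}" using hd IH(4) by blast
    then have g: "growth (Suc m) ?Es" using growth_Suc[OF IH(3,1) eE] False IH(4) by simp
    then have c: "?Es (Suc m) \<subseteq> E" "card (?Es (Suc m)) = Suc m"
      using growth_card[OF g, of "Suc m"] by simp_all
    have le: "Suc m \<le> card E" using card_mono[OF finite_E c(1)] unfolding c(2) .
    have vis: "visited (b # w) = ?Es (Suc m)" using IH(4) by simp
    have "chain w \<subseteq> ?Es ` {1..Suc m}"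
    proof
      fix A assume "A \<in> chain w"
      then obtain k where "k \<in> {1..m}" "A = Es k" using IH(5) by blast
      then have "A = ?Es k" "k \<in> {1..Suc m}" by auto
      then show "A \<in> ?Es ` {1..Suc m}" by blast
    qed
    then have ch: "chain (b # w) \<subseteq> ?Es ` {1..Suc m}"
      unfolding chain.simps(2) vis by (simp del: fun_upd_apply)
    show ?thesis
      by (intro exI[of _ "Suc m"] exI[of _ ?Es] conjI vis[symmetric] g ch le) simp
  qed
qed

lemma path_edge_sequence:
  assumes "is_path w"
  shows "\<exists>Es. growth (card E) Es \<and> chain w \<subseteq> Es ` {1..card E}"
proof -
  obtain m Es where *: "1 \<le> m" "m \<le> card E" "growth m Es" "chain w \<subseteq> Es ` {1..m}"
    using path_growth[OF assms] by blast
  obtain Es' where Es': "growth (card E) Es'" "\<forall>k\<le>m. Es' k = Es k"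
    using growth_extend[OF *(3,1,2)] by blast
  have "Es ` {1..m} \<subseteq> Es' ` {1..card E}"
  proof (rule image_subsetI)
    fix k assume "k \<in> {1..m}"
    then have "Es k = Es' k" "k \<in> {1..card E}" using Es'(2) *(2) by auto
    then show "Es k \<in> Es' ` {1..card E}" by blast
  qed
  with *(4) have "chain w \<subseteq> Es' ` {1..card E}" by (rule subset_trans)
  with Es'(1) show ?thesis by (intro exI[of _ Es'] conjI)
qed

text \<open>The point where monotonicity of \<open>S0\<close> enters: every earlier visited set is
  again rooted and connected and lies inside \<open>B\<close>, so all stages of the path are
  allowed.\<close>

lemma chain_decreasing:
  assumes dec: "decreasing_family E x0 S0" and w: "is_path w" and B: "B \<in> S0" "visited w \<subseteq> B"
  shows "chain w \<subseteq> S0" "visited w \<in> S0"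
proof -
  obtain Es where Es: "growth (card E) Es" "chain w \<subseteq> Es ` {1..card E}"
    using path_edge_sequence[OF w] by blast
  show "chain w \<subseteq> S0"
  proof
    fix A assume A: "A \<in> chain w"
    then have "A \<in> rooted_edge_sets E x0" using Es growth_rooted by fastforce
    moreover have "A \<subseteq> B" using chain_subset[OF A] B(2) by simp
    ultimately show "A \<in> S0" using dec B(1) unfolding decreasing_family_def by blast
  qed
  then show "visited w \<in> S0" using visited_in_chain[OF is_path_nonempty[OF w]] by blast
qed

lemma trans_count_support:
  assumes "is_path w" "trans_count w (A, x, y) \<noteq> 0"
  shows "A \<in> chain w \<and> (x, y) \<in> arc_rel A"
  using assms
proof (induction arbitrary: A x y)
  case base
  then show ?case by simp
next
  case (step w b)
  note ne = is_path_nonempty[OF step.hyps(1)]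
  show ?case
  proof (cases "trans_count w (A, x, y) \<noteq> 0")
    case True
    then show ?thesis using step.IH[OF True] by (simp add: chain.simps)
  next
    case False
    have "arc_edge b \<in> visited w \<and> (A, x, y) = (visited w, hd w, b)"
    proof (rule ccontr)
      assume n: "\<not> (arc_edge b \<in> visited w \<and> (A, x, y) = (visited w, hd w, b))"
      have "trans_count (b # w) (A, x, y) = 0"
        using False unfolding trans_count_Cons[OF ne] if_not_P[OF n] by simp
      with step.prems show False by simp
    qed
    then have "arc_edge b \<in> visited w" "A = visited w" "x = hd w" "y = b" by blast+
    moreover have "visited w \<in> chain w" by (rule visited_in_chain[OF ne])
    moreover have "arc_edge (hd w) \<in> visited w" using ne by simp
    ultimately show ?thesis
      using step.hyps(3) unfolding arc_rel_def by (simp add: mem_arcs_iff chain.simps)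
  qed
qed

text \<open>A stage is a contiguous piece of the path, entered at \<open>u A\<close> and left at
  \<open>v A\<close>. Each of its arcs but the last starts a counted transition, and each but the
  first ends one. The clause on \<open>hd w\<close> marks the exit of the current stage, which the
  induction moves along.\<close>

lemma path_flow:
  assumes "is_path w"
  shows "\<exists>u v. v (visited w) = hd w \<and> (\<forall>A\<in>chain w. u A \<in> arcs A \<and> v A \<in> arcs A \<and>
     (\<forall>x. (\<Sum>y\<in>arcs E. trans_count w (A, x, y)) + (if x = v A then 1 else 0) = node_count w A x) \<and>
     (\<forall>x. (\<Sum>y\<in>arcs E. trans_count w (A, y, x)) + (if x = u A then 1 else 0) = node_count w A x))"
  using assms
proof induction
  case base
  have "z \<in> arcs {arc_edge z}" by (simp add: mem_arcs_iff)
  then show ?case by (intro exI[of _ "\<lambda>_. z"]) (simp add: chain.simps node_count.simps)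
next
  case (step w b)
  note ne = is_path_nonempty[OF step.hyps(1)]
  let ?A = "visited w"
  obtain u v where v: "v ?A = hd w" and uv: "\<And>A. A \<in> chain w \<Longrightarrow> u A \<in> arcs A \<and> v A \<in> arcs A"
    and out: "\<And>A x. A \<in> chain w \<Longrightarrow> (\<Sum>y\<in>arcs E. trans_count w (A, x, y)) + (if x = v A then 1 else 0) = node_count w A x"
    and inn: "\<And>A x. A \<in> chain w \<Longrightarrow> (\<Sum>y\<in>arcs E. trans_count w (A, y, x)) + (if x = u A then 1 else 0) = node_count w A x"
    using step.IH by blast
  have b: "b \<in> arcs E" and hd: "hd w \<in> arcs E" using step.hyps is_path_hd by auto
  show ?case
  proof (cases "arc_edge b \<in> ?A")
    case True
    then have vis: "visited (b # w) = ?A" by auto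
    have A_in: "?A \<in> chain w" by (rule visited_in_chain[OF ne])
    have ch: "chain (b # w) = chain w" unfolding chain.simps vis using A_in by blast
    have tc: "trans_count (b # w) t = trans_count w t + (if t = (?A, hd w, b) then 1 else 0)" for t
      using True by (simp add: trans_count_Cons[OF ne])
    have nc: "node_count (b # w) A x = node_count w A x + (if A = ?A \<and> x = b then 1 else 0)" for A x
      unfolding node_count.simps(2) vis ..
    have "(\<Sum>y\<in>arcs E. trans_count (b # w) (A, x, y)) + (if x = (v(?A := b)) A then 1 else 0) = node_count (b # w) A x"
      if A: "A \<in> chain w" for A x
    proof (cases "A = ?A")
      case True
      have "(\<Sum>y\<in>arcs E. trans_count (b # w) (?A, x, y)) =
         (\<Sum>y\<in>arcs E. trans_count w (?A, x, y)) + (\<Sum>y\<in>arcs E. if y = b then (if x = hd w then 1 else 0) else 0)"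
        unfolding tc sum.distrib by (intro arg_cong2[where f = "(+)"] sum.cong refl) auto
      also have "\<dots> = (\<Sum>y\<in>arcs E. trans_count w (?A, x, y)) + (if x = hd w then 1 else 0)"
        using b by (subst sum.delta) auto
      finally show ?thesis using out[OF A_in, of x] v True by (simp add: nc)
    next
      case False
      then show ?thesis using out[OF A, of x] by (simp add: tc nc)
    qed
    moreover have "(\<Sum>y\<in>arcs E. trans_count (b # w) (A, y, x)) + (if x = u A then 1 else 0) = node_count (b # w) A x"
      if A: "A \<in> chain w" for A x
    proof (cases "A = ?A")
      case True
      have "(\<Sum>y\<in>arcs E. trans_count (b # w) (?A, y, x)) =
         (\<Sum>y\<in>arcs E. trans_count w (?A, y, x)) + (\<Sum>y\<in>arcs E. if y = hd w then (if x = b then 1 else 0) else 0)"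
        unfolding tc sum.distrib by (intro arg_cong2[where f = "(+)"] sum.cong refl) auto
      also have "\<dots> = (\<Sum>y\<in>arcs E. trans_count w (?A, y, x)) + (if x = b then 1 else 0)"
        using hd by (subst sum.delta) auto
      finally show ?thesis using inn[OF A_in, of x] True by (simp add: nc)
    next
      case False
      then show ?thesis using inn[OF A, of x] by (simp add: tc nc)
    qed
    moreover have "u A \<in> arcs A \<and> (v(?A := b)) A \<in> arcs A" if "A \<in> chain w" for A
      using uv[OF that] True by (auto simp: mem_arcs_iff)
    ultimately show ?thesis
      unfolding ch vis by (intro exI[of _ u] exI[of _ "v(?A := b)"]) simp
  next
    case False
    define B where "B = visited (b # w)"
    have Bb: "arc_edge b \<in> B" by (simp add: B_def)
    \<comment> \<open>A new edge opens a stage to which no earlier count refers; its only arc so far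
      is both its entry and its exit.\<close>
    have B: "B \<notin> chain w" using chain_subset[of B w] False Bb by blast
    have ch: "chain (b # w) = insert B (chain w)" by (simp add: B_def chain.simps)
    have tc: "trans_count (b # w) t = trans_count w t" for t
      using False by (simp add: trans_count_Cons[OF ne])
    have tcB: "trans_count w (B, x, y) = 0" for x y
      using trans_count_support[OF step.hyps(1)] B by blast
    have ncB: "node_count w B x = 0" for x using node_count_chain B by blast
    have nc: "node_count (b # w) A x = node_count w A x + (if A = B \<and> x = b then 1 else 0)" for A x
      unfolding node_count.simps(2) B_def ..
    have "(\<Sum>y\<in>arcs E. trans_count (b # w) (A, x, y)) + (if x = (v(B := b)) A then 1 else 0) = node_count (b # w) A x \<and>
      (\<Sum>y\<in>arcs E. trans_count (b # w) (A, y, x)) + (if x = (u(B := b)) A then 1 else 0) = node_count (b # w) A x \<and>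
      (u(B := b)) A \<in> arcs A \<and> (v(B := b)) A \<in> arcs A"
      if A: "A \<in> insert B (chain w)" for A x
    proof (cases "A = B")
      case True
      then show ?thesis using Bb by (simp add: tc tcB ncB nc mem_arcs_iff)
    next
      case False
      then have "A \<in> chain w" using A by simp
      then show ?thesis using out[of A x] inn[of A x] uv[of A] False by (simp add: tc nc)
    qed
    then show ?thesis
      unfolding ch B_def[symmetric] by (intro exI[of _ "u(B := b)"] exI[of _ "v(B := b)"]) simp
  qed
qed

section \<open>From balanced counts to admissible families\<close>

definition out_count :: "('v trans \<Rightarrow> nat) \<Rightarrow> 'v set set \<Rightarrow> 'v \<times> 'v \<Rightarrow> nat" where
  "out_count N A x = (\<Sum>y\<in>arcs E. N (A, x, y))"

definition tot_count :: "('v trans \<Rightarrow> nat) \<Rightarrow> 'v set set \<Rightarrow> nat" where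
  "tot_count N A = (\<Sum>x\<in>arcs E. out_count N A x)"

text \<open>The empirical kernel. For an arc without outgoing counts it is 0, by division by
  0.\<close>

definition freq :: "('v trans \<Rightarrow> nat) \<Rightarrow> 'v trans \<Rightarrow> real" where
  "freq N = (\<lambda>(A, x, y). real (N (A, x, y)) / real (out_count N A x))"

text \<open>The logarithm of the likelihood ratio between the empirical kernel and the base kernel
  on the counted transitions; for balanced counts it is the total count times the stage
  cost.\<close>

definition count_cost :: "('v trans \<Rightarrow> nat) \<Rightarrow> 'v set set \<Rightarrow> real" where
  "count_cost N A = (\<Sum>x\<in>arcs E. \<Sum>y\<in>arcs E. real (N (A, x, y)) * ln (freq N (A, x, y) / base_prob \<delta> E A x y))"

definition circulation :: "('v trans \<Rightarrow> nat) \<Rightarrow> bool" where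
  "circulation N \<longleftrightarrow> (\<forall>A x y. N (A, x, y) \<noteq> 0 \<longrightarrow> (x, y) \<in> arc_rel A) \<and>
     (\<forall>A x. (\<Sum>y\<in>arcs E. N (A, y, x)) = out_count N A x)"

lemma out_count_eq_0_iff: "out_count N A x = 0 \<longleftrightarrow> (\<forall>y\<in>arcs E. N (A, x, y) = 0)"
  by (simp add: out_count_def)

lemma circulationD: "circulation N \<Longrightarrow> N (A, x, y) \<noteq> 0 \<Longrightarrow> (x, y) \<in> arc_rel A"
  unfolding circulation_def by blast

lemma circulation_balance: "circulation N \<Longrightarrow> (\<Sum>y\<in>arcs E. N (A, y, x)) = out_count N A x"
  unfolding circulation_def by blast

text \<open>The measure is proportional to the outgoing counts and the kernel is
  \<open>freq\<close>; balance of the counts is then precisely invariance.\<close>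

lemma stage_of_counts:
  assumes N: "circulation N" and A: "A \<subseteq> E" "arc_edge z \<in> A"
  shows "\<exists>\<mu> q. \<mu> \<in> probs (arcs E) \<and> set_pmf \<mu> \<subseteq> arcs A \<and> q \<in> transitions E \<and> bind_pmf \<mu> q = \<mu> \<and>
    (\<forall>x\<in>arcs E. real (tot_count N A) * pmf \<mu> x = real (out_count N A x)) \<and>
    real (tot_count N A) * stage_cost A \<mu> q = count_cost N A"
proof -
  have AE: "arcs A \<subseteq> arcs E" using A(1) by (rule arcs_mono)
  have supp: "x \<in> arcs A \<and> y \<in> arcs A \<and> arc_step x y" if "N (A, x, y) \<noteq> 0" for x y
    using circulationD[OF N that] by (simp add: arc_rel_def)
  \<comment> \<open>Arcs without outgoing counts get reversal as a default kernel, which is a legal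
    transition and uses no other edge.\<close>
  have "\<forall>x\<in>arcs E. \<exists>Q. set_pmf Q \<subseteq> succs x \<and> (out_count N A x > 0 \<longrightarrow> (\<forall>y\<in>arcs E. pmf Q y = freq N (A, x, y))) \<and>
      (out_count N A x = 0 \<longrightarrow> Q = return_pmf (prod.swap x))"
  proof
    fix x assume x: "x \<in> arcs E"
    show "\<exists>Q. set_pmf Q \<subseteq> succs x \<and> (out_count N A x > 0 \<longrightarrow> (\<forall>y\<in>arcs E. pmf Q y = freq N (A, x, y))) \<and>
      (out_count N A x = 0 \<longrightarrow> Q = return_pmf (prod.swap x))"
    proof (cases "out_count N A x > 0")
    case True
    have "(\<Sum>y\<in>arcs E. freq N (A, x, y)) = (\<Sum>y\<in>arcs E. real (N (A, x, y))) / real (out_count N A x)"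
      by (simp add: freq_def sum_divide_distrib)
    also have "(\<Sum>y\<in>arcs E. real (N (A, x, y))) = real (out_count N A x)" by (simp add: out_count_def)
    also have "real (out_count N A x) / real (out_count N A x) = 1" using True by simp
    finally obtain Q where Q: "set_pmf Q \<subseteq> arcs E" "\<And>y. y \<in> arcs E \<Longrightarrow> pmf Q y = freq N (A, x, y)"
      using pmf_of_weights[OF finite_arcs, of "\<lambda>y. freq N (A, x, y)"] by (auto simp: freq_def)
    have "set_pmf Q \<subseteq> succs x"
    proof
      fix y assume y: "y \<in> set_pmf Q"
      then have "y \<in> arcs E" using Q(1) by blast
      moreover have "N (A, x, y) \<noteq> 0" using y Q(2)[OF calculation] by (auto simp: set_pmf_iff freq_def)
      ultimately show "y \<in> succs x" using supp by blast
    qed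
    with Q(2) True show ?thesis by (intro exI[of _ Q]) simp
  next
    case False
    then show ?thesis using swap_arcs[OF x] arc_step_swap by (intro exI[of _ "return_pmf (prod.swap x)"]) simp
  qed
  qed
  from bchoice[OF this] obtain q where q': "\<forall>x\<in>arcs E. set_pmf (q x) \<subseteq> succs x \<and>
      (out_count N A x > 0 \<longrightarrow> (\<forall>y\<in>arcs E. pmf (q x) y = freq N (A, x, y))) \<and>
      (out_count N A x = 0 \<longrightarrow> q x = return_pmf (prod.swap x))" ..
  then have q: "\<And>x. x \<in> arcs E \<Longrightarrow> set_pmf (q x) \<subseteq> succs x"
    "\<And>x y. x \<in> arcs E \<Longrightarrow> y \<in> arcs E \<Longrightarrow> out_count N A x > 0 \<Longrightarrow> pmf (q x) y = freq N (A, x, y)"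
    "\<And>x. x \<in> arcs E \<Longrightarrow> out_count N A x = 0 \<Longrightarrow> q x = return_pmf (prod.swap x)"
    by blast+
  have qT: "q \<in> transitions E" using q(1) by (auto simp: transitions_def)
  show ?thesis
  proof (cases "tot_count N A = 0")
    case True
    then have out0: "out_count N A x = 0" if "x \<in> arcs E" for x using that by (simp add: tot_count_def)
    \<comment> \<open>A stage without transitions has weight 0 but must still supply an invariant
      measure on its arcs; the default kernel exchanges \<open>z\<close> and its reversal.\<close>
    define \<mu> where "\<mu> = pmf_of_set {z, prod.swap z}"
    have set\<mu>: "set_pmf \<mu> = {z, prod.swap z}" by (simp add: \<mu>_def)
    have zA: "z \<in> arcs A" using A(2) by (simp add: mem_arcs_iff)
    have sub: "set_pmf \<mu> \<subseteq> arcs A" unfolding set\<mu> using zA swap_arcs[OF zA] by simp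
    have "bind_pmf \<mu> q = bind_pmf \<mu> (\<lambda>x. return_pmf (prod.swap x))"
      using sub AE q(3) out0 by (intro bind_pmf_cong) auto
    also have "\<dots> = map_pmf prod.swap \<mu>" by (simp add: map_pmf_def)
    also have "\<dots> = pmf_of_set (prod.swap ` {z, prod.swap z})"
      unfolding \<mu>_def by (intro map_pmf_of_set_inj) (auto simp: inj_on_def prod_eq_iff)
    also have "prod.swap ` {z, prod.swap z} = {z, prod.swap z}" by auto
    finally have "bind_pmf \<mu> q = \<mu>" by (simp add: \<mu>_def)
    moreover have "count_cost N A = 0"
    proof -
      have "N (A, x, y) = 0" if "x \<in> arcs E" "y \<in> arcs E" for x y
        using out0[OF that(1)] that(2) by (simp add: out_count_eq_0_iff)
      then show ?thesis by (simp add: count_cost_def)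
    qed
    ultimately show ?thesis
      using True out0 qT sub AE by (intro exI[of _ \<mu>] exI[of _ q]) (simp add: probs_def)
  next
    case False
    define n where "n = real (tot_count N A)"
    have n: "n > 0" using False by (simp add: n_def)
    have "(\<Sum>x\<in>arcs E. real (out_count N A x) / n) = 1"
      using n unfolding sum_divide_distrib[symmetric] n_def tot_count_def by simp
    then obtain \<mu> where \<mu>: "set_pmf \<mu> \<subseteq> arcs E" "\<And>x. x \<in> arcs E \<Longrightarrow> pmf \<mu> x = real (out_count N A x) / n"
      using pmf_of_weights[OF finite_arcs, of "\<lambda>x. real (out_count N A x) / n"] n by (auto simp: less_imp_le)
    have sub: "set_pmf \<mu> \<subseteq> arcs A"
    proof
      fix x assume x: "x \<in> set_pmf \<mu>"
      then have "x \<in> arcs E" using \<mu>(1) by blast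
      moreover have "out_count N A x \<noteq> 0" using x \<mu>(2)[OF calculation] by (auto simp: set_pmf_iff)
      then obtain y where "N (A, x, y) \<noteq> 0" by (auto simp: out_count_eq_0_iff)
      then show "x \<in> arcs A" using supp by blast
    qed
    have n\<mu>: "n * pmf \<mu> x = real (out_count N A x)" if "x \<in> arcs E" for x
      using n \<mu>(2)[OF that] by simp
    have flow: "pmf (q x) y * real (out_count N A x) = real (N (A, x, y))" if x: "x \<in> arcs E" for x y
    proof (cases "out_count N A x > 0 \<and> y \<in> arcs E")
      case True
      then show ?thesis using q(2)[OF x] by (simp add: freq_def)
    next
      case False
      have "N (A, x, y) = 0"
      proof (rule ccontr)
        assume "N (A, x, y) \<noteq> 0"
        moreover from this have "y \<in> arcs E" using supp AE by blast
        ultimately show False using False by (auto simp: out_count_eq_0_iff)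
      qed
      moreover have "pmf (q x) y = 0 \<or> out_count N A x = 0"
        using False q(1)[OF x] by (auto simp: pmf_eq_0_set_pmf)
      ultimately show ?thesis by auto
    qed
    have "bind_pmf \<mu> q = \<mu>"
    proof (rule pmf_eqI)
      fix y
      have "pmf (bind_pmf \<mu> q) y = (\<Sum>x\<in>arcs E. pmf (q x) y * pmf \<mu> x)"
        unfolding pmf_bind using \<mu>(1) by (intro integral_measure_pmf_real) auto
      then have "n * pmf (bind_pmf \<mu> q) y = (\<Sum>x\<in>arcs E. pmf (q x) y * (n * pmf \<mu> x))"
        by (simp add: sum_distrib_left mult_ac)
      also have "\<dots> = (\<Sum>x\<in>arcs E. real (N (A, x, y)))"
        by (intro sum.cong refl) (simp add: n\<mu> flow)
      also have "\<dots> = real (out_count N A y)"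
        using circulation_balance[OF N, of A y] by (simp flip: of_nat_sum)
      also have "\<dots> = n * pmf \<mu> y"
      proof (cases "y \<in> arcs E")
        case False
        then have "N (A, y, y') = 0" for y' using supp[of y y'] AE by blast
        then have "out_count N A y = 0" by (simp add: out_count_def)
        moreover have "pmf \<mu> y = 0" using False \<mu>(1) by (auto simp: pmf_eq_0_set_pmf)
        ultimately show ?thesis by simp
      qed (simp add: n\<mu>)
      finally show "pmf (bind_pmf \<mu> q) y = pmf \<mu> y" using n by simp
    qed
    moreover have "n * stage_cost A \<mu> q = count_cost N A"
    proof -
      have "n * stage_cost A \<mu> q = (\<Sum>x\<in>arcs E. (n * pmf \<mu> x) * entropy_at A q x)"
        by (simp add: stage_cost_def sum_distrib_left mult_ac)
      also have "\<dots> = (\<Sum>x\<in>arcs E. \<Sum>y\<in>arcs E. (pmf (q x) y * real (out_count N A x)) * ln (pmf (q x) y / base_prob \<delta> E A x y))"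
        by (intro sum.cong refl) (simp add: n\<mu> entropy_at_def sum_distrib_left mult_ac)
      also have "\<dots> = count_cost N A"
        unfolding count_cost_def
      proof (intro sum.cong refl)
        fix x y assume xy: "x \<in> arcs E" "y \<in> arcs E"
        show "(pmf (q x) y * real (out_count N A x)) * ln (pmf (q x) y / base_prob \<delta> E A x y) =
          real (N (A, x, y)) * ln (freq N (A, x, y) / base_prob \<delta> E A x y)"
          unfolding flow[OF xy(1)]
        proof (cases "out_count N A x = 0")
          case True
          then have "N (A, x, y) = 0" using xy by (simp add: out_count_eq_0_iff)
          then show "real (N (A, x, y)) * ln (pmf (q x) y / base_prob \<delta> E A x y) =
             real (N (A, x, y)) * ln (freq N (A, x, y) / base_prob \<delta> E A x y)" by simp
        qed (simp add: q(2) xy)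
      qed
      finally show ?thesis .
    qed
    ultimately show ?thesis
      using qT sub \<mu>(1) n\<mu> unfolding n_def by (intro exI[of _ \<mu>] exI[of _ q]) (simp add: probs_def)
  qed
qed

text \<open>The sets of a sequence are told apart by their sizes, so a sum over all edge sets
  collapses to a sum over stages.\<close>

lemma sum_growth:
  fixes f :: "'v set set \<Rightarrow> 'b :: comm_monoid_add"
  assumes g: "growth (card E) Es" and f: "\<And>A. A \<notin> Es ` {1..card E} \<Longrightarrow> f A = 0"
  shows "(\<Sum>A\<in>Pow E. f A) = (\<Sum>k=1..card E. f (Es k))"
proof -
  have inj: "inj_on Es {1..card E}"
  proof (rule inj_onI)
    fix i j assume "i \<in> {1..card E}" "j \<in> {1..card E}" "Es i = Es j"
    moreover from this have "card (Es i) = i" "card (Es j) = j"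
      using growth_card[OF g] unfolding atLeastAtMost_iff by blast+
    ultimately show "i = j" by metis
  qed
  have "Es ` {1..card E} \<subseteq> Pow E"
    using growth_card[OF g] unfolding atLeastAtMost_iff image_subset_iff by (meson PowI atLeastAtMost_iff)
  then have "(\<Sum>A\<in>Pow E. f A) = (\<Sum>A\<in>Es ` {1..card E}. f A)"
    using f finite_E by (intro sum.mono_neutral_right) auto
  also have "\<dots> = (\<Sum>k=1..card E. f (Es k))" using inj by (rule sum.reindex_cong) auto
  finally show ?thesis .
qed

text \<open>Stage weights are the shares in the total count. The set \<open>B\<close> certifies
  membership in \<open>Cl\<close>, and \<open>\<C>\<close> stands for the sets that the path really
  visits, so stages that only pad the sequence get weight 0.\<close>

lemma plan_of_counts:
  assumes N: "circulation N" and g: "growth (card E) Es" and C: "\<C> \<subseteq> Es ` {1..card E}" "\<C> \<subseteq> S0"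
    and supp: "\<And>A x y. N (A, x, y) \<noteq> 0 \<Longrightarrow> A \<in> \<C>"
    and B: "B \<in> S0" "\<And>A. A \<in> \<C> \<Longrightarrow> A \<subseteq> B"
    and n: "n = real (\<Sum>A\<in>Pow E. tot_count N A)" "n > 0"
  shows "\<exists>\<mu> p. \<mu> \<in> Cl E S0 \<and> p \<in> admissible E x0 z \<mu> S0 \<and>
    (\<forall>x\<in>arcs E. n * pmf \<mu> x = real (\<Sum>A\<in>Pow E. out_count N A x)) \<and>
    n * plan_cost p = (\<Sum>A\<in>Pow E. count_cost N A)"
proof -
  have zE: "arc_edge z \<in> Es k" if "k \<in> {1..card E}" for k
    using growth_mono[OF g, of 1 k] that g by (auto simp: growth_def)
  have EsE: "Es k \<subseteq> E" if "k \<in> {1..card E}" for k using growth_card[OF g, of k] that by auto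
  have "\<forall>k\<in>{1..card E}. \<exists>\<mu> q. \<mu> \<in> probs (arcs E) \<and> set_pmf \<mu> \<subseteq> arcs (Es k) \<and> q \<in> transitions E \<and> bind_pmf \<mu> q = \<mu> \<and>
    (\<forall>x\<in>arcs E. real (tot_count N (Es k)) * pmf \<mu> x = real (out_count N (Es k) x)) \<and>
    real (tot_count N (Es k)) * stage_cost (Es k) \<mu> q = count_cost N (Es k)"
    using stage_of_counts[OF N EsE zE] by blast
  then obtain \<mu>s q where st: "\<And>k. k \<in> {1..card E} \<Longrightarrow> \<mu>s k \<in> probs (arcs E) \<and> set_pmf (\<mu>s k) \<subseteq> arcs (Es k) \<and>
      q k \<in> transitions E \<and> bind_pmf (\<mu>s k) (q k) = \<mu>s k"
    and st\<mu>: "\<And>k x. k \<in> {1..card E} \<Longrightarrow> x \<in> arcs E \<Longrightarrow> real (tot_count N (Es k)) * pmf (\<mu>s k) x = real (out_count N (Es k) x)"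
    and stc: "\<And>k. k \<in> {1..card E} \<Longrightarrow> real (tot_count N (Es k)) * stage_cost (Es k) (\<mu>s k) (q k) = count_cost N (Es k)"
    by metis
  define r where "r k = real (tot_count N (Es k)) / n" for k
  have N0: "N (A, x, y) = 0" if "A \<notin> \<C>" for A x y using supp that by blast
  have out0: "out_count N A x = 0" if "A \<notin> \<C>" for A x using N0[OF that] by (simp add: out_count_def)
  have tot0: "tot_count N A = 0" if "A \<notin> \<C>" for A using out0[OF that] by (simp add: tot_count_def)
  have cost0: "count_cost N A = 0" if "A \<notin> \<C>" for A using N0[OF that] by (simp add: count_cost_def)
  have notC: "A \<notin> \<C>" if "A \<notin> Es ` {1..card E}" for A using that C(1) by blast
  have n_eq: "n = (\<Sum>k=1..card E. real (tot_count N (Es k)))"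
    unfolding n(1) using sum_growth[OF g, of "tot_count N"] tot0 notC by simp
  have mix: "n * (\<Sum>k=1..card E. r k * pmf (\<mu>s k) x) = real (\<Sum>A\<in>Pow E. out_count N A x)" if x: "x \<in> arcs E" for x
  proof -
    have "n * (\<Sum>k=1..card E. r k * pmf (\<mu>s k) x) = (\<Sum>k=1..card E. real (tot_count N (Es k)) * pmf (\<mu>s k) x)"
      using n(2) by (simp add: sum_distrib_left r_def)
    also have "\<dots> = (\<Sum>k=1..card E. real (out_count N (Es k) x))"
      using st\<mu> x by (intro sum.cong) auto
    also have "\<dots> = real (\<Sum>A\<in>Pow E. out_count N A x)"
      using sum_growth[OF g, of "\<lambda>A. out_count N A x"] out0 notC by simp
    finally show ?thesis .
  qed
  have "n * (\<Sum>x\<in>arcs E. (\<Sum>k=1..card E. r k * pmf (\<mu>s k) x)) = (\<Sum>x\<in>arcs E. real (\<Sum>A\<in>Pow E. out_count N A x))"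
    using mix by (simp add: sum_distrib_left)
  also have "\<dots> = n" unfolding n(1) tot_count_def by (simp, subst sum.swap) simp
  finally have sum1: "(\<Sum>x\<in>arcs E. (\<Sum>k=1..card E. r k * pmf (\<mu>s k) x)) = 1" using n(2) by simp
  have r0: "r k \<ge> 0" for k using n(2) by (simp add: r_def)
  have "(\<Sum>k=1..card E. r k * pmf (\<mu>s k) x) \<ge> 0" for x
    using r0 by (intro sum_nonneg mult_nonneg_nonneg) auto
  from pmf_of_weights[OF finite_arcs this sum1] obtain \<mu> where
    \<mu>: "set_pmf \<mu> \<subseteq> arcs E" "\<And>x. x \<in> arcs E \<Longrightarrow> pmf \<mu> x = (\<Sum>k=1..card E. r k * pmf (\<mu>s k) x)" by blast
  have \<mu>n: "n * pmf \<mu> x = real (\<Sum>A\<in>Pow E. out_count N A x)" if "x \<in> arcs E" for x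
    using mix[OF that] \<mu>(2)[OF that] by simp
  have "arc_edge x \<in> B" if x: "x \<in> set_pmf \<mu>" for x
  proof -
    have xE: "x \<in> arcs E" using x \<mu>(1) by blast
    have "n * pmf \<mu> x \<noteq> 0" using x n(2) by (simp add: set_pmf_iff)
    then have "(\<Sum>A\<in>Pow E. out_count N A x) \<noteq> 0" using \<mu>n[OF xE] by linarith
    then obtain A where "out_count N A x \<noteq> 0" by (meson sum.neutral)
    then obtain y where y: "N (A, x, y) \<noteq> 0" by (auto simp: out_count_eq_0_iff)
    then have "arc_edge x \<in> A" using circulationD[OF N y] by (simp add: arc_rel_def mem_arcs_iff)
    then show ?thesis using supp[OF y] B(2) by blast
  qed
  then have "set_pmf (map_pmf arc_edge \<mu>) \<subseteq> B" by (simp add: image_subset_iff)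
  then have Cl: "\<mu> \<in> Cl E S0" using \<mu>(1) B(1) unfolding Cl_def probs_def by blast
  have adm: "(\<mu>s, r, Es, q) \<in> admissible E x0 z \<mu> S0"
    unfolding admissible_def mem_Collect_eq prod.case
  proof (intro conjI allI ballI impI)
    show "Es \<in> edge_sequences_from E x0 z" using g by (simp add: edge_sequences_from_iff)
    show "(\<Sum>k=1..card E. r k) = 1" using n(2) n_eq by (simp add: r_def flip: sum_divide_distrib)
    fix z'
    show "(\<Sum>k=1..card E. r k * pmf (\<mu>s k) z') = pmf \<mu> z'"
    proof (cases "z' \<in> arcs E")
      case False
      then have "pmf \<mu> z' = 0" using \<mu>(1) by (auto simp: pmf_eq_0_set_pmf)
      moreover have "pmf (\<mu>s k) z' = 0" if "k \<in> {1..card E}" for k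
        using st[OF that] False by (auto simp: pmf_eq_0_set_pmf probs_def)
      ultimately show ?thesis by simp
    qed (simp add: \<mu>(2))
  next
    fix k assume k: "k \<in> {1..card E}"
    show "r k \<ge> 0" by (rule r0)
    show "r k = 0" if "Es k \<notin> S0"
    proof -
      have "Es k \<notin> \<C>" using that C(2) by blast
      then show ?thesis using tot0 by (simp add: r_def)
    qed
    show "q k \<in> transitions E" "\<mu>s k \<in> probs (arcs E)" "set_pmf (\<mu>s k) \<subseteq> arcs (Es k)"
      "bind_pmf (\<mu>s k) (q k) = \<mu>s k" using st[OF k] by auto
  qed
  have "n * plan_cost (\<mu>s, r, Es, q) = (\<Sum>k=1..card E. real (tot_count N (Es k)) * stage_cost (Es k) (\<mu>s k) (q k))"
    using n(2) by (simp add: plan_cost_def sum_distrib_left r_def)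
  also have "\<dots> = (\<Sum>k=1..card E. count_cost N (Es k))" using stc by (intro sum.cong) auto
  also have "\<dots> = (\<Sum>A\<in>Pow E. count_cost N A)"
    using sum_growth[OF g, of "count_cost N"] cost0 notC by simp
  finally show ?thesis using Cl adm \<mu>n by blast
qed

section \<open>Closing the stages of a path\<close>

text \<open>A unit flow from \<open>a\<close> to \<open>b\<close>: added to the transition counts of
  a walk from \<open>b\<close> to \<open>a\<close> it balances them. Demanding at least one
  transition keeps the total of the balanced counts at or above the number of arcs in the
  stage.\<close>

definition flow :: "'v set set \<Rightarrow> 'v \<times> 'v \<Rightarrow> 'v \<times> 'v \<Rightarrow> (('v \<times> 'v) \<times> ('v \<times> 'v) \<Rightarrow> nat) \<Rightarrow> bool" where
  "flow A a b F \<longleftrightarrow> (\<forall>x y. F (x, y) \<noteq> 0 \<longrightarrow> (x, y) \<in> arc_rel A) \<and>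
     (\<forall>x. (\<Sum>y\<in>arcs E. F (x, y)) + (if x = b then 1 else 0) = (\<Sum>y\<in>arcs E. F (y, x)) + (if x = a then 1 else 0)) \<and>
     (\<Sum>x\<in>arcs E. \<Sum>y\<in>arcs E. F (x, y)) \<ge> 1"

lemma sum_single_arc:
  assumes "b0 \<in> arcs E"
  shows "(\<Sum>y\<in>arcs E. F y + (if (x, y) = (a0, b0) then 1 else 0 :: nat)) = (\<Sum>y\<in>arcs E. F y) + (if x = a0 then 1 else 0)"
    and "(\<Sum>y\<in>arcs E. F y + (if (y, x) = (b0, a0) then 1 else 0 :: nat)) = (\<Sum>y\<in>arcs E. F y) + (if x = a0 then 1 else 0)"
proof -
  have *: "(\<Sum>y\<in>arcs E. F y + (if x = a0 \<and> y = b0 then 1 else 0 :: nat)) = (\<Sum>y\<in>arcs E. F y) + (if x = a0 then 1 else 0)"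
    using assms by (cases "x = a0") (simp_all add: sum.distrib)
  show "(\<Sum>y\<in>arcs E. F y + (if (x, y) = (a0, b0) then 1 else 0 :: nat)) = (\<Sum>y\<in>arcs E. F y) + (if x = a0 then 1 else 0)"
    using * by (simp only: prod.inject)
  show "(\<Sum>y\<in>arcs E. F y + (if (y, x) = (b0, a0) then 1 else 0 :: nat)) = (\<Sum>y\<in>arcs E. F y) + (if x = a0 then 1 else 0)"
    using * by (simp only: prod.inject conj_commute)
qed

lemma trancl_flow:
  assumes A: "A \<subseteq> E" and ab: "(a, b) \<in> (arc_rel A)\<^sup>+"
  shows "\<exists>F. flow A a b F"
  using ab
proof (induction rule: trancl_induct)
  case (base b)
  define F where "F = (\<lambda>t. 0 + (if t = (a, b) then 1 else 0 :: nat))"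
  have ab: "a \<in> arcs E" "b \<in> arcs E" using base A arcs_mono[OF A] by (auto simp: arc_rel_def)
  have out: "(\<Sum>y\<in>arcs E. F (x, y)) = (if x = a then 1 else 0)" for x
    unfolding F_def using sum_single_arc(1)[OF ab(2), of "\<lambda>_. 0"] by (simp only: sum.neutral_const add_0)
  have inn: "(\<Sum>y\<in>arcs E. F (y, x)) = (if x = b then 1 else 0)" for x
    unfolding F_def using sum_single_arc(2)[OF ab(1), of "\<lambda>_. 0"] by (simp only: sum.neutral_const add_0)
  have "(\<Sum>x\<in>arcs E. \<Sum>y\<in>arcs E. F (x, y)) = 1" unfolding out using ab by simp
  moreover have "F (x, y) \<noteq> 0 \<Longrightarrow> (x, y) \<in> arc_rel A" for x y
    using base by (simp add: F_def split: if_splits)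
  ultimately have "flow A a b F" unfolding flow_def using out inn by simp
  then show ?case by (intro exI[of _ F])
next
  case (step b c)
  then obtain F where F: "flow A a b F" by blast
  define F' where "F' = (\<lambda>t. F t + (if t = (b, c) then 1 else 0 :: nat))"
  have bc: "b \<in> arcs E" "c \<in> arcs E" using step.hyps(2) A arcs_mono[OF A] by (auto simp: arc_rel_def)
  have out: "(\<Sum>y\<in>arcs E. F' (x, y)) = (\<Sum>y\<in>arcs E. F (x, y)) + (if x = b then 1 else 0)" for x
    unfolding F'_def by (rule sum_single_arc(1)[OF bc(2), of "\<lambda>y. F (x, y)"])
  have inn: "(\<Sum>y\<in>arcs E. F' (y, x)) = (\<Sum>y\<in>arcs E. F (y, x)) + (if x = c then 1 else 0)" for x
    unfolding F'_def by (rule sum_single_arc(2)[OF bc(1), of "\<lambda>y. F (y, x)"])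
  have F1: "F (x, y) \<noteq> 0 \<Longrightarrow> (x, y) \<in> arc_rel A" for x y
    using F unfolding flow_def by blast
  have F2: "(\<Sum>y\<in>arcs E. F (x, y)) + (if x = b then 1 else 0) = (\<Sum>y\<in>arcs E. F (y, x)) + (if x = a then 1 else 0)" for x
    using F unfolding flow_def by blast
  have F3: "(\<Sum>x\<in>arcs E. \<Sum>y\<in>arcs E. F (x, y)) \<ge> 1"
    using F unfolding flow_def by blast
  have 1: "F' (x, y) \<noteq> 0 \<Longrightarrow> (x, y) \<in> arc_rel A" for x y
    using F1[of x y] step.hyps(2) by (cases "(x, y) = (b, c)") (simp_all add: F'_def split: if_splits)
  have 2: "(\<Sum>y\<in>arcs E. F' (x, y)) + (if x = c then 1 else 0) = (\<Sum>y\<in>arcs E. F' (y, x)) + (if x = a then 1 else 0)" for x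
    unfolding out inn F2 by simp
  have 3: "(\<Sum>x\<in>arcs E. \<Sum>y\<in>arcs E. F' (x, y)) \<ge> 1"
    unfolding out sum.distrib using F3 by simp
  have "flow A a c F'" unfolding flow_def using 1 2 3 by blast
  then show ?case by (intro exI[of _ F'])
qed

text \<open>There are finitely many triples \<open>(A, a, b)\<close>, so the sum of all chosen
  totals is a common bound. It depends on the graph only, not on any path.\<close>

lemma bounded_flow:
  "\<exists>C. \<forall>A a b. A \<subseteq> E \<longrightarrow> graph_connected (\<Union>A) A \<longrightarrow> a \<in> arcs A \<longrightarrow> b \<in> arcs A \<longrightarrow>
     (\<exists>F. flow A a b F \<and> (\<Sum>x\<in>arcs E. \<Sum>y\<in>arcs E. F (x, y)) \<le> C)"
proof -
  define f where "f t = (case t of (A, a, b) \<Rightarrow> SOME F. flow A a b F)" for t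
  define tot :: "(('v \<times> 'v) \<times> ('v \<times> 'v) \<Rightarrow> nat) \<Rightarrow> nat" where "tot F = (\<Sum>x\<in>arcs E. \<Sum>y\<in>arcs E. F (x, y))" for F
  define T where "T = Pow E \<times> arcs E \<times> arcs E"
  have fin: "finite T" unfolding T_def using finite_E by simp
  have "\<exists>F. flow A a b F \<and> tot F \<le> (\<Sum>t\<in>T. tot (f t))"
    if A: "A \<subseteq> E" "graph_connected (\<Union>A) A" and ab: "a \<in> arcs A" "b \<in> arcs A" for A a b
  proof (intro exI conjI)
    show "flow A a b (f (A, a, b))"
      using someI_ex[OF trancl_flow[OF A(1) arc_rel_trancl[OF A(2) ab]]] by (simp add: f_def)
    have "(A, a, b) \<in> T" using A ab arcs_mono[OF A(1)] by (auto simp: T_def)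
    then show "tot (f (A, a, b)) \<le> (\<Sum>t\<in>T. tot (f t))"
      using fin by (intro member_le_sum) auto
  qed
  then show ?thesis unfolding tot_def by blast
qed

lemma chain_connected:
  assumes w: "is_path w" and A: "A \<in> chain w"
  shows "A \<subseteq> E" "graph_connected (\<Union>A) A"
proof -
  obtain Es where g: "growth (card E) Es" and ch: "chain w \<subseteq> Es ` {1..card E}"
    using path_edge_sequence[OF w] by blast
  obtain k where k: "k \<in> {1..card E}" "A = Es k" using A ch by blast
  show "A \<subseteq> E" using growth_card[OF g, of k] k by simp
  show "graph_connected (\<Union>A) A" using growth_connected[OF g, of k] k by simp
qed

text \<open>Closed counts differ from those of the path by a constant only, so frequencies move by
  order \<open>1 / length w\<close> and probabilities by a bounded factor. Since the total is at
  least the number of arcs, the exponent can be stated with \<open>length w\<close>.\<close>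

abbreviation closes :: "('v \<times> 'v) list \<Rightarrow> nat \<Rightarrow> ('v trans \<Rightarrow> nat) \<Rightarrow> bool" where
  "closes w C N \<equiv> circulation N \<and> (\<forall>A x y. N (A, x, y) \<noteq> 0 \<longrightarrow> A \<in> chain w) \<and>
     (\<forall>t. trans_count w t \<le> N t) \<and>
     (\<forall>A x. out_count N A x \<le> node_count w A x + C \<and> node_count w A x \<le> out_count N A x + C) \<and>
     (\<forall>A. (\<Sum>x\<in>arcs E. node_count w A x) \<le> tot_count N A) \<and>
     (\<forall>A. tot_count N A \<le> tot_count (trans_count w) A + C) \<and>
     (\<forall>A. tot_count N A \<le> (\<Sum>x\<in>arcs E. node_count w A x) + C)"

lemma closed_counts:
  "\<exists>C. \<forall>w. is_path w \<longrightarrow> (\<exists>N. closes w C N)"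
proof -
  obtain C0 where C0: "\<And>A a b. A \<subseteq> E \<Longrightarrow> graph_connected (\<Union>A) A \<Longrightarrow> a \<in> arcs A \<Longrightarrow> b \<in> arcs A \<Longrightarrow>
     (\<exists>F. flow A a b F \<and> (\<Sum>x\<in>arcs E. \<Sum>y\<in>arcs E. F (x, y)) \<le> C0)"
    using bounded_flow by blast
  \<comment> \<open>\<open>C0\<close> bounds the inserted flow; the extra 1 covers the last arc of a
    stage, which starts no counted transition.\<close>
  define C where "C = Suc C0"
  show ?thesis
  proof (intro exI[of _ C] allI impI)
    fix w assume w: "is_path w"
    obtain u v where uv: "\<And>A. A \<in> chain w \<Longrightarrow> u A \<in> arcs A \<and> v A \<in> arcs A"
      and out: "\<And>A x. A \<in> chain w \<Longrightarrow> (\<Sum>y\<in>arcs E. trans_count w (A, x, y)) + (if x = v A then 1 else 0) = node_count w A x"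
      and inn: "\<And>A x. A \<in> chain w \<Longrightarrow> (\<Sum>y\<in>arcs E. trans_count w (A, y, x)) + (if x = u A then 1 else 0) = node_count w A x"
      using path_flow[OF w] by blast
    have "\<forall>A\<in>chain w. \<exists>F. flow A (v A) (u A) F \<and> (\<Sum>x\<in>arcs E. \<Sum>y\<in>arcs E. F (x, y)) \<le> C0"
      using C0[OF chain_connected[OF w]] uv by blast
    from bchoice[OF this] obtain F where F: "\<forall>A\<in>chain w. flow A (v A) (u A) (F A) \<and> (\<Sum>x\<in>arcs E. \<Sum>y\<in>arcs E. F A (x, y)) \<le> C0" ..
    define N where "N = (\<lambda>(A, x, y). trans_count w (A, x, y) + (if A \<in> chain w then F A (x, y) else 0))"
    have N_in: "N (A, x, y) = trans_count w (A, x, y) + F A (x, y)" if "A \<in> chain w" for A x y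
      using that by (simp add: N_def)
    have N_out: "N (A, x, y) = 0" and tc_out: "trans_count w (A, x, y) = 0" if "A \<notin> chain w" for A x y
      using that trans_count_support[OF w, of A x y] by (auto simp: N_def)
    have nc_out: "node_count w A x = 0" if "A \<notin> chain w" for A x
      using node_count_chain that by blast
    have F1: "F A (x, y) \<noteq> 0 \<Longrightarrow> (x, y) \<in> arc_rel A"
      and F2: "(\<Sum>y\<in>arcs E. F A (x, y)) + (if x = u A then 1 else 0) = (\<Sum>y\<in>arcs E. F A (y, x)) + (if x = v A then 1 else 0)"
      and F3: "(\<Sum>x\<in>arcs E. \<Sum>y\<in>arcs E. F A (x, y)) \<ge> 1"
      and F4: "(\<Sum>x\<in>arcs E. \<Sum>y\<in>arcs E. F A (x, y)) \<le> C0" if "A \<in> chain w" for A x y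
      using F that unfolding flow_def by blast+
    have oc: "out_count N A x = (\<Sum>y\<in>arcs E. trans_count w (A, x, y)) + (\<Sum>y\<in>arcs E. F A (x, y))" if "A \<in> chain w" for A x
      by (simp add: out_count_def N_in[OF that] sum.distrib)
    have F_le: "(\<Sum>y\<in>arcs E. F A (x, y)) \<le> C0" if A: "A \<in> chain w" for A x
    proof (cases "x \<in> arcs E")
      case True
      have "(\<Sum>y\<in>arcs E. F A (x, y)) \<le> (\<Sum>x\<in>arcs E. \<Sum>y\<in>arcs E. F A (x, y))"
        using True by (intro member_le_sum[where f = "\<lambda>x. \<Sum>y\<in>arcs E. F A (x, y)"]) auto
      then show ?thesis using F4[OF A] by linarith
    next
      case False
      have "F A (x, y) = 0" for y
        using F1[OF A, of x y] False arcs_mono[OF chain_connected(1)[OF w A]] by (auto simp: arc_rel_def)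
      then show ?thesis by simp
    qed
    have "(x, y) \<in> arc_rel A" if "N (A, x, y) \<noteq> 0" for A x y
    proof (cases "A \<in> chain w")
      case True
      then have "trans_count w (A, x, y) \<noteq> 0 \<or> F A (x, y) \<noteq> 0" using that N_in by simp
      then show ?thesis using trans_count_support[OF w, of A x y] F1[OF True, of x y] by blast
    next
      case False
      then show ?thesis using N_out that by simp
    qed
    moreover have "(\<Sum>y\<in>arcs E. N (A, y, x)) = out_count N A x" for A x
    proof (cases "A \<in> chain w")
      case True
      have "(\<Sum>y\<in>arcs E. N (A, y, x)) = (\<Sum>y\<in>arcs E. trans_count w (A, y, x)) + (\<Sum>y\<in>arcs E. F A (y, x))"
        by (simp add: N_in[OF True] sum.distrib)
      then show ?thesis using oc[OF True, of x] out[OF True, of x] inn[OF True, of x] F2[OF True, of x] by linarith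
    next
      case False
      then show ?thesis by (simp add: out_count_def N_out)
    qed
    ultimately have circ: "circulation N" unfolding circulation_def by blast
    have supp: "\<forall>A x y. N (A, x, y) \<noteq> 0 \<longrightarrow> A \<in> chain w"
    proof (intro allI impI)
      fix A x y assume "N (A, x, y) \<noteq> 0"
      then show "A \<in> chain w" using N_out[of A x y] by (cases "A \<in> chain w") simp_all
    qed
    have ge: "\<forall>t. trans_count w t \<le> N t" by (simp add: N_def split_paired_all)
    have oc_nc: "out_count N A x \<le> node_count w A x + C \<and> node_count w A x \<le> out_count N A x + C" for A x
    proof (cases "A \<in> chain w")
      case True
      then show ?thesis using oc[OF True, of x] out[OF True, of x] F_le[OF True, of x] by (simp add: C_def split: if_splits)
    next
      case False
      then show ?thesis by (simp add: out_count_def N_out nc_out)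
    qed
    have tot: "(\<Sum>x\<in>arcs E. node_count w A x) \<le> tot_count N A \<and> tot_count N A \<le> tot_count (trans_count w) A + C \<and>
        tot_count N A \<le> (\<Sum>x\<in>arcs E. node_count w A x) + C" for A
    proof (cases "A \<in> chain w")
      case True
      have vE: "v A \<in> arcs E" using uv[OF True] arcs_mono[OF chain_connected(1)[OF w True]] by blast
      have t: "tot_count N A = tot_count (trans_count w) A + (\<Sum>x\<in>arcs E. \<Sum>y\<in>arcs E. F A (x, y))"
        unfolding tot_count_def oc[OF True] sum.distrib by (simp add: out_count_def)
      have "(\<Sum>x\<in>arcs E. node_count w A x) = (\<Sum>x\<in>arcs E. out_count (trans_count w) A x + (if x = v A then 1 else 0))"
        using out[OF True] by (simp add: out_count_def)
      \<comment> \<open>A stage has one arc more than it has counted transitions, and the inserted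
        flow makes up for it.\<close>
      also have "\<dots> = tot_count (trans_count w) A + 1"
        unfolding sum.distrib tot_count_def using vE by simp
      finally show ?thesis using t F3[OF True] F4[OF True] by (simp add: C_def)
    next
      case False
      then show ?thesis by (simp add: tot_count_def out_count_def N_out nc_out)
    qed
    show "\<exists>N. closes w C N"
      using circ supp ge oc_nc tot by (intro exI[of _ N] conjI allI) blast+
  qed
qed

end

section \<open>The upper bound on probabilities\<close>

lemma prod_power_increment:
  fixes f :: "'a \<Rightarrow> real" and n :: "'a \<Rightarrow> nat"
  assumes "finite T" "i \<in> T"
  shows "(\<Prod>t\<in>T. f t ^ (n t + (if t = i then 1 else 0))) = f i * (\<Prod>t\<in>T. f t ^ n t)"
proof -
  have "(\<Prod>t\<in>T. f t ^ (n t + (if t = i then 1 else 0))) = (\<Prod>t\<in>T. f t ^ n t * (if t = i then f t else 1))"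
    by (intro prod.cong refl) simp
  also have "\<dots> = (\<Prod>t\<in>T. f t ^ n t) * f i"
    using assms by (simp add: prod.distrib)
  finally show ?thesis by simp
qed

lemma iter_mono:
  assumes "\<And>w b. wt w b \<ge> 0" "\<And>w. F w \<le> G w"
  shows "iter S wt F j w \<le> iter S wt G j w"
  using assms by (induction j arbitrary: w) (auto intro!: sum_mono mult_left_mono)

lemma iter_nonneg:
  assumes "\<And>w b. wt w b \<ge> 0" "\<And>w. F w \<ge> 0"
  shows "iter S wt F j w \<ge> 0"
  using assms by (induction j arbitrary: w) (auto intro!: sum_nonneg)

lemma path_weight_nonneg:
  assumes "\<And>w b. wt w b \<ge> 0" shows "path_weight wt w \<ge> 0"
  using assms by (induction wt w rule: path_weight.induct) auto

lemma finite_bounded_functions: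
  assumes "finite T"
  shows "finite {N :: 'a \<Rightarrow> nat. (\<forall>t. t \<notin> T \<longrightarrow> N t = 0) \<and> (\<forall>t\<in>T. N t \<le> m)}" (is "finite ?\<Theta>")
    and "card {N :: 'a \<Rightarrow> nat. (\<forall>t. t \<notin> T \<longrightarrow> N t = 0) \<and> (\<forall>t\<in>T. N t \<le> m)} \<le> (m + 1) ^ card T"
proof -
  let ?P = "PiE T (\<lambda>_. {..m})" and ?g = "\<lambda>f t. if t \<in> T then f t else (0::nat)"
  have "?\<Theta> \<subseteq> ?g ` ?P"
  proof
    fix N assume N: "N \<in> ?\<Theta>"
    have "restrict N T \<in> ?P" using N by auto
    moreover have "N = ?g (restrict N T)" using N by auto
    ultimately show "N \<in> ?g ` ?P" by blast
  qed
  moreover have fin: "finite ?P" using assms by (intro finite_PiE) auto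
  ultimately show "finite ?\<Theta>" "card ?\<Theta> \<le> (m + 1) ^ card T"
    using card_image_le[OF fin, of ?g] card_mono[of "?g ` ?P" ?\<Theta>] assms
    by (auto simp: card_PiE intro: finite_subset)
qed

section \<open>Weights of paths under the base and the empirical kernels\<close>

context reinforced_graph
begin

definition triples :: "'v trans set" where
  "triples = Pow E \<times> arcs E \<times> arcs E"

lemma finite_triples: "finite triples"
  using finite_E by (simp add: triples_def)

lemma sum_triples: "(\<Sum>t\<in>triples. f t) = (\<Sum>A\<in>Pow E. \<Sum>x\<in>arcs E. \<Sum>y\<in>arcs E. f (A, x, y))"
  by (simp add: triples_def sum.cartesian_product)

definition step_prob :: "'v trans \<Rightarrow> real" where
  "step_prob = (\<lambda>(A, x, y). base_prob \<delta> E A x y)"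

lemma step_prob_nonneg: "step_prob t \<ge> 0"
  by (cases t) (simp add: step_prob_def base_prob_nonneg)

text \<open>Entering a new edge has weight 1, so these weights do not sum to 1; as this happens at most
  \<open>card E\<close> times, their sum over all paths is still polynomial in the length.\<close>

definition freq_wt :: "('v trans \<Rightarrow> nat) \<Rightarrow> ('v \<times> 'v) list \<Rightarrow> 'v \<times> 'v \<Rightarrow> real" where
  "freq_wt N w b = (if arc_edge b \<in> visited w then freq N (visited w, hd w, b) else 1)"

lemma freq_nonneg: "freq N t \<ge> 0"
  by (cases t) (simp add: freq_def)

text \<open>The sum is 0 instead of 1 when \<open>x\<close> has no outgoing counts.\<close>

lemma freq_sum_le_1: "(\<Sum>y\<in>arcs E. freq N (A, x, y)) \<le> 1"
proof -
  have "(\<Sum>y\<in>arcs E. freq N (A, x, y)) = (\<Sum>y\<in>arcs E. real (N (A, x, y))) / real (out_count N A x)"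
    by (simp add: freq_def sum_divide_distrib)
  also have "(\<Sum>y\<in>arcs E. real (N (A, x, y))) = real (out_count N A x)"
    by (simp add: out_count_def)
  finally show ?thesis by simp
qed

lemma freq_le_1: "y \<in> arcs E \<Longrightarrow> freq N (A, x, y) \<le> 1"
  using member_le_sum[of y "arcs E" "\<lambda>y. freq N (A, x, y)"] freq_sum_le_1[of N A x]
  by (simp add: freq_nonneg)

lemma freq_wt_nonneg: "freq_wt N w b \<ge> 0"
  by (simp add: freq_wt_def freq_nonneg)

lemma path_triple:
  assumes "is_path w" "b \<in> arcs E" shows "(visited w, hd w, b) \<in> triples"
  using is_path_arcs[OF assms(1)] is_path_hd[OF assms(1)] assms(2)
  by (auto simp: triples_def mem_arcs_iff)

text \<open>Steps over a new edge are dropped, as their probability is at most 1.\<close>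

lemma path_weight_le_prod:
  assumes "is_path w"
  shows "path_weight next_prob w \<le> (\<Prod>t\<in>triples. step_prob t ^ trans_count w t)"
  using assms
proof induction
  case (step w b)
  note ne = is_path_nonempty[OF step.hyps(1)]
  note tri = path_triple[OF step.hyps(1,2)]
  let ?P = "\<Prod>t\<in>triples. step_prob t ^ trans_count w t"
  have P0: "?P \<ge> 0" by (intro prod_nonneg zero_le_power step_prob_nonneg ballI)
  have pw: "next_prob w b = step_prob (visited w, hd w, b)" by (simp add: next_prob_def step_prob_def)
  show ?case
  proof (cases "arc_edge b \<in> visited w")
    case True
    have "(\<Prod>t\<in>triples. step_prob t ^ trans_count (b # w) t) = next_prob w b * ?P"
      unfolding trans_count_Cons[OF ne] pw using True
      by (simp only: simp_thms prod_power_increment[OF finite_triples tri])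
    then show ?thesis
      using step.IH next_prob_nonneg[of w b] by (simp add: path_weight_Cons[OF ne] mult_left_mono)
  next
    case False
    have "next_prob w b \<le> 1" unfolding next_prob_def by (rule base_prob_le_1[OF is_path_hd[OF step.hyps(1)]])
    then have "next_prob w b * path_weight next_prob w \<le> 1 * ?P"
      using step.IH P0 path_weight_nonneg[of next_prob w] next_prob_nonneg by (intro mult_mono) auto
    then show ?thesis using False by (simp add: path_weight_Cons[OF ne] trans_count_Cons[OF ne])
  qed
qed simp

lemma path_weight_freq_wt:
  assumes "is_path w"
  shows "path_weight (freq_wt N) w = (\<Prod>t\<in>triples. freq N t ^ trans_count w t)"
  using assms
proof induction
  case (step w b)
  note ne = is_path_nonempty[OF step.hyps(1)]
  note tri = path_triple[OF step.hyps(1,2)]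
  show ?case
  proof (cases "arc_edge b \<in> visited w")
    case True
    have "(\<Prod>t\<in>triples. freq N t ^ trans_count (b # w) t) = freq N (visited w, hd w, b) * (\<Prod>t\<in>triples. freq N t ^ trans_count w t)"
      unfolding trans_count_Cons[OF ne] using True
      by (simp only: simp_thms prod_power_increment[OF finite_triples tri])
    then show ?thesis
      using step.IH True by (simp add: path_weight_Cons[OF ne] freq_wt_def)
  next
    case False
    then show ?thesis
      using step.IH by (simp add: path_weight_Cons[OF ne] trans_count_Cons[OF ne] freq_wt_def)
  qed
qed simp

text \<open>Steps along visited edges have total weight at most 1; steps over a new edge number at
  most \<open>card (arcs E)\<close> and lower the exponent by one. The bound thus counts when and by
  which arc each remaining edge is first entered.\<close>

lemma iter_freq_wt_le:
  assumes "w \<noteq> []" "set w \<subseteq> arcs E"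
  shows "iter (arcs E) (freq_wt N) (\<lambda>_. 1) j w \<le> (real (card (arcs E)) * real (Suc j)) ^ card (E - visited w)"
  using assms
proof (induction j arbitrary: w)
  case 0
  have "card (arcs E) \<noteq> 0" using z(1) by auto
  then have "real (card (arcs E)) \<ge> 1" by linarith
  then show ?case by (simp add: one_le_power)
next
  case (Suc j)
  define D where "D = real (card (arcs E))"
  define X where "X = D * real (Suc j)"
  define c where "c = card (E - visited w)"
  have D0: "D \<ge> 0" by (simp add: D_def)
  have X0: "X \<ge> 0" unfolding X_def using D0 by (intro mult_nonneg_nonneg) auto
  let ?S = "{b \<in> arcs E. arc_edge b \<in> visited w}"
  have split: "(\<Sum>b\<in>arcs E. g b) = (\<Sum>b\<in>?S. g b) + (\<Sum>b\<in>arcs E - ?S. g b)" for g :: "_ \<Rightarrow> real"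
    using sum.subset_diff[of ?S "arcs E" g] by simp
  have IH: "iter (arcs E) (freq_wt N) (\<lambda>_. 1) j (b # w) \<le> X ^ card (E - visited (b # w))" if "b \<in> arcs E" for b
    unfolding X_def D_def by (rule Suc.IH) (use Suc.prems that in auto)
  have "(\<Sum>b\<in>?S. freq_wt N w b * iter (arcs E) (freq_wt N) (\<lambda>_. 1) j (b # w)) \<le> (\<Sum>b\<in>?S. freq N (visited w, hd w, b) * X ^ c)"
  proof (rule sum_mono)
    fix b assume b: "b \<in> ?S"
    then have "visited (b # w) = visited w" by auto
    then have "iter (arcs E) (freq_wt N) (\<lambda>_. 1) j (b # w) \<le> X ^ c" using IH[of b] b by (simp add: c_def)
    then show "freq_wt N w b * iter (arcs E) (freq_wt N) (\<lambda>_. 1) j (b # w) \<le> freq N (visited w, hd w, b) * X ^ c"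
      using b freq_nonneg by (simp add: freq_wt_def mult_left_mono)
  qed
  also have "\<dots> = (\<Sum>b\<in>?S. freq N (visited w, hd w, b)) * X ^ c" by (simp add: sum_distrib_right)
  also have "\<dots> \<le> 1 * X ^ c"
  proof (rule mult_right_mono)
    have "(\<Sum>b\<in>?S. freq N (visited w, hd w, b)) \<le> (\<Sum>b\<in>arcs E. freq N (visited w, hd w, b))"
      by (rule sum_mono2) (auto simp: freq_nonneg)
    then show "(\<Sum>b\<in>?S. freq N (visited w, hd w, b)) \<le> 1" using freq_sum_le_1 by (rule order_trans)
  qed (use X0 in simp)
  finally have old: "(\<Sum>b\<in>?S. freq_wt N w b * iter (arcs E) (freq_wt N) (\<lambda>_. 1) j (b # w)) \<le> X ^ c" by simp
  have new: "(\<Sum>b\<in>arcs E - ?S. freq_wt N w b * iter (arcs E) (freq_wt N) (\<lambda>_. 1) j (b # w)) \<le> (if c = 0 then 0 else D * X ^ (c - 1))"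
  proof (cases "c = 0")
    case True
    then have "E - visited w = {}" using finite_E by (simp add: c_def)
    then have "arcs E - ?S = {}" by (auto simp: mem_arcs_iff)
    then have "(\<Sum>b\<in>arcs E - ?S. freq_wt N w b * iter (arcs E) (freq_wt N) (\<lambda>_. 1) j (b # w)) = 0" by (metis sum.empty)
    then show ?thesis using True by simp
  next
    case False
    have "(\<Sum>b\<in>arcs E - ?S. freq_wt N w b * iter (arcs E) (freq_wt N) (\<lambda>_. 1) j (b # w)) \<le> real (card (arcs E - ?S)) * X ^ (c - 1)"
    proof (rule sum_bounded_above)
      fix b assume b: "b \<in> arcs E - ?S"
      then have "E - visited (b # w) = (E - visited w) - {arc_edge b}" "arc_edge b \<in> E - visited w"
        by (auto simp: mem_arcs_iff)
      then have "card (E - visited (b # w)) = c - 1" by (simp add: c_def)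
      then show "freq_wt N w b * iter (arcs E) (freq_wt N) (\<lambda>_. 1) j (b # w) \<le> X ^ (c - 1)"
        using IH[of b] b by (simp add: freq_wt_def)
    qed
    also have "\<dots> \<le> D * X ^ (c - 1)"
      unfolding D_def using X0 by (intro mult_right_mono) (auto intro: card_mono)
    finally show ?thesis using False by simp
  qed
  have "iter (arcs E) (freq_wt N) (\<lambda>_. 1) (Suc j) w \<le> X ^ c + (if c = 0 then 0 else D * X ^ (c - 1))"
    using old new unfolding iter.simps(2) split[of "\<lambda>b. freq_wt N w b * iter (arcs E) (freq_wt N) (\<lambda>_. 1) j (b # w)"] by linarith
  \<comment> \<open>Two terms of the binomial expansion are enough, and \<open>X + D\<close> is
    \<open>X\<close> with \<open>j\<close> replaced by \<open>Suc j\<close>.\<close>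
  also have "\<dots> \<le> (X + D) ^ c"
  proof (cases c)
    case (Suc i)
    have "X ^ c + D * X ^ i = (X + D) * X ^ i" by (simp add: Suc algebra_simps)
    also have "\<dots> \<le> (X + D) * (X + D) ^ i"
      using X0 D0 by (intro mult_left_mono power_mono) auto
    finally show ?thesis by (simp add: Suc)
  qed simp
  also have "X + D = D * real (Suc (Suc j))" by (simp add: X_def algebra_simps)
  finally show ?case by (simp only: D_def c_def)
qed

text \<open>Each factor is rewritten as \<open>p = exp (- ln (f / p)) * f\<close>, and the exponents
  add up to the cost of the counts. Where a count is nonzero, both \<open>f\<close> and
  \<open>p\<close> are positive.\<close>

lemma step_prob_prod_eq:
  assumes N: "circulation N"
  shows "(\<Prod>t\<in>triples. step_prob t ^ N t) = exp (- (\<Sum>A\<in>Pow E. count_cost N A)) * (\<Prod>t\<in>triples. freq N t ^ N t)"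
proof -
  have "step_prob t ^ N t = exp (- (real (N t) * ln (freq N t / step_prob t))) * freq N t ^ N t" if t: "t \<in> triples" for t
  proof (cases "N t = 0")
    case False
    obtain A x y where t_eq: "t = (A, x, y)" by (cases t)
    have xy: "x \<in> arcs E" "y \<in> arcs E" using t by (auto simp: t_eq triples_def)
    have "(x, y) \<in> arc_rel A" using circulationD[OF N] False t_eq by blast
    then have sp: "step_prob t > 0" using base_prob_pos[OF xy] by (simp add: t_eq step_prob_def arc_rel_def)
    have "out_count N A x \<noteq> 0"
    proof
      assume "out_count N A x = 0"
      then have "N (A, x, y) = 0" using xy(2) by (simp only: out_count_eq_0_iff)
      then show False using False by (simp add: t_eq)
    qed
    then have f: "freq N t > 0" using False by (simp add: t_eq freq_def)
    have "exp (- (real (N t) * ln (freq N t / step_prob t))) = exp (ln (step_prob t / freq N t)) ^ N t"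
      using sp f by (simp add: ln_div exp_of_nat_mult[symmetric] algebra_simps)
    also have "\<dots> = (step_prob t / freq N t) ^ N t" using sp f by simp
    finally show ?thesis using f by (simp add: power_divide)
  qed simp
  then have "(\<Prod>t\<in>triples. step_prob t ^ N t) =
      (\<Prod>t\<in>triples. exp (- (real (N t) * ln (freq N t / step_prob t)))) * (\<Prod>t\<in>triples. freq N t ^ N t)"
    by (simp add: prod.distrib)
  also have "(\<Prod>t\<in>triples. exp (- (real (N t) * ln (freq N t / step_prob t)))) =
      exp (- (\<Sum>A\<in>Pow E. count_cost N A))"
    by (simp add: exp_sum[OF finite_triples, symmetric] sum_negf sum_triples count_cost_def step_prob_def)
  finally show ?thesis .
qed

lemma path_weight_le:
  assumes w: "is_path w" and N: "circulation N" "\<And>t. trans_count w t \<le> N t"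
    and c: "(\<Sum>t\<in>triples. N t) \<le> (\<Sum>t\<in>triples. trans_count w t) + c"
  shows "path_weight next_prob w \<le> (1 / pmin) ^ c * exp (- (\<Sum>A\<in>Pow E. count_cost N A)) * path_weight (freq_wt N) w"
proof -
  let ?m = "\<lambda>t. N t - trans_count w t"
  have "(\<Sum>t\<in>triples. N t) = (\<Sum>t\<in>triples. trans_count w t) + (\<Sum>t\<in>triples. ?m t)"
    using N(2) by (simp flip: sum.distrib)
  then have m: "(\<Sum>t\<in>triples. ?m t) \<le> c" using c by linarith
  have "pmin ^ c \<le> pmin ^ (\<Sum>t\<in>triples. ?m t)"
    using m pmin_pos pmin_le_1 by (intro power_decreasing) auto
  also have "\<dots> = (\<Prod>t\<in>triples. pmin ^ ?m t)" by (rule power_sum)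
  also have "\<dots> \<le> (\<Prod>t\<in>triples. step_prob t ^ ?m t)"
  proof (rule prod_mono)
    fix t assume t: "t \<in> triples"
    show "0 \<le> pmin ^ ?m t \<and> pmin ^ ?m t \<le> step_prob t ^ ?m t"
    proof (cases "?m t = 0")
      case False
      obtain A x y where t_eq: "t = (A, x, y)" by (cases t)
      have "N (A, x, y) \<noteq> 0" using False t_eq by auto
      then have "arc_step x y" using circulationD[OF N(1)] by (simp add: arc_rel_def)
      then have "pmin \<le> step_prob t" using pmin_le t by (auto simp: t_eq step_prob_def triples_def)
      then show ?thesis using pmin_pos by (intro conjI power_mono) auto
    qed simp
  qed
  finally have pm: "pmin ^ c \<le> (\<Prod>t\<in>triples. step_prob t ^ ?m t)" .
  have P0: "(\<Prod>t\<in>triples. step_prob t ^ trans_count w t) \<ge> 0"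
    by (intro prod_nonneg zero_le_power step_prob_nonneg ballI)
  have "pmin ^ c * path_weight next_prob w \<le> (\<Prod>t\<in>triples. step_prob t ^ ?m t) * (\<Prod>t\<in>triples. step_prob t ^ trans_count w t)"
    using pm path_weight_le_prod[OF w] pmin_pos path_weight_nonneg[of next_prob w] next_prob_nonneg
      prod_nonneg[of triples "\<lambda>t. step_prob t ^ ?m t"] step_prob_nonneg
    by (intro mult_mono) auto
  also have "\<dots> = (\<Prod>t\<in>triples. step_prob t ^ N t)"
    using N(2) by (simp add: prod.distrib[symmetric] power_add[symmetric])
  also have "\<dots> = exp (- (\<Sum>A\<in>Pow E. count_cost N A)) * (\<Prod>t\<in>triples. freq N t ^ N t)"
    by (rule step_prob_prod_eq[OF N(1)])
  also have "\<dots> \<le> exp (- (\<Sum>A\<in>Pow E. count_cost N A)) * path_weight (freq_wt N) w"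
    unfolding path_weight_freq_wt[OF w]
  proof (intro mult_left_mono prod_mono conjI)
    fix t assume t: "t \<in> triples"
    show "0 \<le> freq N t ^ N t" by (simp add: freq_nonneg)
    have "freq N t \<le> 1" using t freq_le_1 by (auto simp: triples_def)
    then show "freq N t ^ N t \<le> freq N t ^ trans_count w t"
      using N(2) by (intro power_decreasing) (auto simp: freq_nonneg)
  qed simp
  finally show ?thesis using pmin_pos by (simp add: field_simps)
qed

text \<open>The counts \<open>N\<close> depend on the path and occur on the right side. Confining
  them to a box of polynomial size allows a sum over all \<open>N\<close> to replace the unknown
  one.\<close>

abbreviation estimates :: "'v set set set \<Rightarrow> nat \<Rightarrow> ('v \<times> 'v) list \<Rightarrow> bool" where
  "estimates S0 C w \<equiv> \<exists>N \<mu> p. (\<forall>t. t \<notin> triples \<longrightarrow> N t = 0) \<and> (\<forall>t\<in>triples. N t \<le> length w + C) \<and>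
       \<mu> \<in> Cl E S0 \<and> p \<in> admissible E x0 z \<mu> S0 \<and>
       (\<forall>x\<in>arcs E. \<bar>pmf \<mu> x - pmf (emp w) x\<bar> \<le> 2 * real C / real (length w)) \<and>
       path_weight next_prob w \<le> (1 / pmin) ^ C * exp (- real (length w) * plan_cost p) * path_weight (freq_wt N) w"

lemma path_estimate:
  "\<exists>C. \<forall>w S0 B. is_path w \<longrightarrow> decreasing_family E x0 S0 \<longrightarrow> B \<in> S0 \<longrightarrow> visited w \<subseteq> B \<longrightarrow>
    estimates S0 C w"
proof -
  obtain C0 where C0: "\<And>w. is_path w \<Longrightarrow> (\<exists>N. closes w C0 N)"
    using closed_counts by blast
  define P where "P = card (Pow E)"
  \<comment> \<open>A closing error of at most \<open>C0\<close> for every possible stage.\<close>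
  define C where "C = P * C0"
  have finP: "finite (Pow E)" using finite_E by simp
  show ?thesis
  proof (intro exI[of _ C] allI impI)
    fix w S0 B
    assume w: "is_path w" and dec: "decreasing_family E x0 S0" and B: "B \<in> S0" "visited w \<subseteq> B"
    obtain N where N: "circulation N" and supp: "\<And>A x y. N (A, x, y) \<noteq> 0 \<Longrightarrow> A \<in> chain w"
      and ge: "\<And>t. trans_count w t \<le> N t"
      and oc: "\<And>A x. out_count N A x \<le> node_count w A x + C0" "\<And>A x. node_count w A x \<le> out_count N A x + C0"
      and tot: "\<And>A. (\<Sum>x\<in>arcs E. node_count w A x) \<le> tot_count N A"
        "\<And>A. tot_count N A \<le> tot_count (trans_count w) A + C0"
        "\<And>A. tot_count N A \<le> (\<Sum>x\<in>arcs E. node_count w A x) + C0"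
      using C0[OF w] by blast
    obtain Es where g: "growth (card E) Es" and ch: "chain w \<subseteq> Es ` {1..card E}"
      using path_edge_sequence[OF w] by blast
    have chS: "chain w \<subseteq> S0" by (rule chain_decreasing(1)[OF dec w B])
    have chB: "A \<subseteq> B" if "A \<in> chain w" for A using chain_subset[OF that] B(2) by (rule subset_trans)
    have chE: "chain w \<subseteq> Pow E" using chain_connected(1)[OF w] by blast
    define n where "n = length w"
    define m where "m = (\<Sum>A\<in>Pow E. tot_count N A)"
    have n0: "n > 0" using is_path_nonempty[OF w] by (simp add: n_def)
    have cnt: "(\<Sum>A\<in>Pow E. node_count w A x) = count_list w x" for x
      by (rule sum_node_count[OF finP chE])
    have n_eq: "n = (\<Sum>A\<in>Pow E. \<Sum>x\<in>arcs E. node_count w A x)"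
    proof -
      have "n = (\<Sum>x\<in>arcs E. count_list w x)"
        unfolding n_def by (rule sum_count_set[symmetric, OF is_path_arcs[OF w] finite_arcs])
      also have "\<dots> = (\<Sum>x\<in>arcs E. \<Sum>A\<in>Pow E. node_count w A x)" by (simp only: cnt)
      finally show ?thesis by (subst sum.swap)
    qed
    have nm: "n \<le> m" unfolding n_eq m_def by (intro sum_mono tot)
    have "m \<le> (\<Sum>A\<in>Pow E. (\<Sum>x\<in>arcs E. node_count w A x) + C0)" unfolding m_def by (intro sum_mono tot)
    also have "\<dots> = n + C" by (simp add: n_eq C_def P_def sum.distrib)
    finally have mn: "m \<le> n + C" .
    have trip: "(\<Sum>t\<in>triples. M t) = (\<Sum>A\<in>Pow E. tot_count M A)" for M
      by (simp add: sum_triples tot_count_def out_count_def)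
    have "(\<Sum>A\<in>Pow E. tot_count N A) \<le> (\<Sum>A\<in>Pow E. tot_count (trans_count w) A + C0)"
      by (intro sum_mono tot)
    then have extra: "(\<Sum>t\<in>triples. N t) \<le> (\<Sum>t\<in>triples. trans_count w t) + C"
      unfolding trip by (simp add: C_def P_def sum.distrib)
    have m0: "real m > 0" using n0 nm by linarith
    obtain \<mu> p where \<mu>: "\<mu> \<in> Cl E S0" and p: "p \<in> admissible E x0 z \<mu> S0"
      and \<mu>m: "\<And>x. x \<in> arcs E \<Longrightarrow> real m * pmf \<mu> x = real (\<Sum>A\<in>Pow E. out_count N A x)"
      and cost: "real m * plan_cost p = (\<Sum>A\<in>Pow E. count_cost N A)"
    proof -
      have "\<exists>\<mu> p. \<mu> \<in> Cl E S0 \<and> p \<in> admissible E x0 z \<mu> S0 \<and>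
        (\<forall>x\<in>arcs E. real m * pmf \<mu> x = real (\<Sum>A\<in>Pow E. out_count N A x)) \<and>
        real m * plan_cost p = (\<Sum>A\<in>Pow E. count_cost N A)"
        by (rule plan_of_counts[OF N g ch chS _ B(1) chB _ m0]) (use supp in \<open>auto simp: m_def\<close>)
      then show thesis using that by blast
    qed
    have N0: "N t = 0" if "t \<notin> triples" for t
    proof (rule ccontr)
      assume "N t \<noteq> 0"
      moreover obtain A x y where t: "t = (A, x, y)" by (cases t)
      ultimately have Nt: "N (A, x, y) \<noteq> 0" by simp
      from supp[OF Nt] have "A \<in> Pow E" using chE by blast
      moreover have "x \<in> arcs A" "y \<in> arcs A" using circulationD[OF N Nt] by (simp_all add: arc_rel_def)
      ultimately show False using that arcs_mono[of A E] by (auto simp: t triples_def)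
    qed
    have N_le: "N t \<le> n + C" if t: "t \<in> triples" for t
    proof -
      have "N t \<le> (\<Sum>t\<in>triples. N t)" by (rule member_le_sum[OF t _ finite_triples]) simp
      also have "\<dots> = m" by (simp add: trip m_def)
      finally show ?thesis using mn by simp
    qed
    \<comment> \<open>One error \<open>C\<close> comes from comparing the counts, the other from
      normalising by \<open>m\<close> instead of \<open>n\<close>.\<close>
    have close: "\<bar>pmf \<mu> x - pmf (emp w) x\<bar> \<le> 2 * real C / real n" if x: "x \<in> arcs E" for x
    proof -
      define a where "a = (\<Sum>A\<in>Pow E. out_count N A x)"
      define b where "b = count_list w x"
      have "a \<le> (\<Sum>A\<in>Pow E. node_count w A x + C0)" unfolding a_def by (intro sum_mono oc)
      then have ab: "a \<le> b + C" by (simp add: sum.distrib cnt b_def C_def P_def)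
      have "(\<Sum>A\<in>Pow E. node_count w A x) \<le> (\<Sum>A\<in>Pow E. out_count N A x + C0)" by (intro sum_mono oc)
      then have ba: "b \<le> a + C" by (simp add: sum.distrib cnt b_def C_def P_def a_def)
      have eb: "real n * pmf (emp w) x = real b"
        using is_path_nonempty[OF w] by (simp add: pmf_emp n_def b_def)
      have ea: "real m * pmf \<mu> x = real a" using \<mu>m[OF x] by (simp add: a_def)
      have mp: "real n * pmf \<mu> x \<le> real m * pmf \<mu> x" "real m * pmf \<mu> x \<le> real n * pmf \<mu> x + real C"
      proof -
        show "real n * pmf \<mu> x \<le> real m * pmf \<mu> x" using nm by (intro mult_right_mono) auto
        have "real m * pmf \<mu> x \<le> (real n + real C) * pmf \<mu> x" using mn by (intro mult_right_mono) auto
        also have "\<dots> \<le> real n * pmf \<mu> x + real C" by (simp add: algebra_simps mult_left_le pmf_le_1)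
        finally show "real m * pmf \<mu> x \<le> real n * pmf \<mu> x + real C" .
      qed
      have "\<bar>real n * pmf \<mu> x - real n * pmf (emp w) x\<bar> \<le> 2 * real C"
        using mp ea eb ab ba by linarith
      then have "real n * \<bar>pmf \<mu> x - pmf (emp w) x\<bar> \<le> 2 * real C"
        by (simp add: abs_mult flip: right_diff_distrib)
      then show ?thesis using n0 by (simp add: field_simps)
    qed
    have "path_weight next_prob w \<le> (1 / pmin) ^ C * exp (- (\<Sum>A\<in>Pow E. count_cost N A)) * path_weight (freq_wt N) w"
      by (rule path_weight_le[OF w N ge extra])
    also have "\<dots> \<le> (1 / pmin) ^ C * exp (- real n * plan_cost p) * path_weight (freq_wt N) w"
    proof (intro mult_right_mono mult_left_mono)
      \<comment> \<open>The balanced total \<open>m\<close> is at least \<open>n\<close> and costs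
        are nonnegative, so passing from \<open>m\<close> to \<open>n\<close> only weakens the
        bound.\<close>
      have "real n * plan_cost p \<le> real m * plan_cost p"
        using nm plan_cost_nonneg[OF p] by (intro mult_right_mono) auto
      then show "exp (- (\<Sum>A\<in>Pow E. count_cost N A)) \<le> exp (- real n * plan_cost p)"
        by (simp add: cost)
    qed (use pmin_pos path_weight_nonneg[of "freq_wt N"] freq_wt_nonneg in auto)
    finally have pw: "path_weight next_prob w \<le> (1 / pmin) ^ C * exp (- real n * plan_cost p) * path_weight (freq_wt N) w" .
    show "estimates S0 C w"
      unfolding n_def[symmetric]
      by (rule exI[of _ N], rule exI[of _ \<mu>], rule exI[of _ p]) (intro conjI allI ballI impI N0 N_le \<mu> p close pw)
  qed
qed

text \<open>The number \<open>c\<close> is any lower bound of the variational expression. Each path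
  is dominated by the weight of its own counts, hence by the sum over the box \<Theta>; after the
  two sums are exchanged, every inner sum over paths is polynomial in \<open>j\<close>.\<close>

lemma upper_bound:
  fixes h :: "('v \<times> 'v) pmf \<Rightarrow> real"
  assumes dec: "decreasing_family E x0 S0"
    and h: "continuous_map (weak_topology (arcs E)) euclideanreal h"
    and c: "\<And>\<mu> p. \<mu> \<in> Cl E S0 \<Longrightarrow> p \<in> admissible E x0 z \<mu> S0 \<Longrightarrow> c \<le> plan_cost p + h \<mu>"
    and \<epsilon>: "\<epsilon> > 0"
  shows "\<exists>K L d n0. K > 0 \<and> L > 0 \<and> (\<forall>j\<ge>n0.
    iter (arcs E) next_prob (tilt E S0 h (real (Suc j))) j [z]
      \<le> K * (real j + L) ^ d * exp (- real (Suc j) * (c - \<epsilon>)))"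
proof -
  obtain C where C: "\<And>w S0 B. is_path w \<Longrightarrow> decreasing_family E x0 S0 \<Longrightarrow> B \<in> S0 \<Longrightarrow> visited w \<subseteq> B \<Longrightarrow>
    estimates S0 C w"
    using path_estimate by blast
  obtain \<eta> where \<eta>: "\<eta> > 0" "\<And>\<mu> \<nu>. \<mu> \<in> probs (arcs E) \<Longrightarrow> \<nu> \<in> probs (arcs E) \<Longrightarrow>
      (\<forall>a\<in>arcs E. \<bar>pmf \<nu> a - pmf \<mu> a\<bar> < \<eta>) \<Longrightarrow> \<bar>h \<nu> - h \<mu>\<bar> < \<epsilon>"
    using weak_uniformly_continuous[OF finite_arcs h \<epsilon>] by blast
  \<comment> \<open>From \<open>n0\<close> on the distance between the empirical and the balanced
    measure is below the modulus \<eta>.\<close>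
  obtain n0 :: nat where n0: "2 * real C / \<eta> < real n0" using reals_Archimedean2 by blast
  define D where "D = real (card (arcs E))"
  define K1 where "K1 = (1 / pmin) ^ C"
  \<comment> \<open>Chosen so that \<open>Suc j + C + 1\<close> equals
    \<open>real j + L\<close>.\<close>
  define L where "L = real C + 2"
  have K1: "K1 > 0" using pmin_pos by (simp add: K1_def)
  have D1: "D \<ge> 1"
  proof -
    have "card (arcs E) \<noteq> 0" using z(1) by auto
    then show ?thesis unfolding D_def by linarith
  qed
  show ?thesis
  proof (intro exI conjI allI impI)
    show "K1 * D ^ card E > 0" "L > 0" using K1 D1 by (auto simp: L_def)
    fix j assume j: "n0 \<le> j"
    let ?F = "tilt E S0 h (real (Suc j))"
    let ?e = "K1 * exp (- real (Suc j) * (c - \<epsilon>))"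
    define \<Theta> where "\<Theta> = {N. (\<forall>t. t \<notin> triples \<longrightarrow> N t = 0) \<and> (\<forall>t\<in>triples. N t \<le> Suc j + C)}"
    have fin\<Theta>: "finite \<Theta>" and card\<Theta>: "card \<Theta> \<le> (Suc j + C + 1) ^ card triples"
      unfolding \<Theta>_def using finite_bounded_functions[OF finite_triples] by blast+
    have term_le: "path_weight next_prob (v @ [z]) * ?F (v @ [z]) \<le> ?e * (\<Sum>N\<in>\<Theta>. path_weight (freq_wt N) (v @ [z]))"
      if v: "set v \<subseteq> arcs E" "length v = j" for v
    proof (cases "path_weight next_prob (v @ [z]) > 0 \<and> emp (v @ [z]) \<in> Cl E S0")
      case False
      then have "path_weight next_prob (v @ [z]) * ?F (v @ [z]) = 0"
        using path_weight_nonneg[of next_prob "v @ [z]"] next_prob_nonneg by (auto simp: not_less)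
      also have "0 \<le> ?e * (\<Sum>N\<in>\<Theta>. path_weight (freq_wt N) (v @ [z]))"
        using K1 by (intro mult_nonneg_nonneg sum_nonneg path_weight_nonneg freq_wt_nonneg) auto
      finally show ?thesis .
    next
      case True
      let ?w = "v @ [z]"
      have path: "is_path ?w" using is_pathI v True by blast
      have len: "length ?w = Suc j" using v by simp
      obtain B where B: "B \<in> S0" "set_pmf (map_pmf arc_edge (emp ?w)) \<subseteq> B"
        using True by (auto simp: Cl_def)
      have emp_probs: "emp ?w \<in> probs (arcs E)" using True by (simp add: Cl_def)
      have "set_pmf (emp ?w) = set ?w" by (rule set_emp) simp
      then have vis: "visited ?w \<subseteq> B" using B(2) by simp
      obtain N \<mu> p where N: "N \<in> \<Theta>" and \<mu>: "\<mu> \<in> Cl E S0" and p: "p \<in> admissible E x0 z \<mu> S0"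
        and close: "\<forall>x\<in>arcs E. \<bar>pmf \<mu> x - pmf (emp ?w) x\<bar> \<le> 2 * real C / real (Suc j)"
        and pw: "path_weight next_prob ?w \<le> K1 * exp (- real (Suc j) * plan_cost p) * path_weight (freq_wt N) ?w"
        using C[OF path dec B(1) vis] unfolding len \<Theta>_def K1_def by blast
      have "2 * real C / real (Suc j) < \<eta>"
      proof -
        have "real n0 < real (Suc j)" using j by simp
        then have "2 * real C / \<eta> < real (Suc j)" using n0 by linarith
        then show ?thesis using \<eta>(1) by (simp add: field_simps)
      qed
      then have "\<forall>x\<in>arcs E. \<bar>pmf \<mu> x - pmf (emp ?w) x\<bar> < \<eta>" using close by (meson le_less_trans)
      moreover have "\<mu> \<in> probs (arcs E)" using \<mu> by (simp add: Cl_def)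
      ultimately have "\<bar>h \<mu> - h (emp ?w)\<bar> < \<epsilon>" using \<eta>(2) emp_probs by blast
      moreover have "c \<le> plan_cost p + h \<mu>" by (rule c[OF \<mu> p])
      ultimately have "c - \<epsilon> \<le> plan_cost p + h (emp ?w)" by linarith
      then have "real (Suc j) * (c - \<epsilon>) \<le> real (Suc j) * (plan_cost p + h (emp ?w))"
        by (intro mult_left_mono) auto
      then have ex: "exp (- real (Suc j) * plan_cost p) * exp (- real (Suc j) * h (emp ?w)) \<le> exp (- real (Suc j) * (c - \<epsilon>))"
        unfolding exp_add[symmetric] by (simp add: algebra_simps)
      have f0: "path_weight (freq_wt N) ?w \<ge> 0" by (rule path_weight_nonneg) (rule freq_wt_nonneg)
      have "path_weight next_prob ?w * ?F ?w \<le> (K1 * exp (- real (Suc j) * plan_cost p) * path_weight (freq_wt N) ?w) * exp (- real (Suc j) * h (emp ?w))"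
        using True pw by (simp add: mult_right_mono)
      also have "\<dots> = (K1 * path_weight (freq_wt N) ?w) * (exp (- real (Suc j) * plan_cost p) * exp (- real (Suc j) * h (emp ?w)))"
        by (simp only: mult_ac)
      also have "\<dots> \<le> (K1 * path_weight (freq_wt N) ?w) * exp (- real (Suc j) * (c - \<epsilon>))"
        using ex K1 f0 by (intro mult_left_mono mult_nonneg_nonneg) auto
      also have "\<dots> = ?e * path_weight (freq_wt N) ?w" by (simp only: mult_ac)
      also have "\<dots> \<le> ?e * (\<Sum>N\<in>\<Theta>. path_weight (freq_wt N) ?w)"
        using K1 by (intro mult_left_mono member_le_sum N fin\<Theta> path_weight_nonneg freq_wt_nonneg) auto
      finally show ?thesis .
    qed
    have "iter (arcs E) next_prob ?F j [z] = (\<Sum>v | set v \<subseteq> arcs E \<and> length v = j. path_weight next_prob (v @ [z]) * ?F (v @ [z]))"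
      using iter_eq_sum[OF finite_arcs, of "[z]" next_prob ?F j] by simp
    also have "\<dots> \<le> (\<Sum>v | set v \<subseteq> arcs E \<and> length v = j. ?e * (\<Sum>N\<in>\<Theta>. path_weight (freq_wt N) (v @ [z])))"
      by (intro sum_mono term_le) auto
    also have "\<dots> = ?e * (\<Sum>N\<in>\<Theta>. \<Sum>v | set v \<subseteq> arcs E \<and> length v = j. path_weight (freq_wt N) (v @ [z]))"
      unfolding sum_distrib_left[symmetric] by (subst sum.swap) simp
    also have "\<dots> = ?e * (\<Sum>N\<in>\<Theta>. iter (arcs E) (freq_wt N) (\<lambda>_. 1) j [z])"
    proof -
      have "(\<Sum>v | set v \<subseteq> arcs E \<and> length v = j. path_weight (freq_wt N) (v @ [z])) = iter (arcs E) (freq_wt N) (\<lambda>_. 1) j [z]" for N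
        using iter_eq_sum[OF finite_arcs, of "[z]" "freq_wt N" "\<lambda>_. 1" j] by simp
      then show ?thesis by (simp only:)
    qed
    also have "\<dots> \<le> ?e * (real (card \<Theta>) * (D * real (Suc j)) ^ card E)"
    proof (intro mult_left_mono sum_bounded_above)
      fix N
      have "iter (arcs E) (freq_wt N) (\<lambda>_. 1) j [z] \<le> (D * real (Suc j)) ^ card (E - visited [z])"
        unfolding D_def by (rule iter_freq_wt_le) (use z(1) in auto)
      also have "\<dots> \<le> (D * real (Suc j)) ^ card E"
      proof (rule power_increasing)
        show "card (E - visited [z]) \<le> card E" using finite_E by (intro card_mono) auto
        have "1 * 1 \<le> D * real (Suc j)" using D1 by (intro mult_mono) auto
        then show "1 \<le> D * real (Suc j)" by simp
      qed
      finally show "iter (arcs E) (freq_wt N) (\<lambda>_. 1) j [z] \<le> (D * real (Suc j)) ^ card E" .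
    qed (use K1 in simp)
    also have "\<dots> \<le> ?e * ((real j + L) ^ card triples * (D ^ card E * (real j + L) ^ card E))"
    proof (intro mult_left_mono mult_mono)
      have "real (card \<Theta>) \<le> real ((Suc j + C + 1) ^ card triples)" using card\<Theta> by (simp only: of_nat_le_iff)
      also have "\<dots> = (real j + L) ^ card triples" by (simp add: L_def algebra_simps)
      finally show "real (card \<Theta>) \<le> (real j + L) ^ card triples" .
      show "(D * real (Suc j)) ^ card E \<le> D ^ card E * (real j + L) ^ card E"
        unfolding power_mult_distrib using D1 by (intro mult_left_mono power_mono) (auto simp: L_def)
    qed (use K1 D1 in \<open>auto simp: L_def\<close>)
    also have "\<dots> = K1 * D ^ card E * (real j + L) ^ (card triples + card E) * exp (- real (Suc j) * (c - \<epsilon>))"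
      by (simp add: power_add mult_ac)
    finally show "iter (arcs E) next_prob ?F j [z] \<le> K1 * D ^ card E * (real j + L) ^ (card triples + card E) * exp (- real (Suc j) * (c - \<epsilon>))" .
  qed
qed

section \<open>Controlled walks\<close>

text \<open>The value function of the control problem: minus the logarithm of the expectation of
  \<open>F\<close> at length \<open>n\<close>, given the history \<open>w\<close>.\<close>

definition cost_to_go :: "(('v \<times> 'v) list \<Rightarrow> real) \<Rightarrow> nat \<Rightarrow> ('v \<times> 'v) list \<Rightarrow> real" where
  "cost_to_go F n w = - ln (iter (arcs E) next_prob F (n - length w) w)"

text \<open>Histories run backwards in time, hence the exchanged arguments of
  \<open>arc_step\<close>.\<close>

definition linked :: "('v \<times> 'v) list \<Rightarrow> bool" where
  "linked = successively (\<lambda>y x. arc_step x y)"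

lemma linked_Cons: "v \<noteq> [] \<Longrightarrow> linked (b # v) \<longleftrightarrow> arc_step (hd v) b \<and> linked v"
  by (cases v) (auto simp: linked_def)

lemma trancl_trail:
  assumes "(a, b) \<in> (arc_rel A)\<^sup>+"
  shows "\<exists>v. v \<noteq> [] \<and> hd v = b \<and> set v \<subseteq> arcs A \<and> linked (v @ [a])"
  using assms
proof (induction rule: trancl_induct)
  case (base b)
  then show ?case by (intro exI[of _ "[b]"]) (simp add: arc_rel_def linked_def)
next
  case (step b c)
  then obtain v where v: "v \<noteq> []" "hd v = b" "set v \<subseteq> arcs A" "linked (v @ [a])" by blast
  then show ?case
    using step.hyps(2) by (intro exI[of _ "c # v"]) (simp add: arc_rel_def linked_Cons)
qed

abbreviation trails :: "nat \<Rightarrow> bool" where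
  "trails L \<equiv> \<forall>A a b. A \<subseteq> E \<longrightarrow> graph_connected (\<Union>A) A \<longrightarrow> a \<in> arcs A \<longrightarrow> b \<in> arcs A \<longrightarrow>
     (\<exists>v. v \<noteq> [] \<and> hd v = b \<and> set v \<subseteq> arcs A \<and> linked (v @ [a]) \<and> length v \<le> L)"

lemma bounded_trail:
  "\<exists>L. trails L"
proof -
  define f where "f t = (case t of (A, a, b) \<Rightarrow> SOME v. v \<noteq> [] \<and> hd v = b \<and> set v \<subseteq> arcs A \<and> linked (v @ [a]))" for t
  have "\<exists>v. v \<noteq> [] \<and> hd v = b \<and> set v \<subseteq> arcs A \<and> linked (v @ [a]) \<and> length v \<le> (\<Sum>t\<in>triples. length (f t))"
    if A: "A \<subseteq> E" "graph_connected (\<Union>A) A" and ab: "a \<in> arcs A" "b \<in> arcs A" for A a b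
  proof -
    have f: "f (A, a, b) \<noteq> [] \<and> hd (f (A, a, b)) = b \<and> set (f (A, a, b)) \<subseteq> arcs A \<and> linked (f (A, a, b) @ [a])"
      using someI_ex[OF trancl_trail[OF arc_rel_trancl[OF A(2) ab]]] by (simp add: f_def)
    have "(A, a, b) \<in> triples" using A ab arcs_mono[OF A(1)] by (auto simp: triples_def)
    then have "length (f (A, a, b)) \<le> (\<Sum>t\<in>triples. length (f t))"
      using finite_triples by (intro member_le_sum[where f = "\<lambda>t. length (f t)"]) auto
    with f show ?thesis by (intro exI[of _ "f (A, a, b)"]) simp
  qed
  then show ?thesis by blast
qed

text \<open>The expectation of \<open>\<Phi>\<close> over the next \<open>m\<close> arcs of the chain with kernel \<open>q\<close> at \<open>a\<close>; as the newest
  arc comes first, the first step is the last entry.\<close>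

primrec block_exp :: "('v \<times> 'v \<Rightarrow> ('v \<times> 'v) pmf) \<Rightarrow> nat \<Rightarrow> 'v \<times> 'v \<Rightarrow> (('v \<times> 'v) list \<Rightarrow> real) \<Rightarrow> real" where
  "block_exp q 0 a \<Phi> = \<Phi> []"
| "block_exp q (Suc m) a \<Phi> = (\<Sum>b\<in>arcs E. pmf (q a) b * block_exp q m b (\<lambda>v. \<Phi> (v @ [b])))"

text \<open>All entropies are taken relative to the kernel of \<open>A\<close>, since a block opens
  no new edge.\<close>

primrec block_cost :: "'v set set \<Rightarrow> ('v \<times> 'v \<Rightarrow> ('v \<times> 'v) pmf) \<Rightarrow> nat \<Rightarrow> 'v \<times> 'v \<Rightarrow> real" where
  "block_cost A q 0 a = 0"
| "block_cost A q (Suc m) a = entropy_at A q a + (\<Sum>b\<in>arcs E. pmf (q a) b * block_cost A q m b)"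

definition stationary :: "'v set set \<Rightarrow> ('v \<times> 'v) pmf \<Rightarrow> ('v \<times> 'v \<Rightarrow> ('v \<times> 'v) pmf) \<Rightarrow> bool" where
  "stationary A \<mu> q \<longleftrightarrow> A \<subseteq> E \<and> set_pmf \<mu> \<subseteq> arcs A \<and> q \<in> transitions E \<and> bind_pmf \<mu> q = \<mu>"

section \<open>Blocks of a stationary chain\<close>

context
  fixes A :: "'v set set" and \<mu> :: "('v \<times> 'v) pmf" and q :: "'v \<times> 'v \<Rightarrow> ('v \<times> 'v) pmf"
  assumes st: "stationary A \<mu> q"
begin

lemma stationary_sets: "A \<subseteq> E" "set_pmf \<mu> \<subseteq> arcs A" "set_pmf \<mu> \<subseteq> arcs E" "q \<in> transitions E"
  using st arcs_mono[of A E] by (auto simp: stationary_def)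

text \<open>Mass leaving the support of \<mu> would show up in the image measure. So bounds along a
  block are needed on this support only, which lies in \<open>arcs A\<close>.\<close>

lemma stationary_closed: "a \<in> set_pmf \<mu> \<Longrightarrow> b \<in> set_pmf (q a) \<Longrightarrow> b \<in> set_pmf \<mu>"
proof -
  assume "a \<in> set_pmf \<mu>" "b \<in> set_pmf (q a)"
  then have "b \<in> set_pmf (bind_pmf \<mu> q)" unfolding set_bind_pmf by blast
  moreover have "bind_pmf \<mu> q = \<mu>" using st unfolding stationary_def by blast
  ultimately show ?thesis by (simp only:)
qed

lemma stationary_sum_q: "a \<in> set_pmf \<mu> \<Longrightarrow> (\<Sum>b\<in>arcs E. pmf (q a) b) = 1"
  by (intro sum_pmf_eq_1 finite_arcs subsetI) (rule subsetD[OF stationary_sets(3) stationary_closed])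

lemma stationary_sum_\<mu>: "(\<Sum>a\<in>arcs E. pmf \<mu> a) = 1"
  using stationary_sets(3) by (intro sum_pmf_eq_1) auto

lemma stationary_average: "(\<Sum>a\<in>arcs E. pmf \<mu> a * (\<Sum>b\<in>arcs E. pmf (q a) b * g b)) = (\<Sum>b\<in>arcs E. pmf \<mu> b * g b)"
proof -
  have mu: "pmf \<mu> b = (\<Sum>a\<in>arcs E. pmf (q a) b * pmf \<mu> a)" for b
  proof -
    have "pmf \<mu> b = pmf (bind_pmf \<mu> q) b" using st by (simp add: stationary_def)
    also have "\<dots> = (\<Sum>a\<in>arcs E. pmf (q a) b * pmf \<mu> a)"
      unfolding pmf_bind using stationary_sets(3) by (intro integral_measure_pmf_real) auto
    finally show ?thesis .
  qed
  have "(\<Sum>b\<in>arcs E. pmf \<mu> b * g b) = (\<Sum>b\<in>arcs E. (\<Sum>a\<in>arcs E. pmf (q a) b * pmf \<mu> a) * g b)"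
    by (intro sum.cong refl arg_cong2[where f = "(*)"] mu)
  also have "\<dots> = (\<Sum>b\<in>arcs E. \<Sum>a\<in>arcs E. pmf \<mu> a * (pmf (q a) b * g b))"
    by (simp add: sum_distrib_left mult_ac)
  also have "\<dots> = (\<Sum>a\<in>arcs E. pmf \<mu> a * (\<Sum>b\<in>arcs E. pmf (q a) b * g b))"
    by (subst sum.swap) (simp add: sum_distrib_left)
  finally show ?thesis by simp
qed

lemma sum_q_mono:
  assumes a: "a \<in> set_pmf \<mu>" and f: "\<And>b. b \<in> set_pmf \<mu> \<Longrightarrow> f b \<le> g b"
  shows "(\<Sum>b\<in>arcs E. pmf (q a) b * f b) \<le> (\<Sum>b\<in>arcs E. pmf (q a) b * g b)"
proof (rule sum_mono)
  fix b
  show "pmf (q a) b * f b \<le> pmf (q a) b * g b"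
  proof (cases "b \<in> set_pmf (q a)")
    case True
    then show ?thesis using f[OF stationary_closed[OF a True]] by (simp add: mult_left_mono)
  next
    case False
    then have "pmf (q a) b = 0" by (simp add: pmf_eq_0_set_pmf)
    then show ?thesis by simp
  qed
qed

lemma block_exp_mono:
  assumes "a \<in> set_pmf \<mu>" "\<And>v. length v = m \<Longrightarrow> set v \<subseteq> set_pmf \<mu> \<Longrightarrow> \<Phi> v \<le> \<Psi> v"
  shows "block_exp q m a \<Phi> \<le> block_exp q m a \<Psi>"
  using assms
proof (induction m arbitrary: a \<Phi> \<Psi>)
  case (Suc m)
  show ?case unfolding block_exp.simps
  proof (rule sum_q_mono[OF Suc.prems(1)])
    fix b assume "b \<in> set_pmf \<mu>"
    then show "block_exp q m b (\<lambda>v. \<Phi> (v @ [b])) \<le> block_exp q m b (\<lambda>v. \<Psi> (v @ [b]))"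
      using Suc.prems(2) by (intro Suc.IH) auto
  qed
qed simp

lemma block_exp_add_const:
  assumes "a \<in> set_pmf \<mu>" shows "block_exp q m a (\<lambda>v. c + \<Phi> v) = c + block_exp q m a \<Phi>"
  using assms
proof (induction m arbitrary: a \<Phi>)
  case (Suc m)
  have "(\<Sum>b\<in>arcs E. pmf (q a) b * block_exp q m b (\<lambda>v. c + \<Phi> (v @ [b]))) =
    (\<Sum>b\<in>arcs E. pmf (q a) b * (c + block_exp q m b (\<lambda>v. \<Phi> (v @ [b]))))"
    by (intro antisym sum_q_mono Suc.prems) (simp_all add: Suc.IH)
  also have "\<dots> = c * (\<Sum>b\<in>arcs E. pmf (q a) b) + (\<Sum>b\<in>arcs E. pmf (q a) b * block_exp q m b (\<lambda>v. \<Phi> (v @ [b])))"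
    by (simp add: distrib_left sum.distrib sum_distrib_left mult_ac)
  finally show ?case by (simp add: stationary_sum_q[OF Suc.prems])
qed simp

lemma sum_\<mu>_mono:
  assumes "\<And>a. a \<in> set_pmf \<mu> \<Longrightarrow> f a \<le> g a"
  shows "(\<Sum>a\<in>arcs E. pmf \<mu> a * f a) \<le> (\<Sum>a\<in>arcs E. pmf \<mu> a * g a)"
proof (rule sum_mono)
  fix a
  show "pmf \<mu> a * f a \<le> pmf \<mu> a * g a"
  proof (cases "a \<in> set_pmf \<mu>")
    case False
    then have "pmf \<mu> a = 0" by (simp add: pmf_eq_0_set_pmf)
    then show ?thesis by simp
  qed (simp add: assms mult_left_mono)
qed

text \<open>Started from \<mu>, each of the \<open>m\<close> arcs of a block has law \<mu>, so
  expected counts are exact without any mixing. Affine functions suffice because squares of counts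
  are linearised before averaging.\<close>

lemma block_exp_average:
  "(\<Sum>a\<in>arcs E. pmf \<mu> a * block_exp q m a (\<lambda>v. c + (\<Sum>x\<in>arcs E. \<beta> x * real (count_list v x)))) =
    c + real m * (\<Sum>x\<in>arcs E. \<beta> x * pmf \<mu> x)"
proof (induction m)
  case 0
  then show ?case by (simp add: stationary_sum_\<mu> flip: sum_distrib_right)
next
  case (Suc m)
  let ?\<Phi> = "\<lambda>v. c + (\<Sum>x\<in>arcs E. \<beta> x * real (count_list v x))"
  have snoc: "?\<Phi> (v @ [b]) = \<beta> b + ?\<Phi> v" if "b \<in> arcs E" for v b
  proof -
    have "(\<Sum>x\<in>arcs E. \<beta> x * real (count_list (v @ [b]) x)) =
      (\<Sum>x\<in>arcs E. \<beta> x * real (count_list v x) + (if x = b then \<beta> x else 0))"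
      by (intro sum.cong refl) (auto simp: algebra_simps)
    then show ?thesis using that by (simp add: sum.distrib)
  qed
  have "(\<Sum>a\<in>arcs E. pmf \<mu> a * block_exp q (Suc m) a ?\<Phi>) = (\<Sum>b\<in>arcs E. pmf \<mu> b * block_exp q m b (\<lambda>v. ?\<Phi> (v @ [b])))"
    unfolding block_exp.simps by (rule stationary_average)
  also have "\<dots> = (\<Sum>b\<in>arcs E. pmf \<mu> b * (\<beta> b + block_exp q m b ?\<Phi>))"
  proof -
    have "block_exp q m b (\<lambda>v. ?\<Phi> (v @ [b])) = \<beta> b + block_exp q m b ?\<Phi>" if b: "b \<in> set_pmf \<mu>" for b
    proof -
      have "b \<in> arcs E" using b stationary_sets(3) by blast
      then have "(\<lambda>v. ?\<Phi> (v @ [b])) = (\<lambda>v. \<beta> b + ?\<Phi> v)" by (intro ext snoc)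
      then show ?thesis by (simp only: block_exp_add_const[OF b])
    qed
    then show ?thesis by (intro antisym sum_\<mu>_mono) simp_all
  qed
  also have "\<dots> = (\<Sum>b\<in>arcs E. \<beta> b * pmf \<mu> b) + (\<Sum>b\<in>arcs E. pmf \<mu> b * block_exp q m b ?\<Phi>)"
    by (simp add: distrib_left sum.distrib mult.commute)
  finally show ?case using Suc.IH by (simp add: algebra_simps)
qed

lemma block_cost_average: "(\<Sum>a\<in>arcs E. pmf \<mu> a * block_cost A q m a) = real m * stage_cost A \<mu> q"
proof (induction m)
  case (Suc m)
  have "(\<Sum>a\<in>arcs E. pmf \<mu> a * block_cost A q (Suc m) a) =
     stage_cost A \<mu> q + (\<Sum>a\<in>arcs E. pmf \<mu> a * (\<Sum>b\<in>arcs E. pmf (q a) b * block_cost A q m b))"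
    by (simp add: stage_cost_def distrib_left sum.distrib)
  then show ?case by (simp add: stationary_average Suc.IH algebra_simps)
qed simp

end

section \<open>Bounds for the cost to go\<close>

context
  fixes F :: "('v \<times> 'v) list \<Rightarrow> real" and B :: "'v set set" and n :: nat
  assumes F0: "\<And>w. F w \<ge> 0" and F_pos: "\<And>w. w \<noteq> [] \<Longrightarrow> set w \<subseteq> arcs B \<Longrightarrow> F w > 0" and BE: "B \<subseteq> E"
begin

text \<open>Turning back along the last arc is always possible and stays in \<open>arcs B\<close>,
  where \<open>F\<close> is positive. The logarithms below are therefore those of positive
  numbers.\<close>

lemma iter_next_prob_pos:
  "w \<noteq> [] \<Longrightarrow> set w \<subseteq> arcs B \<Longrightarrow> iter (arcs E) next_prob F j w > 0"
proof (induction j arbitrary: w)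
  case 0
  then show ?case by (simp add: F_pos)
next
  case (Suc j)
  let ?b = "prod.swap (hd w)"
  have hd: "hd w \<in> arcs B" using Suc.prems by (meson hd_in_set subsetD)
  then have b: "?b \<in> arcs B" by (rule swap_arcs)
  have bE: "?b \<in> arcs E" "hd w \<in> arcs E" using arcs_mono[OF BE] b hd by blast+
  have "next_prob w ?b > 0" unfolding next_prob_def by (rule base_prob_pos[OF bE(2,1) arc_step_swap])
  moreover have "iter (arcs E) next_prob F j (?b # w) > 0" using Suc.prems b by (intro Suc.IH) auto
  ultimately have "0 < next_prob w ?b * iter (arcs E) next_prob F j (?b # w)" by simp
  also have "\<dots> \<le> (\<Sum>b\<in>arcs E. next_prob w b * iter (arcs E) next_prob F j (b # w))"
    by (rule member_le_sum[where f = "\<lambda>b. next_prob w b * iter (arcs E) next_prob F j (b # w)"])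
       (auto simp: bE intro!: mult_nonneg_nonneg next_prob_nonneg iter_nonneg F0)
  finally show ?case by simp
qed

text \<open>Jensen's inequality for the control that moves from \<open>hd w\<close> according to \<open>g\<close>.\<close>

lemma cost_to_go_step:
  assumes w: "w \<noteq> []" "set w \<subseteq> arcs B" "length w < n"
    and g: "\<And>b. g b \<ge> 0" "(\<Sum>b\<in>arcs E. g b) = 1" "\<And>b. g b > 0 \<Longrightarrow> b \<in> arcs B \<and> arc_step (hd w) b"
  shows "cost_to_go F n w \<le> (\<Sum>b\<in>arcs E. g b * (ln (g b / next_prob w b) + cost_to_go F n (b # w)))"
proof -
  define j where "j = n - Suc (length w)"
  have j: "n - length w = Suc j" using w(3) by (simp add: j_def)
  let ?I = "\<lambda>b. iter (arcs E) next_prob F j (b # w)"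
  have hd: "hd w \<in> arcs E" using w arcs_mono[OF BE] by (meson hd_in_set subsetD)
  have pos: "next_prob w b > 0 \<and> ?I b > 0" if "g b > 0" for b
  proof
    have b: "b \<in> arcs B" "arc_step (hd w) b" using g(3) that by blast+
    then have "b \<in> arcs E" using arcs_mono[OF BE] by blast
    then show "next_prob w b > 0" unfolding next_prob_def using b(2) hd by (intro base_prob_pos)
    show "?I b > 0" using b w by (intro iter_next_prob_pos) auto
  qed
  have "- ln (\<Sum>b\<in>arcs E. next_prob w b * ?I b) \<le> (\<Sum>b\<in>arcs E. g b * ln (g b / (next_prob w b * ?I b)))"
  proof (rule log_sum_ge[OF finite_arcs g(1) g(2)])
    show "(\<Sum>b\<in>arcs E. next_prob w b * ?I b) > 0"
      using iter_next_prob_pos[OF w(1,2), of "Suc j"] by simp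
  qed (use pos in \<open>auto intro!: mult_nonneg_nonneg next_prob_nonneg iter_nonneg F0\<close>)
  also have "\<dots> = (\<Sum>b\<in>arcs E. g b * (ln (g b / next_prob w b) + cost_to_go F n (b # w)))"
  proof (rule sum.cong[OF refl])
    fix b
    show "g b * ln (g b / (next_prob w b * ?I b)) = g b * (ln (g b / next_prob w b) + cost_to_go F n (b # w))"
    proof (cases "g b > 0")
      case True
      then show ?thesis using pos[OF True] by (simp add: cost_to_go_def j_def ln_div ln_mult)
    next
      case False
      then have "g b = 0" using g(1)[of b] by linarith
      then show ?thesis by simp
    qed
  qed
  finally show ?thesis by (simp add: cost_to_go_def j)
qed

text \<open>A forced step is a point mass; its entropy is minus the logarithm of a probability that
  is at least \<open>pmin\<close>.\<close>

lemma cost_to_go_det_step: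
  assumes w: "w \<noteq> []" "set w \<subseteq> arcs B" "length w < n" and b: "b \<in> arcs B" "arc_step (hd w) b"
  shows "cost_to_go F n w \<le> - ln pmin + cost_to_go F n (b # w)"
proof -
  let ?g = "\<lambda>y. if y = b then 1 else 0 :: real"
  have bE: "b \<in> arcs E" using b arcs_mono[OF BE] by blast
  have hd: "hd w \<in> arcs E" using w arcs_mono[OF BE] by (meson hd_in_set subsetD)
  have "cost_to_go F n w \<le> (\<Sum>y\<in>arcs E. ?g y * (ln (?g y / next_prob w y) + cost_to_go F n (y # w)))"
    by (rule cost_to_go_step[OF w]) (use b bE in \<open>auto split: if_splits\<close>)
  also have "\<dots> = (\<Sum>y\<in>arcs E. if y = b then ln (1 / next_prob w b) + cost_to_go F n (b # w) else 0)"
    by (rule sum.cong) auto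
  also have "\<dots> = ln (1 / next_prob w b) + cost_to_go F n (b # w)" using bE by simp
  also have "ln (1 / next_prob w b) \<le> - ln pmin"
  proof -
    have "pmin \<le> next_prob w b" unfolding next_prob_def by (rule pmin_le[OF hd bE b(2)])
    then show ?thesis using pmin_pos by (simp add: ln_div)
  qed
  finally show ?thesis by simp
qed

lemma cost_to_go_trail:
  assumes "w \<noteq> []" "set w \<subseteq> arcs B" "set v \<subseteq> arcs B" "linked (v @ [hd w])" "length v + length w \<le> n"
  shows "cost_to_go F n w \<le> real (length v) * (- ln pmin) + cost_to_go F n (v @ w)"
  using assms(3-5)
proof (induction v)
  case (Cons b v)
  have hd: "hd (v @ w) = hd (v @ [hd w])" using assms(1) by (cases v) auto
  have l: "arc_step (hd (v @ w)) b" "linked (v @ [hd w])" using Cons.prems(2) by (simp_all add: linked_Cons hd)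
  have "cost_to_go F n (v @ w) \<le> - ln pmin + cost_to_go F n (b # v @ w)"
    by (rule cost_to_go_det_step) (use Cons.prems assms(1,2) l in auto)
  moreover have "cost_to_go F n w \<le> real (length v) * (- ln pmin) + cost_to_go F n (v @ w)"
    using Cons l by (intro Cons.IH) auto
  ultimately show ?case by (simp add: algebra_simps)
qed simp

text \<open>The edges of \<open>A\<close> are already visited and the chain stays in the support of
  \<mu>, so the visited set does not change: \<open>next_prob\<close> is the kernel of
  \<open>A\<close> at every step and the entropies add up to \<open>block_cost\<close>.\<close>

lemma cost_to_go_block:
  assumes st: "stationary A \<mu> q" and AB: "A \<subseteq> B"
    and "visited w = A" "hd w \<in> set_pmf \<mu>" "w \<noteq> []" "length w + m \<le> n"
  shows "cost_to_go F n w \<le> block_cost A q m (hd w) + block_exp q m (hd w) (\<lambda>v. cost_to_go F n (v @ w))"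
  using assms(3-)
proof (induction m arbitrary: w)
  case (Suc m)
  note S = stationary_sets[OF st]
  have sw: "set w \<subseteq> arcs B" using Suc.prems(1) AB by (auto simp: mem_arcs_iff)
  let ?a = "hd w"
  have gpos: "b \<in> arcs B \<and> arc_step ?a b" if "pmf (q ?a) b > 0" for b
  proof -
    have b: "b \<in> set_pmf (q ?a)" using that by (simp add: set_pmf_iff)
    have "b \<in> arcs B" using stationary_closed[OF st Suc.prems(2) b] S(2) arcs_mono[OF AB] by blast
    moreover have "b \<in> succs ?a" using transitions_set[OF S(4)] Suc.prems(2) S(3) b by blast
    ultimately show ?thesis by blast
  qed
  have "cost_to_go F n w \<le> (\<Sum>b\<in>arcs E. pmf (q ?a) b * (ln (pmf (q ?a) b / next_prob w b) + cost_to_go F n (b # w)))"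
    by (rule cost_to_go_step) (use Suc.prems sw gpos stationary_sum_q[OF st Suc.prems(2)] in auto)
  also have "\<dots> = entropy_at A q ?a + (\<Sum>b\<in>arcs E. pmf (q ?a) b * cost_to_go F n (b # w))"
    by (simp add: entropy_at_def next_prob_def Suc.prems(1) distrib_left sum.distrib)
  also have "(\<Sum>b\<in>arcs E. pmf (q ?a) b * cost_to_go F n (b # w)) \<le>
      (\<Sum>b\<in>arcs E. pmf (q ?a) b * (block_cost A q m b + block_exp q m b (\<lambda>v. cost_to_go F n (v @ b # w))))"
  proof (rule sum_q_mono[OF st Suc.prems(2)])
    fix b assume b: "b \<in> set_pmf \<mu>"
    then have "arc_edge b \<in> A" using S(2) by (auto simp: mem_arcs_iff)
    then have "visited (b # w) = A" using Suc.prems(1) by auto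
    then show "cost_to_go F n (b # w) \<le> block_cost A q m b + block_exp q m b (\<lambda>v. cost_to_go F n (v @ b # w))"
      using Suc.IH[of "b # w"] b Suc.prems by simp
  qed
  finally show ?case by (simp add: distrib_left sum.distrib)
qed simp

end

text \<open>Between \<open>hi\<close> and \<open>lo\<close> steps remain.  Their arcs are those of the blocks, whose expected counts
  minus the target are \<open>\<rho>\<close> and whose counts have total variance at most \<open>s\<close>, and at most \<open>t\<close>
  connecting arcs.  For the past, \<open>u\<close> counts the arcs of blocks and \<open>e\<close> bounds the others.\<close>

definition cost_bound :: "(('v \<times> 'v) list \<Rightarrow> real) \<Rightarrow> nat \<Rightarrow> real \<Rightarrow> real \<Rightarrow> 'v set set \<Rightarrow> nat \<Rightarrow> nat \<Rightarrow>
    real \<Rightarrow> ('v \<times> 'v \<Rightarrow> real) \<Rightarrow> real \<Rightarrow> real \<Rightarrow> bool" where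
  "cost_bound F n Q c A hi lo \<kappa> \<rho> s t \<longleftrightarrow> (\<forall>w u e. w \<noteq> [] \<longrightarrow> visited w = A \<longrightarrow> length w + hi \<le> n \<longrightarrow> n \<le> length w + lo \<longrightarrow>
     (\<forall>x\<in>arcs E. \<bar>real (count_list w x) - u x\<bar> \<le> e) \<longrightarrow>
     cost_to_go F n w \<le> \<kappa> + c + Q * ((\<Sum>x\<in>arcs E. (u x + \<rho> x)\<^sup>2) + s + real (card (arcs E)) * (e + t)\<^sup>2))"

lemma cost_boundD:
  assumes "cost_bound F n Q c A hi lo \<kappa> \<rho> s t" "w \<noteq> []" "visited w = A" "length w + hi \<le> n" "n \<le> length w + lo"
    "\<And>x. x \<in> arcs E \<Longrightarrow> \<bar>real (count_list w x) - u x\<bar> \<le> e"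
  shows "cost_to_go F n w \<le> \<kappa> + c + Q * ((\<Sum>x\<in>arcs E. (u x + \<rho> x)\<^sup>2) + s + real (card (arcs E)) * (e + t)\<^sup>2)"
  using assms unfolding cost_bound_def by blast

lemma cost_bound_eq:
  assumes "cost_bound F n Q c A hi lo \<kappa> \<rho> s t" "hi = hi'" "lo = lo'" "\<kappa> = \<kappa>'" "\<And>x. \<rho> x = \<rho>' x" "s = s'" "t = t'"
  shows "cost_bound F n Q c A hi' lo' \<kappa>' \<rho>' s' t'"
proof -
  have "\<rho> = \<rho>'" using assms(5) by (rule ext)
  with assms show ?thesis by simp
qed

lemma visited_arcs: "visited w = A \<Longrightarrow> set w \<subseteq> arcs A"
  by (auto simp: mem_arcs_iff)

text \<open>Going back and forth over one edge uses up any number of leftover steps.\<close>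

lemma swap_trail:
  assumes "a \<in> arcs B"
  shows "\<exists>v. length v = r \<and> set v \<subseteq> arcs B \<and> linked (v @ [a])"
proof (induction r)
  case 0
  show ?case by (intro exI[of _ "[]"]) (simp add: linked_def)
next
  case (Suc r)
  then obtain v where v: "length v = r" "set v \<subseteq> arcs B" "linked (v @ [a])" by blast
  have "hd (v @ [a]) \<in> set (v @ [a])" by (rule hd_in_set) simp
  then have "hd (v @ [a]) \<in> arcs B" using v(2) assms by auto
  then have "prod.swap (hd (v @ [a])) \<in> arcs B" by (rule swap_arcs)
  then show ?case
    using v by (intro exI[of _ "prod.swap (hd (v @ [a])) # v"]) (simp add: linked_Cons)
qed

definition control_setting :: "(('v \<times> 'v) list \<Rightarrow> real) \<Rightarrow> 'v set set \<Rightarrow> nat \<Rightarrow> bool" where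
  "control_setting F B L \<longleftrightarrow> (\<forall>w. F w \<ge> 0) \<and> (\<forall>w. w \<noteq> [] \<longrightarrow> set w \<subseteq> arcs B \<longrightarrow> F w > 0) \<and> B \<subseteq> E \<and>
     trails L"

section \<open>Backward recursion for the cost bound\<close>

context
  fixes F :: "('v \<times> 'v) list \<Rightarrow> real" and B :: "'v set set" and n L :: nat and Q c :: real
  assumes setting: "control_setting F B L" and Q: "Q \<ge> 0"
begin

lemma setting_nonneg: "F w \<ge> 0"
  and setting_pos: "w \<noteq> [] \<Longrightarrow> set w \<subseteq> arcs B \<Longrightarrow> F w > 0"
  and setting_subset: "B \<subseteq> E"
  and setting_trail: "A \<subseteq> E \<Longrightarrow> graph_connected (\<Union>A) A \<Longrightarrow> a \<in> arcs A \<Longrightarrow> b \<in> arcs A \<Longrightarrow>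
     (\<exists>v. v \<noteq> [] \<and> hd v = b \<and> set v \<subseteq> arcs A \<and> linked (v @ [a]) \<and> length v \<le> L)"
  using setting unfolding control_setting_def by blast+

lemma neg_ln_pmin_nonneg: "- ln pmin \<ge> 0"
  using pmin_pos pmin_le_1 by simp

lemma count_close:
  assumes "\<bar>real (count_list w x) - u x\<bar> \<le> e"
  shows "\<bar>real (count_list (v @ w) x) - u x\<bar> \<le> e + real (length v)"
proof -
  have "count_list v x \<le> length v" by (rule count_le_length)
  then show ?thesis using assms by (simp add: abs_le_iff)
qed

text \<open>Leftover steps are spent inside \<open>arcs B\<close> and treated as connecting arcs.
  Separating them from the block counts by \<open>(a + d)^2 \<le> 2 * a^2 + 2 * d^2\<close> turns
  the terminal factor \<open>Q / 2\<close> into \<open>Q\<close>; this loss occurs only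
  once.\<close>

lemma cost_bound_final:
  assumes fin: "\<forall>w. length w = n \<longrightarrow> w \<noteq> [] \<longrightarrow> set w \<subseteq> arcs B \<longrightarrow>
      cost_to_go F n w \<le> c + Q / 2 * (\<Sum>x\<in>arcs E. (real (count_list w x) - \<tau> x)\<^sup>2)"
  shows "cost_bound F n Q c B 0 r (real r * (- ln pmin)) (\<lambda>x. - \<tau> x) 0 (real r)"
  unfolding cost_bound_def
proof (intro allI impI)
  fix w u e
  assume w: "w \<noteq> []" "visited w = B" "length w + 0 \<le> n" "n \<le> length w + r"
    and u: "\<forall>x\<in>arcs E. \<bar>real (count_list w x) - u x\<bar> \<le> e"
  have sw: "set w \<subseteq> arcs B" using w(2) by (rule visited_arcs)
  have e0: "e \<ge> 0" using u z(1) by (meson abs_ge_zero order_trans)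
  define i where "i = n - length w"
  have i: "i \<le> r" "length w + i = n" using w by (auto simp: i_def)
  have "hd w \<in> arcs B" using sw w(1) by (meson hd_in_set subsetD)
  then obtain v where v: "length v = i" "set v \<subseteq> arcs B" "linked (v @ [hd w])" using swap_trail by blast
  have "cost_to_go F n w \<le> real (length v) * (- ln pmin) + cost_to_go F n (v @ w)"
    using cost_to_go_trail[of F B w v n] setting_nonneg setting_pos setting_subset w(1) sw v i by simp
  also have "real (length v) * (- ln pmin) \<le> real r * (- ln pmin)"
    using i v neg_ln_pmin_nonneg by (intro mult_right_mono) auto
  also have "cost_to_go F n (v @ w) \<le> c + Q / 2 * (\<Sum>x\<in>arcs E. (real (count_list (v @ w) x) - \<tau> x)\<^sup>2)"
    by (rule fin[rule_format]) (use v i w sw in auto)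
  finally have 1: "cost_to_go F n w \<le> real r * (- ln pmin) +
      (c + Q / 2 * (\<Sum>x\<in>arcs E. (real (count_list (v @ w) x) - \<tau> x)\<^sup>2))" by simp
  have "(\<Sum>x\<in>arcs E. (real (count_list (v @ w) x) - \<tau> x)\<^sup>2) \<le> (\<Sum>x\<in>arcs E. 2 * (u x - \<tau> x)\<^sup>2 + 2 * (e + real r)\<^sup>2)"
  proof (rule sum_mono)
    fix x assume x: "x \<in> arcs E"
    define d where "d = real (count_list (v @ w) x) - u x"
    have "\<bar>d\<bar> \<le> e + real (length v)" unfolding d_def using u x by (intro count_close) auto
    then have "\<bar>d\<bar> \<le> \<bar>e + real r\<bar>" using v i e0 by linarith
    then have d2: "d\<^sup>2 \<le> (e + real r)\<^sup>2" by (rule abs_le_square_iff[THEN iffD1])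
    have "(real (count_list (v @ w) x) - \<tau> x)\<^sup>2 = ((u x - \<tau> x) + d)\<^sup>2" by (simp add: d_def)
    also have "\<dots> \<le> 2 * (u x - \<tau> x)\<^sup>2 + 2 * d\<^sup>2"
      using zero_le_power2[of "(u x - \<tau> x) - d"] by (simp add: power2_eq_square algebra_simps)
    finally show "(real (count_list (v @ w) x) - \<tau> x)\<^sup>2 \<le> 2 * (u x - \<tau> x)\<^sup>2 + 2 * (e + real r)\<^sup>2"
      using d2 by linarith
  qed
  also have "\<dots> = 2 * ((\<Sum>x\<in>arcs E. (u x + (- \<tau> x))\<^sup>2) + real (card (arcs E)) * (e + real r)\<^sup>2)"
    by (simp add: sum.distrib flip: sum_distrib_left)
  finally have 2: "Q / 2 * (\<Sum>x\<in>arcs E. (real (count_list (v @ w) x) - \<tau> x)\<^sup>2) \<le>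
      Q / 2 * (2 * ((\<Sum>x\<in>arcs E. (u x + (- \<tau> x))\<^sup>2) + real (card (arcs E)) * (e + real r)\<^sup>2))"
    using Q by (intro mult_left_mono) auto
  have "Q / 2 * (2 * y) = Q * y" for y by simp
  note 2[unfolded this]
  with 1 show "cost_to_go F n w \<le> real r * (- ln pmin) + c +
      Q * ((\<Sum>x\<in>arcs E. (u x + (- \<tau> x))\<^sup>2) + 0 + real (card (arcs E)) * (e + real r)\<^sup>2)"
    by (simp only: add_0_right)
qed

text \<open>A trail to the chosen arc has at most \<open>L\<close> arcs, so a block uses between
  \<open>l\<close> and \<open>l + L\<close> steps; this is why \<open>hi\<close> and
  \<open>lo\<close> grow differently.\<close>

lemma cost_bound_block:
  assumes g: "cost_bound F n Q c A hi lo \<kappa> \<rho> s t" and st: "stationary A \<mu> q" and A: "A \<subseteq> B" "graph_connected (\<Union>A) A"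
    and t0: "t \<ge> 0"
  shows "cost_bound F n Q c A (hi + (l + L)) (lo + l) (\<kappa> + (real L * (- ln pmin) + real l * stage_cost A \<mu> q))
     (\<lambda>x. \<rho> x + real l * pmf \<mu> x) (s + real (card (arcs E)) * (real l)\<^sup>2) (t + real L)"
  unfolding cost_bound_def
proof (intro allI impI)
  fix w u e
  assume w: "w \<noteq> []" "visited w = A" "length w + (hi + (l + L)) \<le> n" "n \<le> length w + (lo + l)"
    and u: "\<forall>x\<in>arcs E. \<bar>real (count_list w x) - u x\<bar> \<le> e"
  define D where "D = real (card (arcs E))"
  note S = stationary_sets[OF st]
  have AB: "arcs A \<subseteq> arcs B" by (rule arcs_mono[OF A(1)])
  have sw: "set w \<subseteq> arcs A" using w(2) by (rule visited_arcs)
  have hdA: "hd w \<in> arcs A" using sw w(1) by (meson hd_in_set subsetD)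
  have e0: "e \<ge> 0" using u z(1) by (meson abs_ge_zero order_trans)
  define y where "y x = u x + \<rho> x" for x
  define m where "m x = real l * pmf \<mu> x" for x
  define R where "R = s + D * (e + (t + real L))\<^sup>2"
  \<comment> \<open>Expansion of \<open>(y + Y)^2\<close> around the expected block count
    \<open>m\<close>: \<beta> is the slope, and \<open>c1\<close> collects the rest with
    \<open>(Y - m)^2\<close> replaced by its bound \<open>(real l)^2\<close>. The part linear in
    \<open>Y - m\<close> averages to zero, so block deviations add up like variances.\<close>
  define \<beta> where "\<beta> x = Q * (2 * (y x + m x))" for x
  define c1 where "c1 = \<kappa> + c + Q * ((\<Sum>x\<in>arcs E. (y x + m x)\<^sup>2 - 2 * (y x + m x) * m x + (real l)\<^sup>2) + R)"
  let ?\<Phi> = "\<lambda>v. c1 + (\<Sum>x\<in>arcs E. \<beta> x * real (count_list v x))"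
  have one: "cost_to_go F n w \<le> real L * (- ln pmin) + (block_cost A q l a + block_exp q l a ?\<Phi>)"
    if a: "a \<in> set_pmf \<mu>" for a
  proof -
    have aA: "a \<in> arcs A" using a S(2) by blast
    obtain v where v: "v \<noteq> []" "hd v = a" "set v \<subseteq> arcs A" "linked (v @ [hd w])" "length v \<le> L"
      using setting_trail[OF S(1) A(2) hdA aA] by blast
    have "cost_to_go F n w \<le> real (length v) * (- ln pmin) + cost_to_go F n (v @ w)"
      using cost_to_go_trail[of F B w v n] setting_nonneg setting_pos setting_subset w v sw AB by simp
    also have "real (length v) * (- ln pmin) \<le> real L * (- ln pmin)"
      using v neg_ln_pmin_nonneg by (intro mult_right_mono) auto
    also have "cost_to_go F n (v @ w) \<le> block_cost A q l a + block_exp q l a (\<lambda>v'. cost_to_go F n (v' @ v @ w))"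
    proof -
      have "visited (v @ w) = A" using v(3) w(2) by (auto simp: mem_arcs_iff)
      then show ?thesis
        using cost_to_go_block[of F B A \<mu> q "v @ w" l n] setting_nonneg setting_pos setting_subset st A(1) a v w by simp
    qed
    also have "block_exp q l a (\<lambda>v'. cost_to_go F n (v' @ v @ w)) \<le> block_exp q l a ?\<Phi>"
    proof (rule block_exp_mono[OF st a])
      fix v' assume v': "length v' = l" "set v' \<subseteq> set_pmf \<mu>"
      have vis: "visited (v' @ v @ w) = A" using v(3) v'(2) S(2) w(2) by (auto simp: mem_arcs_iff)
      have close: "\<bar>real (count_list (v' @ v @ w) x) - (u x + real (count_list v' x))\<bar> \<le> e + real L" if x: "x \<in> arcs E" for x
      proof -
        have "\<bar>real (count_list (v @ w) x) - u x\<bar> \<le> e + real (length v)" using u x by (intro count_close) auto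
        then show ?thesis using v(5) by simp
      qed
      have "cost_to_go F n (v' @ v @ w) \<le> \<kappa> + c + Q * ((\<Sum>x\<in>arcs E. (u x + real (count_list v' x) + \<rho> x)\<^sup>2) + s +
          real (card (arcs E)) * (e + real L + t)\<^sup>2)"
        by (rule cost_boundD[OF g _ vis _ _ close]) (use v v' w in auto)
      also have "\<dots> = \<kappa> + c + Q * ((\<Sum>x\<in>arcs E. (y x + real (count_list v' x))\<^sup>2) + R)"
        by (simp add: R_def D_def y_def add_ac)
      also have "\<dots> \<le> \<kappa> + c + Q * ((\<Sum>x\<in>arcs E. (y x + m x)\<^sup>2 - 2 * (y x + m x) * m x + (real l)\<^sup>2 +
           2 * (y x + m x) * real (count_list v' x)) + R)"
      proof (intro add_left_mono mult_left_mono add_right_mono sum_mono Q)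
        fix x
        define Y where "Y = real (count_list v' x)"
        have "Y \<le> real l" "Y \<ge> 0" using count_le_length[of v' x] v'(1) by (auto simp: Y_def)
        moreover have "m x \<ge> 0" "m x \<le> real l" by (auto simp: m_def mult_left_le pmf_le_1)
        ultimately have "\<bar>Y - m x\<bar> \<le> \<bar>real l\<bar>" by linarith
        then have "(Y - m x)\<^sup>2 \<le> (real l)\<^sup>2" by (rule abs_le_square_iff[THEN iffD1])
        then show "(y x + real (count_list v' x))\<^sup>2 \<le> (y x + m x)\<^sup>2 - 2 * (y x + m x) * m x + (real l)\<^sup>2 +
           2 * (y x + m x) * real (count_list v' x)"
          unfolding Y_def[symmetric] by (simp add: power2_eq_square algebra_simps)
      qed
      also have "\<dots> = ?\<Phi> v'"
        by (simp add: c1_def \<beta>_def sum.distrib sum_distrib_left distrib_left mult_ac add_ac)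
      finally show "cost_to_go F n (v' @ v @ w) \<le> ?\<Phi> v'" .
    qed
    finally show ?thesis by simp
  qed
  have "cost_to_go F n w = (\<Sum>a\<in>arcs E. pmf \<mu> a * cost_to_go F n w)"
    by (simp add: stationary_sum_\<mu>[OF st] flip: sum_distrib_right)
  also have "\<dots> \<le> (\<Sum>a\<in>arcs E. pmf \<mu> a * (real L * (- ln pmin) + (block_cost A q l a + block_exp q l a ?\<Phi>)))"
    by (rule sum_\<mu>_mono[OF st one])
  also have "\<dots> = real L * (- ln pmin) + (\<Sum>a\<in>arcs E. pmf \<mu> a * block_cost A q l a) + (\<Sum>a\<in>arcs E. pmf \<mu> a * block_exp q l a ?\<Phi>)"
    using stationary_sum_\<mu>[OF st] by (simp add: distrib_left right_diff_distrib sum.distrib sum_subtractf flip: sum_distrib_right)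
  also have "\<dots> = real L * (- ln pmin) + real l * stage_cost A \<mu> q + (c1 + real l * (\<Sum>x\<in>arcs E. \<beta> x * pmf \<mu> x))"
    by (simp only: block_cost_average[OF st] block_exp_average[OF st])
  also have "c1 + real l * (\<Sum>x\<in>arcs E. \<beta> x * pmf \<mu> x) = \<kappa> + c + Q * ((\<Sum>x\<in>arcs E. (y x + m x)\<^sup>2) + D * (real l)\<^sup>2 + R)"
  proof -
    have 1: "real l * (\<Sum>x\<in>arcs E. \<beta> x * pmf \<mu> x) = Q * (\<Sum>x\<in>arcs E. 2 * (y x + m x) * m x)"
      by (simp add: \<beta>_def m_def sum_distrib_left mult_ac)
    have 2: "(\<Sum>x\<in>arcs E. (y x + m x)\<^sup>2 - 2 * (y x + m x) * m x + (real l)\<^sup>2) =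
       (\<Sum>x\<in>arcs E. (y x + m x)\<^sup>2) - (\<Sum>x\<in>arcs E. 2 * (y x + m x) * m x) + D * (real l)\<^sup>2"
      by (simp add: sum.distrib sum_subtractf D_def)
    have "\<kappa> + c + Q * (S1 - S2 + d + R) + Q * S2 = \<kappa> + c + Q * (S1 + d + R)" for S1 S2 d :: real
      by (simp add: algebra_simps)
    then show ?thesis unfolding c1_def 1 2 .
  qed
  finally show "cost_to_go F n w \<le> \<kappa> + (real L * (- ln pmin) + real l * stage_cost A \<mu> q) + c +
     Q * ((\<Sum>x\<in>arcs E. (u x + (\<rho> x + real l * pmf \<mu> x))\<^sup>2) + (s + real (card (arcs E)) * (real l)\<^sup>2) +
       real (card (arcs E)) * (e + (t + real L))\<^sup>2)"
    by (simp add: y_def m_def R_def D_def add_ac)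
qed

lemma cost_bound_blocks:
  assumes g: "cost_bound F n Q c A hi lo \<kappa> \<rho> s t" and st: "stationary A \<mu> q" and A: "A \<subseteq> B" "graph_connected (\<Union>A) A"
    and t0: "t \<ge> 0"
  shows "cost_bound F n Q c A (hi + m * (l + L)) (lo + m * l) (\<kappa> + real m * (real L * (- ln pmin) + real l * stage_cost A \<mu> q))
     (\<lambda>x. \<rho> x + real m * real l * pmf \<mu> x) (s + real m * (real (card (arcs E)) * (real l)\<^sup>2)) (t + real m * real L)"
proof (induction m)
  case 0
  then show ?case using g by simp
next
  case (Suc m)
  have "t + real m * real L \<ge> 0" using t0 by simp
  from cost_bound_block[OF Suc st A this, of l] show ?case
    by (rule cost_bound_eq) (simp_all add: algebra_simps)
qed

text \<open>A trail leads to an arc of \<open>A\<close> that ends in a vertex of the new edge, and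
  one more forced step crosses it, which makes at most \<open>L + 1\<close> connecting arcs.\<close>

lemma cost_bound_new_edge:
  assumes g: "cost_bound F n Q c (insert e A) hi lo \<kappa> \<rho> s t" and e: "insert e A \<subseteq> B" "e \<inter> \<Union>A \<noteq> {}"
    and A: "graph_connected (\<Union>A) A"
  shows "cost_bound F n Q c A (hi + (L + 1)) lo (\<kappa> + (real L + 1) * (- ln pmin)) \<rho> s (t + (real L + 1))"
  unfolding cost_bound_def
proof (intro allI impI)
  fix w u d
  assume w: "w \<noteq> []" "visited w = A" "length w + (hi + (L + 1)) \<le> n" "n \<le> length w + lo"
    and u: "\<forall>x\<in>arcs E. \<bar>real (count_list w x) - u x\<bar> \<le> d"
  have AE: "A \<subseteq> E" "e \<in> E" "A \<subseteq> B" "e \<in> B" using e(1) setting_subset by auto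
  have AB: "arcs A \<subseteq> arcs B" by (rule arcs_mono[OF AE(3)])
  have sw: "set w \<subseteq> arcs A" using w(2) by (rule visited_arcs)
  have hdA: "hd w \<in> arcs A" using sw w(1) by (meson hd_in_set subsetD)
  have d0: "d \<ge> 0" using u z(1) by (meson abs_ge_zero order_trans)
  obtain p e' where p: "p \<in> e" "p \<in> e'" "e' \<in> A" using e(2) by blast
  obtain p1 where p1: "e = {p, p1}" using card_edge[OF AE(2)] p(1) by (auto simp: card_2_iff)
  obtain p2 where p2: "e' = {p2, p}" using card_edge[of e'] p AE(1) by (auto simp: card_2_iff)
  define a b where "a = (p2, p)" and "b = (p, p1)"
  have a: "a \<in> arcs A" using p(3) p2 by (simp add: a_def arcs_def)
  have b: "arc_edge b = e" "b \<in> arcs B" "arc_step a b" using AE(4) p1 by (auto simp: a_def b_def arc_edge_def arcs_def arc_step_def)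
  obtain v where v: "v \<noteq> []" "hd v = a" "set v \<subseteq> arcs A" "linked (v @ [hd w])" "length v \<le> L"
    using setting_trail[OF AE(1) A hdA a] by blast
  have lk: "linked ((b # v) @ [hd w])" using v b(3) by (simp add: linked_Cons)
  have "cost_to_go F n w \<le> real (length (b # v)) * (- ln pmin) + cost_to_go F n ((b # v) @ w)"
    by (rule cost_to_go_trail[of F B w "b # v" n, OF setting_nonneg setting_pos setting_subset w(1) _ _ lk]) (use w v sw AB b in auto)
  also have "real (length (b # v)) * (- ln pmin) \<le> (real L + 1) * (- ln pmin)"
    using v neg_ln_pmin_nonneg by (intro mult_right_mono) auto
  also have "cost_to_go F n ((b # v) @ w) \<le> \<kappa> + c + Q * ((\<Sum>x\<in>arcs E. (u x + \<rho> x)\<^sup>2) + s + real (card (arcs E)) * (d + (real L + 1) + t)\<^sup>2)"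
  proof (rule cost_boundD[OF g])
    show "visited ((b # v) @ w) = insert e A" using v(3) w(2) b(1) by (auto simp: mem_arcs_iff)
    fix x assume "x \<in> arcs E"
    then have "\<bar>real (count_list ((b # v) @ w) x) - u x\<bar> \<le> d + real (length (b # v))"
      using u by (intro count_close) auto
    then show "\<bar>real (count_list ((b # v) @ w) x) - u x\<bar> \<le> d + (real L + 1)" using v(5) by simp
  qed (use v w in auto)
  finally show "cost_to_go F n w \<le> \<kappa> + (real L + 1) * (- ln pmin) + c +
     Q * ((\<Sum>x\<in>arcs E. (u x + \<rho> x)\<^sup>2) + s + real (card (arcs E)) * (d + (t + (real L + 1)))\<^sup>2)"
    by (simp add: add_ac)
qed

end

end

text \<open>The shift by \<open>n0\<close> reserves room for a fixed number of forced steps; it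
  vanishes in the limit, as does the rounding.\<close>

lemma tendsto_nat_floor_over:
  assumes "r \<ge> 0"
  shows "(\<lambda>n. real (nat \<lfloor>r * real (n - n0)\<rfloor>) / real n) \<longlonglongrightarrow> r"
proof (rule tendsto_sandwich)
  have inv: "(\<lambda>n. 1 / real n) \<longlonglongrightarrow> 0" by (rule lim_1_over_n)
  show "(\<lambda>n. r - (r * real n0 + 1) * (1 / real n)) \<longlonglongrightarrow> r"
    using tendsto_diff[OF tendsto_const tendsto_mult[OF tendsto_const inv], of r "r * real n0 + 1"] by simp
  show "(\<lambda>n. r) \<longlonglongrightarrow> r" by simp
  show "\<forall>\<^sub>F n in sequentially. r - (r * real n0 + 1) * (1 / real n) \<le> real (nat \<lfloor>r * real (n - n0)\<rfloor>) / real n"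
  proof (rule eventually_sequentiallyI[of "Suc n0"])
    fix n assume n: "Suc n0 \<le> n"
    have "r * (real n - real n0) - 1 \<le> real (nat \<lfloor>r * real (n - n0)\<rfloor>)"
      using n assms by (simp add: of_nat_diff)
    then have "(r * (real n - real n0) - 1) / real n \<le> real (nat \<lfloor>r * real (n - n0)\<rfloor>) / real n"
      by (intro divide_right_mono) auto
    moreover have "(r * (real n - real n0) - 1) / real n = r - (r * real n0 + 1) * (1 / real n)"
      using n by (simp add: field_simps)
    ultimately show "r - (r * real n0 + 1) * (1 / real n) \<le> real (nat \<lfloor>r * real (n - n0)\<rfloor>) / real n" by simp
  qed
  show "\<forall>\<^sub>F n in sequentially. real (nat \<lfloor>r * real (n - n0)\<rfloor>) / real n \<le> r"
  proof (rule eventually_sequentiallyI[of 1])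
    fix n :: nat assume n: "1 \<le> n"
    have "real (nat \<lfloor>r * real (n - n0)\<rfloor>) \<le> r * real (n - n0)" using assms by simp
    also have "\<dots> \<le> r * real n" using assms by (intro mult_left_mono) auto
    finally show "real (nat \<lfloor>r * real (n - n0)\<rfloor>) / real n \<le> r" using n by (simp add: field_simps)
  qed
qed

context reinforced_graph
begin

text \<open>Dynamic programming from stage \<open>K\<close> down to the first: the crossing into the
  next stage is put before the later bound, and the \<open>M k\<close> blocks of stage
  \<open>k\<close> before the crossing.\<close>

lemma cost_to_go_start:
  assumes setting: "control_setting F (Es K) L" and Q: "Q \<ge> 0"
    and fin: "\<forall>w. length w = n \<longrightarrow> w \<noteq> [] \<longrightarrow> set w \<subseteq> arcs (Es K) \<longrightarrow>
      cost_to_go F n w \<le> c + Q / 2 * (\<Sum>x\<in>arcs E. (real (count_list w x) - \<tau> x)\<^sup>2)"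
    and g: "growth (card E) Es" and K: "1 \<le> K" "K \<le> card E"
    and st: "\<And>k. k \<in> {1..K} \<Longrightarrow> stationary (Es k) (\<mu>s k) (q k)"
    and n: "1 + ((\<Sum>k=1..K. M k * (l + L)) + (K - 1) * (L + 1)) \<le> n" "n \<le> 1 + (r + (\<Sum>k=1..K. M k * l))"
  shows "cost_to_go F n [z] \<le> real r * (- ln pmin) +
      (\<Sum>k=1..K. real (M k) * (real L * (- ln pmin) + real l * stage_cost (Es k) (\<mu>s k) (q k))) +
      real ((K - 1) * (L + 1)) * (- ln pmin) + c +
      Q * ((\<Sum>x\<in>arcs E. ((\<Sum>k=1..K. real (M k) * real l * pmf (\<mu>s k) x) - \<tau> x)\<^sup>2) +
        (\<Sum>k=1..K. real (M k) * (real (card (arcs E)) * (real l)\<^sup>2)) +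
        real (card (arcs E)) * (1 + (real r + (\<Sum>k=1..K. real (M k) * real L) + real ((K - 1) * (L + 1))))\<^sup>2)"
proof -
  have BE: "Es K \<subseteq> E" using growth_card[OF g] K by simp
  have con: "graph_connected (\<Union>(Es k)) (Es k)" if "k \<in> {1..K}" for k
    using growth_connected[OF g, of k] that K by simp
  have sub: "Es k \<subseteq> Es K" if "k \<in> {1..K}" for k
    using growth_mono[OF g, of k K] that K by simp
  note blocks = cost_bound_blocks[OF setting Q]
  note new_edge = cost_bound_new_edge[OF setting Q]
  have pm: "- ln pmin \<ge> 0" using pmin_pos pmin_le_1 by simp
  let ?hi = "\<lambda>k. (\<Sum>j=k..K. M j * (l + L)) + (K - k) * (L + 1)"
  let ?lo = "\<lambda>k. r + (\<Sum>j=k..K. M j * l)"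
  let ?\<kappa> = "\<lambda>k. real r * (- ln pmin) +
      (\<Sum>j=k..K. real (M j) * (real L * (- ln pmin) + real l * stage_cost (Es j) (\<mu>s j) (q j))) +
      real ((K - k) * (L + 1)) * (- ln pmin)"
  let ?\<rho> = "\<lambda>k x. (\<Sum>j=k..K. real (M j) * real l * pmf (\<mu>s j) x) - \<tau> x"
  let ?s = "\<lambda>k. (\<Sum>j=k..K. real (M j) * (real (card (arcs E)) * (real l)\<^sup>2))"
  let ?t = "\<lambda>k. real r + (\<Sum>j=k..K. real (M j) * real L) + real ((K - k) * (L + 1))"
  define P where "P k \<longleftrightarrow> cost_bound F n Q c (Es k) (?hi k) (?lo k) (?\<kappa> k) (?\<rho> k) (?s k) (?t k)" for k
  have "P 1"
    using K(1)
  proof (induction rule: inc_induct)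
    case base
    have last: "cost_bound F n Q c (Es K) 0 r (real r * (- ln pmin)) (\<lambda>x. - \<tau> x) 0 (real r)"
      by (rule cost_bound_final[OF setting Q fin])
    have KK: "K \<in> {1..K}" using K by simp
    from blocks[OF last st[OF KK] subset_refl con[OF KK], where m = "M K" and l = l]
    show ?case unfolding P_def by (rule cost_bound_eq) simp_all
  next
    case (step k)
    have Sk: "{k..K} = insert k {Suc k..K}" using step by auto
    have Kk: "K - k = Suc (K - Suc k)" using step by simp
    have gs: "Es (Suc k) \<subseteq> Es K" "k \<in> {1..K}" "Es k \<subset> Es (Suc k)"
      "\<forall>e \<in> Es (Suc k) - Es k. \<exists>e' \<in> Es k. e \<inter> e' \<noteq> {}"
      using step K g sub[of "Suc k"] by (auto simp: growth_def)
    have "card (Es (Suc k) - Es k) = 1"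
    proof -
      have "card (Es k) = k" "card (Es (Suc k)) = Suc k" "Es (Suc k) \<subseteq> E"
        using growth_card[OF g, of k] growth_card[OF g, of "Suc k"] step K by auto
      moreover from this have "finite (Es (Suc k))" using finite_E finite_subset by blast
      ultimately show ?thesis using gs(3) by (subst card_Diff_subset) (auto intro: finite_subset)
    qed
    then obtain e where e: "Es (Suc k) - Es k = {e}" by (meson card_1_singletonE)
    then have ins: "Es (Suc k) = insert e (Es k)" using gs(3) by blast
    obtain e' where "e' \<in> Es k" "e \<inter> e' \<noteq> {}" using e gs(4) by blast
    then have touch: "e \<inter> \<Union>(Es k) \<noteq> {}" by blast
    have t0: "?t (Suc k) + (real L + 1) \<ge> 0" by (intro add_nonneg_nonneg sum_nonneg) auto
    have "cost_bound F n Q c (Es k) (?hi (Suc k) + (L + 1)) (?lo (Suc k)) (?\<kappa> (Suc k) + (real L + 1) * (- ln pmin))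
       (?\<rho> (Suc k)) (?s (Suc k)) (?t (Suc k) + (real L + 1))"
      by (rule new_edge[OF _ _ touch con[OF gs(2)]]) (use step.IH gs(1) ins in \<open>simp_all add: P_def\<close>)
    from blocks[OF this st[OF gs(2)] sub[OF gs(2)] con[OF gs(2)] t0, where m = "M k" and l = l] show ?case
      unfolding P_def by (rule cost_bound_eq) (simp_all add: Sk Kk algebra_simps)
  qed
  \<comment> \<open>The initial arc \<open>z\<close> belongs to no block; with \<open>u = 0\<close>
    it is an error of size 1.\<close>
  from cost_boundD[OF this[unfolded P_def], of "[z]" "\<lambda>_. 0" 1] n g show ?thesis
    by (simp add: growth_def)
qed

section \<open>The lower bound on probabilities\<close>

text \<open>Near \<mu> continuity suffices. Elsewhere some coordinate deviates by at least \<eta>,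
  and \<open>C\<close> is chosen to make the quadratic term at least \<open>2 * Hb\<close>, which
  bounds every difference of values of \<open>h\<close>.\<close>

lemma quadratic_majorant:
  fixes h :: "('v \<times> 'v) pmf \<Rightarrow> real"
  assumes h: "continuous_map (weak_topology (arcs E)) euclideanreal h" and bnd: "bounded (h ` probs (arcs E))"
    and \<mu>: "\<mu> \<in> probs (arcs E)" and \<epsilon>: "\<epsilon> > 0"
  shows "\<exists>C\<ge>0. \<forall>\<nu>\<in>probs (arcs E). h \<nu> \<le> h \<mu> + \<epsilon> + C * (\<Sum>x\<in>arcs E. (pmf \<nu> x - pmf \<mu> x)\<^sup>2)"
proof -
  obtain Hb where Hb: "Hb > 0" "\<And>\<nu>. \<nu> \<in> probs (arcs E) \<Longrightarrow> \<bar>h \<nu>\<bar> \<le> Hb"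
    using bnd unfolding bounded_pos by auto
  obtain \<eta> where \<eta>: "\<eta> > 0" "\<And>\<nu>. \<nu> \<in> probs (arcs E) \<Longrightarrow> (\<forall>a\<in>arcs E. \<bar>pmf \<nu> a - pmf \<mu> a\<bar> < \<eta>) \<Longrightarrow> \<bar>h \<nu> - h \<mu>\<bar> < \<epsilon>"
    using weak_continuous_at[OF finite_arcs h \<mu> \<epsilon>] by blast
  define C where "C = 2 * Hb / \<eta>\<^sup>2"
  have C0: "C \<ge> 0" using Hb by (simp add: C_def)
  have "h \<nu> \<le> h \<mu> + \<epsilon> + C * (\<Sum>x\<in>arcs E. (pmf \<nu> x - pmf \<mu> x)\<^sup>2)" if \<nu>: "\<nu> \<in> probs (arcs E)" for \<nu>
  proof (cases "\<forall>a\<in>arcs E. \<bar>pmf \<nu> a - pmf \<mu> a\<bar> < \<eta>")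
    case True
    have "C * (\<Sum>x\<in>arcs E. (pmf \<nu> x - pmf \<mu> x)\<^sup>2) \<ge> 0" using C0 by (intro mult_nonneg_nonneg sum_nonneg) auto
    then show ?thesis using \<eta>(2)[OF \<nu> True] by linarith
  next
    case False
    then obtain a where a: "a \<in> arcs E" "\<eta> \<le> \<bar>pmf \<nu> a - pmf \<mu> a\<bar>" by force
    have "\<eta>\<^sup>2 \<le> (pmf \<nu> a - pmf \<mu> a)\<^sup>2" using a(2) \<eta>(1) by (intro abs_le_square_iff[THEN iffD1]) simp
    also have "\<dots> \<le> (\<Sum>x\<in>arcs E. (pmf \<nu> x - pmf \<mu> x)\<^sup>2)"
      using a(1) by (intro member_le_sum[where f = "\<lambda>x. (pmf \<nu> x - pmf \<mu> x)\<^sup>2"]) auto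
    finally have "C * \<eta>\<^sup>2 \<le> C * (\<Sum>x\<in>arcs E. (pmf \<nu> x - pmf \<mu> x)\<^sup>2)" using C0 by (rule mult_left_mono)
    moreover have "C * \<eta>\<^sup>2 = 2 * Hb" using \<eta>(1) by (simp add: C_def)
    moreover have "h \<nu> \<le> Hb" "- Hb \<le> h \<mu>" using Hb(2)[OF \<nu>] Hb(2)[OF \<mu>] by (auto simp: abs_le_iff)
    ultimately show ?thesis using \<epsilon> by linarith
  qed
  then show ?thesis using C0 by blast
qed

text \<open>\<open>K\<close> is the last stage of positive weight. Its edge set is in
  \<open>S0\<close>, so a control that never leaves these edges meets the constraint
  \<open>Cl\<close> with certainty.\<close>

lemma admissible_last_stage:
  assumes "(\<mu>s, r, Es, q) \<in> admissible E x0 z \<mu> S0"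
  obtains K where "growth (card E) Es" "1 \<le> K" "K \<le> card E" "Es K \<in> S0"
    "\<And>k. k \<in> {1..K} \<Longrightarrow> stationary (Es k) (\<mu>s k) (q k)" "\<And>k. k \<in> {1..K} \<Longrightarrow> r k \<ge> 0"
    "\<And>f. (\<Sum>k=1..card E. r k * f k) = (\<Sum>k=1..K. r k * f k)"
proof -
  have adm: "growth (card E) Es" "\<And>k. k \<in> {1..card E} \<Longrightarrow> r k \<ge> 0" "(\<Sum>k=1..card E. r k) = 1"
    "\<And>k. k \<in> {1..card E} \<Longrightarrow> Es k \<notin> S0 \<Longrightarrow> r k = 0"
    "\<And>k. k \<in> {1..card E} \<Longrightarrow> q k \<in> transitions E \<and> set_pmf (\<mu>s k) \<subseteq> arcs (Es k) \<and> bind_pmf (\<mu>s k) (q k) = \<mu>s k"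
    using assms unfolding admissible_def mem_Collect_eq prod.case edge_sequences_from_iff by blast+
  define I where "I = {k \<in> {1..card E}. r k \<noteq> 0}"
  define K where "K = Max I"
  have "I \<noteq> {}"
  proof
    assume "I = {}"
    then have "(\<Sum>k=1..card E. r k) = 0" unfolding I_def by (intro sum.neutral) blast
    then show False using adm(3) by simp
  qed
  then have KI: "K \<in> I" unfolding K_def by (intro Max_in) (auto simp: I_def)
  then have K: "1 \<le> K" "K \<le> card E" "r K \<noteq> 0" by (auto simp: I_def)
  have zero: "r k = 0" if "k \<in> {1..card E} - {1..K}" for k
  proof (rule ccontr)
    assume "r k \<noteq> 0"
    then have "k \<in> I" using that by (simp add: I_def)
    then have "k \<le> K" unfolding K_def by (intro Max_ge) (auto simp: I_def)
    then show False using that by auto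
  qed
  show thesis
  proof (rule that[OF adm(1) K(1,2)])
    show "Es K \<in> S0" using adm(4)[of K] K by auto
    show "stationary (Es k) (\<mu>s k) (q k)" if "k \<in> {1..K}" for k
      using adm(5)[of k] growth_card[OF adm(1), of k] that K(2) by (simp add: stationary_def)
    show "r k \<ge> 0" if "k \<in> {1..K}" for k using adm(2)[of k] that K(2) by simp
    show "(\<Sum>k=1..card E. r k * f k) = (\<Sum>k=1..K. r k * f k)" for f
      using K(2) zero by (intro sum.mono_neutral_right) auto
  qed
qed

lemma lower_bound:
  fixes h :: "('v \<times> 'v) pmf \<Rightarrow> real"
  assumes h: "continuous_map (weak_topology (arcs E)) euclideanreal h" and bnd: "bounded (h ` probs (arcs E))"
    and \<mu>: "\<mu> \<in> probs (arcs E)" and p: "p \<in> admissible E x0 z \<mu> S0" and \<epsilon>: "\<epsilon> > 0"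
  shows "\<exists>j0. \<forall>j\<ge>j0.
    iter (arcs E) next_prob (\<lambda>w. indicator (Cl E S0) (emp w)) j [z] > 0 \<and>
    - (1 / real (Suc j)) * ln (iter (arcs E) next_prob (tilt E S0 h (real (Suc j))) j [z])
      \<le> plan_cost p + h \<mu> + \<epsilon>"
proof -
  obtain \<mu>s r Es q where p_eq: "p = (\<mu>s, r, Es, q)" by (cases p)
  obtain K where g: "growth (card E) Es" and K: "1 \<le> K" "K \<le> card E" "Es K \<in> S0"
    and st: "\<And>k. k \<in> {1..K} \<Longrightarrow> stationary (Es k) (\<mu>s k) (q k)" and r0: "\<And>k. k \<in> {1..K} \<Longrightarrow> r k \<ge> 0"
    and upto: "\<And>f. (\<Sum>k=1..card E. r k * f k) = (\<Sum>k=1..K. r k * f k)"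
    using admissible_last_stage[OF p[unfolded p_eq]] by blast
  have adm: "(\<Sum>k=1..card E. r k) = 1" "\<And>x. (\<Sum>k=1..card E. r k * pmf (\<mu>s k) x) = pmf \<mu> x"
    using p unfolding p_eq admissible_def mem_Collect_eq prod.case by blast+
  define I where "I k = stage_cost (Es k) (\<mu>s k) (q k)" for k
  have r1: "(\<Sum>k=1..K. r k) = 1" using upto[of "\<lambda>_. 1"] adm(1) by simp
  have mix: "(\<Sum>k=1..K. r k * pmf (\<mu>s k) x) = pmf \<mu> x" for x using upto[of "\<lambda>k. pmf (\<mu>s k) x"] adm(2) by simp
  have cost: "(\<Sum>k=1..K. r k * I k) = plan_cost p" using upto[of I] by (simp add: p_eq plan_cost_def I_def)
  obtain L where L: "trails L"
    using bounded_trail by blast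
  have BE: "Es K \<subseteq> E" using growth_card[OF g] K by simp
  have setting: "control_setting F (Es K) L"
    if "\<And>w. F w \<ge> 0" "\<And>w. emp w \<in> Cl E S0 \<Longrightarrow> F w > 0" for F
  proof -
    have "emp w \<in> Cl E S0" if "w \<noteq> []" "set w \<subseteq> arcs (Es K)" for w
    proof -
      have s: "set_pmf (emp w) \<subseteq> arcs (Es K)" unfolding set_emp[OF that(1)] by (rule that(2))
      then have "set_pmf (map_pmf arc_edge (emp w)) \<subseteq> Es K" by (auto simp: mem_arcs_iff)
      then show ?thesis using s arcs_mono[OF BE] K(3) unfolding Cl_def probs_def by blast
    qed
    then show ?thesis unfolding control_setting_def using that BE L by blast
  qed
  obtain C where C: "C \<ge> 0"
    "\<And>\<nu>. \<nu> \<in> probs (arcs E) \<Longrightarrow> h \<nu> \<le> h \<mu> + \<epsilon> / 4 + C * (\<Sum>x\<in>arcs E. (pmf \<nu> x - pmf \<mu> x)\<^sup>2)"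
    using quadratic_majorant[OF h bnd \<mu>, of "\<epsilon> / 4"] \<epsilon> by auto
  define D where "D = real (card (arcs E))"
  define \<pi> where "\<pi> = - ln pmin"
  define C2 where "C2 = real ((K - 1) * (L + 1))"
  \<comment> \<open>The initial arc together with \<open>K - 1\<close> crossings of at most
    \<open>L + 1\<close> forced steps each.\<close>
  define n0 where "n0 = 1 + (K - 1) * (L + 1)"
  \<comment> \<open>The bound of \<open>cost_to_go_start\<close> divided by \<open>n\<close>, with
    \<open>m k\<close> for \<open>M k / n\<close> and \<open>u\<close> for \<open>1 / n\<close>. It
    is continuous in \<open>m\<close> and \<open>u\<close>, so \<open>n\<close> can tend to infinity
    while \<open>l\<close> is fixed.\<close>
  define U where "U m u l = (1 - u - (\<Sum>k=1..K. m k * l)) * \<pi> + (\<Sum>k=1..K. m k * (real L * \<pi> + l * I k)) + C2 * u * \<pi> + (h \<mu> + \<epsilon> / 4) +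
     2 * C * ((\<Sum>x\<in>arcs E. ((\<Sum>k=1..K. m k * l * pmf (\<mu>s k) x) - pmf \<mu> x)\<^sup>2) + (\<Sum>k=1..K. m k * (D * l\<^sup>2)) * u +
       D * (u + ((1 - u - (\<Sum>k=1..K. m k * l)) + (\<Sum>k=1..K. m k * real L) + C2 * u))\<^sup>2)" for m :: "nat \<Rightarrow> real" and u l :: real
  \<comment> \<open>Even if every trail takes its full length \<open>L\<close>, blocks in the
    proportion \<open>r k / (l + L)\<close> fit into the available time.\<close>
  define \<rho> where "\<rho> l k = r k / real (l + L)" for l k
  \<comment> \<open>The block length is chosen at \<open>u = 0\<close>: the share \<open>a l\<close>
    of time spent in blocks tends to 1 and the share \<open>b l\<close> reserved for trails to
    0.\<close>
  have "\<exists>l\<ge>1. U (\<rho> l) 0 (real l) < plan_cost p + h \<mu> + \<epsilon> / 2"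
  proof -
    define a where "a l = real l / real (l + L)" for l
    define b where "b l = real L / real (l + L)" for l
    have b0: "b \<longlonglongrightarrow> 0"
      unfolding b_def by real_asymp
    have a1: "a \<longlonglongrightarrow> 1"
      unfolding a_def by real_asymp
    have eq: "U (\<rho> l) 0 (real l) = (1 - a l) * \<pi> + (b l * \<pi> + a l * plan_cost p) + (h \<mu> + \<epsilon> / 4) +
       2 * C * ((\<Sum>x\<in>arcs E. (a l * pmf \<mu> x - pmf \<mu> x)\<^sup>2) + D * ((1 - a l) + b l)\<^sup>2)" for l
    proof -
      have 1: "(\<Sum>k=1..K. \<rho> l k * y) = y / real (l + L)" for y
        using r1 by (simp add: \<rho>_def flip: sum_distrib_right sum_divide_distrib)
      have 2: "(\<Sum>k=1..K. \<rho> l k * (real L * \<pi> + real l * I k)) = b l * \<pi> + a l * plan_cost p"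
      proof -
        have "(\<Sum>k=1..K. \<rho> l k * (real L * \<pi> + real l * I k)) =
          (\<Sum>k=1..K. \<rho> l k * (real L * \<pi>)) + (real l / real (l + L)) * (\<Sum>k=1..K. r k * I k)"
          unfolding sum_distrib_left by (simp add: distrib_left sum.distrib \<rho>_def mult_ac)
        then show ?thesis unfolding 1 cost by (simp add: a_def b_def)
      qed
      have 3: "(\<Sum>k=1..K. \<rho> l k * real l * pmf (\<mu>s k) x) = a l * pmf \<mu> x" for x
        unfolding mix[symmetric] sum_distrib_left by (intro sum.cong refl) (simp add: \<rho>_def a_def)
      show ?thesis unfolding U_def 1 2 3 by (simp add: a_def b_def)
    qed
    have "(\<lambda>l. U (\<rho> l) 0 (real l)) \<longlonglongrightarrow> (1 - 1) * \<pi> + (0 * \<pi> + 1 * plan_cost p) + (h \<mu> + \<epsilon> / 4) +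
       2 * C * ((\<Sum>x\<in>arcs E. (1 * pmf \<mu> x - pmf \<mu> x)\<^sup>2) + D * ((1 - 1) + 0)\<^sup>2)"
      unfolding eq by (intro tendsto_intros a1 b0)
    then have "(\<lambda>l. U (\<rho> l) 0 (real l)) \<longlonglongrightarrow> plan_cost p + h \<mu> + \<epsilon> / 4" by (simp add: add_ac)
    moreover have "plan_cost p + h \<mu> + \<epsilon> / 4 < plan_cost p + h \<mu> + \<epsilon> / 2" using \<epsilon> by simp
    ultimately have "\<forall>\<^sub>F l in sequentially. U (\<rho> l) 0 (real l) < plan_cost p + h \<mu> + \<epsilon> / 2" by (rule order_tendstoD)
    with eventually_ge_at_top[of 1] have "\<forall>\<^sub>F l in sequentially. 1 \<le> l \<and> U (\<rho> l) 0 (real l) < plan_cost p + h \<mu> + \<epsilon> / 2"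
      by (rule eventually_conj)
    then show ?thesis by (auto simp: eventually_sequentially)
  qed
  then obtain l where l: "l \<ge> 1" "U (\<rho> l) 0 (real l) < plan_cost p + h \<mu> + \<epsilon> / 2" by blast
  define M where "M n k = nat \<lfloor>\<rho> l k * real (n - n0)\<rfloor>" for n k
  have lL: "real (l + L) > 0" using l(1) by simp
  have \<rho>0: "\<rho> l k \<ge> 0" if "k \<in> {1..K}" for k using r0[OF that] lL by (simp add: \<rho>_def)
  have lim: "(\<lambda>n. real (M n k) / real n) \<longlonglongrightarrow> \<rho> l k" if "k \<in> {1..K}" for k
    unfolding M_def by (rule tendsto_nat_floor_over[OF \<rho>0[OF that]])
  have "(\<lambda>n. U (\<lambda>k. real (M n k) / real n) (1 / real n) (real l)) \<longlonglongrightarrow> U (\<rho> l) 0 (real l)"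
    unfolding U_def by (intro tendsto_intros lim lim_1_over_n)
  then have "\<forall>\<^sub>F n in sequentially. U (\<lambda>k. real (M n k) / real n) (1 / real n) (real l) < plan_cost p + h \<mu> + \<epsilon> / 2"
    using l(2) by (rule order_tendstoD)
  then obtain n1 where n1: "\<And>n. n \<ge> n1 \<Longrightarrow> U (\<lambda>k. real (M n k) / real n) (1 / real n) (real l) < plan_cost p + h \<mu> + \<epsilon> / 2"
    by (auto simp: eventually_sequentially)
  show ?thesis
  proof (intro exI[of _ "n0 + n1"] allI impI conjI)
    fix j assume j: "n0 + n1 \<le> j"
    have "control_setting (\<lambda>w. indicator (Cl E S0) (emp w)) (Es K) L" by (rule setting) auto
    then show "iter (arcs E) next_prob (\<lambda>w. indicator (Cl E S0) (emp w)) j [z] > 0"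
    proof -
      assume cs: "control_setting (\<lambda>w. indicator (Cl E S0) (emp w)) (Es K) L"
      have "z \<in> arcs (Es K)" using growth_mono[OF g, of 1 K] g K by (auto simp: growth_def mem_arcs_iff)
      then show ?thesis
        using setting_nonneg[OF cs order_refl] setting_pos[OF cs order_refl] BE
        by (intro iter_next_prob_pos[where B = "Es K"]) auto
    qed
    define n where "n = Suc j"
    define m where "m k = real (M n k) / real n" for k
    let ?F = "tilt E S0 h (real n)"
    have n: "n \<ge> n0" "n \<ge> n1" "n > 0" using j by (auto simp: n_def)
    have cs: "control_setting ?F (Es K) L" by (rule setting) auto
    have sumM: "(\<Sum>k=1..K. M n k * (l + L)) \<le> n - n0"
    proof -
      have "real (\<Sum>k=1..K. M n k * (l + L)) = (\<Sum>k=1..K. real (M n k) * real (l + L))" by simp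
      also have "\<dots> \<le> (\<Sum>k=1..K. (\<rho> l k * real (n - n0)) * real (l + L))"
        unfolding M_def by (intro sum_mono mult_right_mono) (use \<rho>0 in auto)
      also have "\<dots> = (\<Sum>k=1..K. r k) * real (n - n0)"
        unfolding sum_distrib_right using lL by (intro sum.cong refl) (simp add: \<rho>_def)
      also have "\<dots> = real (n - n0)" unfolding r1 by simp
      finally show ?thesis by (simp only: of_nat_le_iff)
    qed
    have sumMl: "(\<Sum>k=1..K. M n k * l) \<le> n - 1"
    proof -
      have "(\<Sum>k=1..K. M n k * l) \<le> (\<Sum>k=1..K. M n k * (l + L))" by (intro sum_mono mult_left_mono) auto
      then show ?thesis using sumM by (simp add: n0_def)
    qed
    \<comment> \<open>Trails may be shorter than \<open>L\<close>, so the leftover is bounded by the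
      number of all steps outside the blocks.\<close>
    define s where "s = n - 1 - (\<Sum>k=1..K. M n k * l)"
    \<comment> \<open>The terminal cost \<open>n * C\<close> times squared deviations of frequencies
      is \<open>C / n\<close> times those of counts, and \<open>C / n\<close> is the
      \<open>Q / 2\<close> of the terminal condition.\<close>
    define Q where "Q = 2 * (C / real n)"
    have "cost_to_go ?F n [z] \<le> real s * (- ln pmin) +
      (\<Sum>k=1..K. real (M n k) * (real L * (- ln pmin) + real l * stage_cost (Es k) (\<mu>s k) (q k))) +
      real ((K - 1) * (L + 1)) * (- ln pmin) + real n * (h \<mu> + \<epsilon> / 4) +
      Q * ((\<Sum>x\<in>arcs E. ((\<Sum>k=1..K. real (M n k) * real l * pmf (\<mu>s k) x) - real n * pmf \<mu> x)\<^sup>2) +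
        (\<Sum>k=1..K. real (M n k) * (real (card (arcs E)) * (real l)\<^sup>2)) +
        real (card (arcs E)) * (1 + (real s + (\<Sum>k=1..K. real (M n k) * real L) + real ((K - 1) * (L + 1))))\<^sup>2)"
    proof (rule cost_to_go_start[OF cs _ _ g K(1,2) st])
      show "Q \<ge> 0" using C(1) by (simp add: Q_def)
      show "1 + ((\<Sum>k=1..K. M n k * (l + L)) + (K - 1) * (L + 1)) \<le> n"
        using sumM n(1) by (simp add: n0_def)
      show "n \<le> 1 + (s + (\<Sum>k=1..K. M n k * l))" using sumMl n(3) by (simp add: s_def)
      show "\<forall>w. length w = n \<longrightarrow> w \<noteq> [] \<longrightarrow> set w \<subseteq> arcs (Es K) \<longrightarrow>
         cost_to_go ?F n w \<le> real n * (h \<mu> + \<epsilon> / 4) + Q / 2 * (\<Sum>x\<in>arcs E. (real (count_list w x) - real n * pmf \<mu> x)\<^sup>2)"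
      proof (intro allI impI)
        fix w assume w: "length w = n" "w \<noteq> []" "set w \<subseteq> arcs (Es K)"
        have Fw: "?F w > 0" using setting_pos[OF cs order_refl w(2,3)] .
        then have "emp w \<in> Cl E S0" by (auto split: split_indicator_asm)
        then have Fe: "?F w = exp (- real n * h (emp w))" and pr: "emp w \<in> probs (arcs E)" by (auto simp: Cl_def)
        have "cost_to_go ?F n w = real n * h (emp w)" by (simp only: cost_to_go_def w(1) diff_self_eq_0 iter.simps Fe) simp
        also have "\<dots> \<le> real n * (h \<mu> + \<epsilon> / 4 + C * (\<Sum>x\<in>arcs E. (pmf (emp w) x - pmf \<mu> x)\<^sup>2))"
          by (intro mult_left_mono C(2) pr) simp
        also have "\<dots> = real n * (h \<mu> + \<epsilon> / 4) + C / real n * ((real n)\<^sup>2 * (\<Sum>x\<in>arcs E. (pmf (emp w) x - pmf \<mu> x)\<^sup>2))"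
          using n(3) by (simp add: field_simps power2_eq_square)
        also have "(real n)\<^sup>2 * (\<Sum>x\<in>arcs E. (pmf (emp w) x - pmf \<mu> x)\<^sup>2) =
            (\<Sum>x\<in>arcs E. (real (count_list w x) - real n * pmf \<mu> x)\<^sup>2)"
          unfolding sum_distrib_left power_mult_distrib[symmetric]
          using n(3) w by (intro sum.cong refl) (simp add: pmf_emp right_diff_distrib)
        finally show "cost_to_go ?F n w \<le> real n * (h \<mu> + \<epsilon> / 4) + Q / 2 * (\<Sum>x\<in>arcs E. (real (count_list w x) - real n * pmf \<mu> x)\<^sup>2)"
          by (simp add: Q_def)
      qed
    qed
    also have "\<dots> = real n * U m (1 / real n) (real l)"
    proof -
      have Mm: "real (M n k) = real n * m k" for k using n(3) by (simp add: m_def)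
      have S: "(\<Sum>k=1..K. real (M n k) * f k) = real n * (\<Sum>k=1..K. m k * f k)" for f
        by (simp add: Mm sum_distrib_left mult_ac)
      have s_eq: "real s = real n * (1 - 1 / real n - (\<Sum>k=1..K. m k * real l))"
      proof -
        have "real s = real n - 1 - (\<Sum>k=1..K. real (M n k) * real l)"
          using sumMl n(3) by (simp add: s_def of_nat_diff)
        then show ?thesis unfolding S[of "\<lambda>_. real l"] using n(3) by (simp add: right_diff_distrib)
      qed
      have sq: "(\<Sum>x\<in>arcs E. ((\<Sum>k=1..K. real (M n k) * real l * pmf (\<mu>s k) x) - real n * pmf \<mu> x)\<^sup>2) =
        (real n)\<^sup>2 * (\<Sum>x\<in>arcs E. ((\<Sum>k=1..K. m k * real l * pmf (\<mu>s k) x) - pmf \<mu> x)\<^sup>2)"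
        unfolding sum_distrib_left power_mult_distrib[symmetric]
        using S[of "\<lambda>k. real l * pmf (\<mu>s k) x" for x] by (simp add: mult.assoc right_diff_distrib)
      have lin: "1 + (real n * y1 + real n * y2 + C2) = real n * (1 / real n + (y1 + y2 + C2 * (1 / real n)))" for y1 y2
        using n(3) by (simp add: distrib_left)
      have fin: "real n * y1 * \<pi> + real n * y2 + C2 * \<pi> + real n * y3 + Q * ((real n)\<^sup>2 * y4 + real n * y5 + D * (real n * y6)\<^sup>2) =
        real n * (y1 * \<pi> + y2 + C2 * (1 / real n) * \<pi> + y3 + 2 * C * (y4 + y5 * (1 / real n) + D * y6\<^sup>2))" for y1 y2 y3 y4 y5 y6
        using n(3) by (simp add: Q_def field_simps power2_eq_square)
      show ?thesis
        unfolding U_def sq S s_eq \<pi>_def[symmetric] C2_def[symmetric] D_def[symmetric] I_def[symmetric] lin fin ..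
    qed
    finally have "cost_to_go ?F n [z] / real n \<le> U m (1 / real n) (real l)" using n(3) by (simp add: field_simps)
    also have "\<dots> < plan_cost p + h \<mu> + \<epsilon> / 2" unfolding m_def by (rule n1[OF n(2)])
    finally have "cost_to_go ?F n [z] / real n \<le> plan_cost p + h \<mu> + \<epsilon>" using \<epsilon> by linarith
    then show "- (1 / real (Suc j)) * ln (iter (arcs E) next_prob (tilt E S0 h (real (Suc j))) j [z])
      \<le> plan_cost p + h \<mu> + \<epsilon>"
      unfolding cost_to_go_def n_def by simp
  qed
qed

end

section \<open>The limit\<close>

lemma iter_cmult: "iter S wt (\<lambda>w. c * F w) j w = c * iter S wt F j w"
  by (induction j arbitrary: w) (simp_all add: sum_distrib_left mult_ac)

context reinforced_walk
begin

lemma W_eventually_less: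
  fixes h :: "('v \<times> 'v) pmf \<Rightarrow> real"
  assumes h: "continuous_map (weak_topology (arcs E)) euclideanreal h" and bnd: "bounded (h ` probs (arcs E))"
    and a: "(INF \<mu> \<in> Cl E S0. rate E x0 \<delta> z S0 \<mu> + ereal (h \<mu>)) < a"
  shows "\<forall>\<^sub>F j in sequentially. W E M X h S0 (Suc j) z < a"
proof -
  obtain \<mu> where \<mu>: "\<mu> \<in> Cl E S0" "rate E x0 \<delta> z S0 \<mu> + ereal (h \<mu>) < a"
    using a unfolding INF_less_iff by blast
  have "\<exists>p\<in>admissible E x0 z \<mu> S0. ereal (plan_cost p + h \<mu>) < a"
  proof (rule ccontr)
    assume "\<not> ?thesis"
    then have "a - ereal (h \<mu>) \<le> ereal (plan_cost p)" if "p \<in> admissible E x0 z \<mu> S0" for p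
      using that by (subst ereal_minus_le) (auto simp: not_less)
    then have "a - ereal (h \<mu>) \<le> rate E x0 \<delta> z S0 \<mu>"
      unfolding rate_eq by (rule INF_greatest)
    then have "a \<le> rate E x0 \<delta> z S0 \<mu> + ereal (h \<mu>)" by (subst (asm) ereal_minus_le) auto
    then show False using \<mu>(2) by simp
  qed
  then obtain p where p: "p \<in> admissible E x0 z \<mu> S0" "ereal (plan_cost p + h \<mu>) < a" by blast
  \<comment> \<open>A real threshold is needed because \<open>a\<close> may be infinite.\<close>
  obtain b where b: "ereal (plan_cost p + h \<mu>) < ereal b" "ereal b < a"
    using ereal_dense2[OF p(2)] by blast
  define \<epsilon> where "\<epsilon> = b - (plan_cost p + h \<mu>)"
  have \<epsilon>: "\<epsilon> > 0" using b(1) by (simp add: \<epsilon>_def)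
  have "\<mu> \<in> probs (arcs E)" using \<mu>(1) by (simp add: Cl_def)
  from lower_bound[OF h bnd this p(1) \<epsilon>] obtain j0 where j0: "\<forall>j\<ge>j0.
    iter (arcs E) next_prob (\<lambda>w. indicator (Cl E S0) (emp w)) j [z] > 0 \<and>
    - (1 / real (Suc j)) * ln (iter (arcs E) next_prob (tilt E S0 h (real (Suc j))) j [z])
      \<le> plan_cost p + h \<mu> + \<epsilon>" by blast
  show ?thesis
  proof (rule eventually_sequentiallyI[of j0])
    fix j assume "j0 \<le> j"
    with j0 have "W E M X h S0 (Suc j) z \<le> ereal b"
      unfolding W_Suc by (simp add: \<epsilon>_def del: of_nat_Suc)
    then show "W E M X h S0 (Suc j) z < a" using b(2) by (rule le_less_trans)
  qed
qed

lemma W_eventually_greater: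
  fixes h :: "('v \<times> 'v) pmf \<Rightarrow> real"
  assumes dec: "decreasing_family E x0 S0"
    and h: "continuous_map (weak_topology (arcs E)) euclideanreal h" and bnd: "bounded (h ` probs (arcs E))"
    and a: "a < (INF \<mu> \<in> Cl E S0. rate E x0 \<delta> z S0 \<mu> + ereal (h \<mu>))"
  shows "\<forall>\<^sub>F j in sequentially. a < W E M X h S0 (Suc j) z"
proof -
  \<comment> \<open>Both \<open>a\<close> and the infimum may be infinite, so two real numbers are
    placed between them.\<close>
  obtain a' where a': "a < ereal a'" "ereal a' < (INF \<mu> \<in> Cl E S0. rate E x0 \<delta> z S0 \<mu> + ereal (h \<mu>))"
    using ereal_dense2[OF a] by blast
  obtain c where c: "ereal a' < ereal c" "ereal c < (INF \<mu> \<in> Cl E S0. rate E x0 \<delta> z S0 \<mu> + ereal (h \<mu>))"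
    using ereal_dense2[OF a'(2)] by blast
  \<comment> \<open>One \<epsilon> pays for the continuity of \<open>h\<close>, the other for the
    polynomial factor; together they give \<open>c - 2 * \<epsilon> = a'\<close>.\<close>
  define \<epsilon> where "\<epsilon> = (c - a') / 2"
  have \<epsilon>: "\<epsilon> > 0" using c(1) by (simp add: \<epsilon>_def)
  have cp: "c \<le> plan_cost p + h \<mu>" if \<mu>: "\<mu> \<in> Cl E S0" and p: "p \<in> admissible E x0 z \<mu> S0" for \<mu> p
  proof -
    have "ereal c \<le> rate E x0 \<delta> z S0 \<mu> + ereal (h \<mu>)"
      using c(2) INF_lower[OF \<mu>, of "\<lambda>\<mu>. rate E x0 \<delta> z S0 \<mu> + ereal (h \<mu>)"] by (meson less_imp_le order_trans)
    also have "\<dots> \<le> ereal (plan_cost p) + ereal (h \<mu>)"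
      unfolding rate_eq by (intro add_right_mono INF_lower p)
    finally show ?thesis by simp
  qed
  obtain K L d n0 where K: "K > 0" "L > 0" and ub: "\<And>j. j \<ge> n0 \<Longrightarrow>
    iter (arcs E) next_prob (tilt E S0 h (real (Suc j))) j [z]
      \<le> K * (real j + L) ^ d * exp (- real (Suc j) * (c - \<epsilon>))"
    using upper_bound[OF dec h cp \<epsilon>] by blast
  obtain Hb where Hb: "\<And>\<nu>. \<nu> \<in> probs (arcs E) \<Longrightarrow> \<bar>h \<nu>\<bar> \<le> Hb"
    using bnd unfolding bounded_iff by auto
  have "(\<lambda>j. (ln K + real d * ln (real j + L)) / real (Suc j)) \<longlonglongrightarrow> 0" by real_asymp
  then have "\<forall>\<^sub>F j in sequentially. (ln K + real d * ln (real j + L)) / real (Suc j) < \<epsilon>"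
    using \<epsilon> by (rule order_tendstoD)
  moreover have "\<forall>\<^sub>F j in sequentially. j \<ge> n0" by (rule eventually_ge_at_top)
  ultimately show ?thesis
  proof eventually_elim
    case (elim j)
    let ?n = "real (Suc j)"
    let ?I = "iter (arcs E) next_prob (\<lambda>w. indicator (Cl E S0) (emp w)) j [z]"
    let ?J = "iter (arcs E) next_prob (tilt E S0 h ?n) j [z]"
    show ?case
    proof (cases "?I > 0")
      case False
      then show ?thesis using a'(1) by (simp add: W_Suc less_ereal.simps) (cases a; simp)
    next
      case True
      \<comment> \<open>Boundedness of \<open>h\<close> bounds the tilted expectation from below by
        a positive multiple of the probability of the constraint, so its logarithm is that of a
        positive number.\<close>
      have "exp (- ?n * Hb) * ?I = iter (arcs E) next_prob (\<lambda>w. exp (- ?n * Hb) * indicator (Cl E S0) (emp w)) j [z]"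
        by (rule iter_cmult[symmetric])
      also have "\<dots> \<le> ?J"
      proof (rule iter_mono[OF next_prob_nonneg])
        fix w
        show "exp (- ?n * Hb) * indicator (Cl E S0) (emp w) \<le> exp (- ?n * h (emp w)) * indicator (Cl E S0) (emp w)"
        proof (cases "emp w \<in> Cl E S0")
          case True
          then have "h (emp w) \<le> Hb" using Hb[of "emp w"] by (auto simp: Cl_def abs_le_iff)
          then have "?n * h (emp w) \<le> ?n * Hb" by (intro mult_left_mono) auto
          then show ?thesis using True by simp
        qed simp
      qed
      finally have J0: "?J > 0" using True by (meson exp_gt_zero less_le_trans mult_pos_pos)
      have "ln ?J \<le> ln (K * (real j + L) ^ d * exp (- ?n * (c - \<epsilon>)))"
        using ub[OF elim(2)] J0 by (intro ln_mono) auto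
      also have "\<dots> = ln K + real d * ln (real j + L) - ?n * (c - \<epsilon>)"
        using K by (simp add: ln_mult ln_realpow algebra_simps)
      finally have "ln ?J / ?n \<le> (ln K + real d * ln (real j + L) - ?n * (c - \<epsilon>)) / ?n"
        by (intro divide_right_mono) auto
      also have "\<dots> = (ln K + real d * ln (real j + L)) / ?n - (c - \<epsilon>)"
        by (simp add: diff_divide_distrib del: of_nat_Suc)
      also have "\<dots> < \<epsilon> - (c - \<epsilon>)" using elim(1) by simp
      finally have "a' < - (1 / ?n) * ln ?J" by (simp add: \<epsilon>_def field_simps del: of_nat_Suc)
      then have "ereal a' < W E M X h S0 (Suc j) z" using True by (simp only: W_Suc if_True less_ereal.simps)
      with a'(1) show ?thesis by (rule less_trans)
    qed
  qed
qed

end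

theorem theorem2p26:
  fixes V :: "'v set" and E :: "'v set set" and x0 :: 'v and \<delta> :: real
    and S0 :: "'v set set set" and z :: "'v \<times> 'v"
    and M :: "'w measure" and X :: "nat \<Rightarrow> 'w \<Rightarrow> 'v"
    and h :: "('v \<times> 'v) pmf \<Rightarrow> real"
  assumes "finite V" and "simple_graph V E" and "graph_connected V E" and "card V \<ge> 3"
    and "x0 \<in> V" and "\<delta> > 0"
    and "once_reinforced_walk V E x0 \<delta> M X"
    and "S0 \<noteq> {}" and "decreasing_family E x0 S0"
    and "z \<in> arcs E" and "fst z = x0"
    and "bounded (h ` probs (arcs E))"
    and "continuous_map (weak_topology (arcs E)) euclideanreal h"
  shows "(\<lambda>n. W E M X h S0 n z) \<longlonglongrightarrow> (INF \<mu> \<in> Cl E S0. rate E x0 \<delta> z S0 \<mu> + ereal (h \<mu>))"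
proof -
  interpret reinforced_walk V E x0 \<delta> z M X
    using assms by unfold_locales
  \<comment> \<open>The empirical measure is not meaningful for \<open>n = 0\<close>, so the
    sequence is shifted by one.\<close>
  show ?thesis
  proof (rule LIMSEQ_imp_Suc, rule order_tendstoI)
    fix a
    show "\<forall>\<^sub>F j in sequentially. a < W E M X h S0 (Suc j) z"
      if "a < (INF \<mu> \<in> Cl E S0. rate E x0 \<delta> z S0 \<mu> + ereal (h \<mu>))"
      using assms(9,13,12) that by (rule W_eventually_greater)
    show "\<forall>\<^sub>F j in sequentially. W E M X h S0 (Suc j) z < a"
      if "(INF \<mu> \<in> Cl E S0. rate E x0 \<delta> z S0 \<mu> + ereal (h \<mu>)) < a"
      using assms(13,12) that by (rule W_eventually_less)
  qed
qed

end
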